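(* Let $\mathcal{C}$ be a locally cartesian closed category equipped with a model structure such that: (i) the cofibrations are exactly the monomorphisms; (ii) the pushout-product of a cofibration with a trivial cofibration is a trivial cofibration; (iii) $I$ is a good (not necessarily very good) cylinder object for the terminal object $1$, with two disjoint endpoint inclusions $\{0\},\{1\}\colon 1\rightrightarrows I$; (iv) the model structure is right proper. Let $i\colon \partial B\hookrightarrow B$ be a cofibration, let $\underline{E}\to B$ be a fibration and $\partial\underline{E}:=i^*\underline{E}\to\partial B$ its pullback, let $\partial E\to\partial B$ be a fibration and let $\partial w\colon \partial E\to\partial\underline{E}$ be a map over $\partial B$. Suppose $\partial w$ has a homotopy retraction $\partial r\colon\partial\underline{E}\to\partial E$ over $\partial B$ together with a homotopy $\partial H_r\colon \partial E\to P^I_{\partial B}(\partial E)$ over $\partial B$ with $\mathrm{ev}_0\circ\partial H_r=\partial r\circ\partial w$ and $\mathrm{ev}_1\circ\partial H_r=\mathrm{id}_{\partial E}$, and a homotopy section $\partial s\colon\partial\underline{E}\to\partial E$ over $\partial B$ together with a homotopy $\partial H_s\colon\partial\underline{E}\to P^I_{\partial B}(\partial\underline{E})$ over $\partial B$ with $\mathrm{ev}_0\circ\partial H_s=\partial w\circ\partial s$ and $\mathrm{ev}_1\circ\partial H_s=\mathrm{id}_{\partial\underline{E}}$. Let $E:=\mathsf{Glue}_{i,\underline{E}}(\partial w)$ and $w:=\mathsf{unglue}_{i,\underline{E}}(\partial w)\colon E\to\underline{E}$ (so that $i^*E\cong\partial E$ and $i^*w=\partial w$). Then: (1) there exist a map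 $r\colon\underline{E}\to E$ over $B$ and a homotopy $H_r\colon E\to P^I_B(E)$ over $B$ with $\mathrm{ev}_0\circ H_r=r\circ w$ and $\mathrm{ev}_1\circ H_r=\mathrm{id}_E$, such that the pullbacks of $r$ and $H_r$ along $i$ are $\partial r$ and $\partial H_r$; (2) there exist a map $s\colon\underline{E}\to E$ over $B$ and a homotopy $H_s\colon\underline{E}\to P^I_B(\underline{E})$ over $B$ with $\mathrm{ev}_0\circ H_s=w\circ s$ and $\mathrm{ev}_1\circ H_s=\mathrm{id}_{\underline{E}}$, such that the pullbacks of $s$ and $H_s$ along $i$ are $\partial s$ and $\partial H_s$.
   Context: "Good cylinder object for $1$" means the induced map $1\sqcup 1\to I$ is a cofibration and $I\to 1$ is a weak equivalence; the endpoints are disjoint when the pullback of $\{0\}$ and $\{1\}$ is initial. For a map $Y\to C$, the fibred path object $P^I_C(Y):=[C\times I,Y]_C$ is the local exponential in $\mathcal{C}/C$, with evaluation maps $\mathrm{ev}_0,\mathrm{ev}_1\colon P^I_C(Y)\to Y$ induced by $\{0\},\{1\}$; it is stable under pullback, so $i^*P^I_B(X)\cong P^I_{\partial B}(i^*X)$. Glue construction: for a mono $i\colon\partial B\hookrightarrow B$, an object $\underline{E}\to B$ with $\partial\underline{E}=i^*\underline{E}$, and a map $f\colon\partial E\to\partial\underline{E}$, let $i_*$ be the pushforward (right adjoint of pullback $i^*$) and $\eta\colon\underline{E}\to i_*i^*\underline{E}=i_*\partial\underline{E}$ the unit. Then $\mathsf{Glue}_{i,\underline{E}}(f)$ is the pullback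 of $i_*f\colon i_*\partial E\to i_*\partial\underline{E}$ along $\eta$, and $\mathsf{unglue}_{i,\underline{E}}(f)\colon\mathsf{Glue}_{i,\underline{E}}(f)\to\underline{E}$ is the projection. *)

theory Defs
  imports Main
begin

record ('o, 'a) cat =
  Obj :: "'o set"
  Arr :: "'a set"
  Dom :: "'a \<Rightarrow> 'o"
  Cod :: "'a \<Rightarrow> 'o"
  Id :: "'o \<Rightarrow> 'a"
  Comp :: "'a \<Rightarrow> 'a \<Rightarrow> 'a"  (infixr "\<cdot>\<index>" 70)

definition hom :: "('o, 'a) cat \<Rightarrow> 'o \<Rightarrow> 'o \<Rightarrow> 'a set" where
  "hom C X Y = {f \<in> Arr C. Dom C f = X \<and> Cod C f = Y}"

locale category =
  fixes C :: "('o, 'a) cat" (structure)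
  assumes dom_obj: "f \<in> Arr C \<Longrightarrow> Dom C f \<in> Obj C"
    and cod_obj: "f \<in> Arr C \<Longrightarrow> Cod C f \<in> Obj C"
    and id_hom: "X \<in> Obj C \<Longrightarrow> Id C X \<in> hom C X X"
    and comp_hom: "f \<in> hom C X Y \<Longrightarrow> g \<in> hom C Y Z \<Longrightarrow> g \<cdot> f \<in> hom C X Z"
    and id_left: "f \<in> hom C X Y \<Longrightarrow> Id C Y \<cdot> f = f"
    and id_right: "f \<in> hom C X Y \<Longrightarrow> f \<cdot> Id C X = f"
    and assoc: "f \<in> hom C X Y \<Longrightarrow> g \<in> hom C Y Z \<Longrightarrow> h \<in> hom C Z V \<Longrightarrow>
      (h \<cdot> g) \<cdot> f = h \<cdot> (g \<cdot> f)"

definition is_mono :: "('o, 'a) cat \<Rightarrow> 'a \<Rightarrow> bool" where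
  "is_mono C f \<longleftrightarrow> f \<in> Arr C \<and>
    (\<forall>X. \<forall>g \<in> hom C X (Dom C f). \<forall>h \<in> hom C X (Dom C f).
      f \<cdot>\<^bsub>C\<^esub> g = f \<cdot>\<^bsub>C\<^esub> h \<longrightarrow> g = h)"

definition is_iso :: "('o, 'a) cat \<Rightarrow> 'a \<Rightarrow> bool" where
  "is_iso C f \<longleftrightarrow> f \<in> Arr C \<and>
    (\<exists>g \<in> hom C (Cod C f) (Dom C f).
      g \<cdot>\<^bsub>C\<^esub> f = Id C (Dom C f) \<and> f \<cdot>\<^bsub>C\<^esub> g = Id C (Cod C f))"

definition is_terminal :: "('o, 'a) cat \<Rightarrow> 'o \<Rightarrow> bool" where
  "is_terminal C T \<longleftrightarrow> T \<in> Obj C \<and> (\<forall>X \<in> Obj C. \<exists>!f. f \<in> hom C X T)"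

definition is_initial :: "('o, 'a) cat \<Rightarrow> 'o \<Rightarrow> bool" where
  "is_initial C Z \<longleftrightarrow> Z \<in> Obj C \<and> (\<forall>X \<in> Obj C. \<exists>!f. f \<in> hom C Z X)"

definition bang :: "('o, 'a) cat \<Rightarrow> 'o \<Rightarrow> 'o \<Rightarrow> 'a" where
  "bang C T X = (THE f. f \<in> hom C X T)"

definition is_product :: "('o, 'a) cat \<Rightarrow> 'o \<Rightarrow> 'o \<Rightarrow> 'a \<Rightarrow> 'a \<Rightarrow> bool" where
  "is_product C X Y p q \<longleftrightarrow>
    p \<in> hom C (Dom C p) X \<and> q \<in> hom C (Dom C p) Y \<and>
    (\<forall>V. \<forall>u \<in> hom C V X. \<forall>v \<in> hom C V Y.
      \<exists>!m. m \<in> hom C V (Dom C p) \<and> p \<cdot>\<^bsub>C\<^esub> m = u \<and> q \<cdot>\<^bsub>C\<^esub> m = v)"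

definition is_coproduct :: "('o, 'a) cat \<Rightarrow> 'o \<Rightarrow> 'o \<Rightarrow> 'a \<Rightarrow> 'a \<Rightarrow> bool" where
  "is_coproduct C X Y j k \<longleftrightarrow>
    j \<in> hom C X (Cod C j) \<and> k \<in> hom C Y (Cod C j) \<and>
    (\<forall>V. \<forall>u \<in> hom C X V. \<forall>v \<in> hom C Y V.
      \<exists>!m. m \<in> hom C (Cod C j) V \<and> m \<cdot>\<^bsub>C\<^esub> j = u \<and> m \<cdot>\<^bsub>C\<^esub> k = v)"

text \<open>In \<open>is_pullback C p q f g\<close> the commuting square is \<open>f \<cdot> p = g \<cdot> q\<close>;
  so \<open>q\<close> is the pullback of \<open>f\<close> along \<open>g\<close>. Dually, in \<open>is_pushout C u v f g\<close>
  the square is \<open>u \<cdot> f = v \<cdot> g\<close>.\<close>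

definition is_pullback :: "('o, 'a) cat \<Rightarrow> 'a \<Rightarrow> 'a \<Rightarrow> 'a \<Rightarrow> 'a \<Rightarrow> bool" where
  "is_pullback C p q f g \<longleftrightarrow>
    f \<in> Arr C \<and> g \<in> Arr C \<and> Cod C f = Cod C g \<and>
    p \<in> hom C (Dom C p) (Dom C f) \<and> q \<in> hom C (Dom C p) (Dom C g) \<and>
    f \<cdot>\<^bsub>C\<^esub> p = g \<cdot>\<^bsub>C\<^esub> q \<and>
    (\<forall>V. \<forall>u \<in> hom C V (Dom C f). \<forall>v \<in> hom C V (Dom C g).
      f \<cdot>\<^bsub>C\<^esub> u = g \<cdot>\<^bsub>C\<^esub> v \<longrightarrow>
      (\<exists>!m. m \<in> hom C V (Dom C p) \<and> p \<cdot>\<^bsub>C\<^esub> m = u \<and> q \<cdot>\<^bsub>C\<^esub> m = v))"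

definition is_pushout :: "('o, 'a) cat \<Rightarrow> 'a \<Rightarrow> 'a \<Rightarrow> 'a \<Rightarrow> 'a \<Rightarrow> bool" where
  "is_pushout C u v f g \<longleftrightarrow>
    f \<in> Arr C \<and> g \<in> Arr C \<and> Dom C f = Dom C g \<and>
    u \<in> hom C (Cod C f) (Cod C u) \<and> v \<in> hom C (Cod C g) (Cod C u) \<and>
    u \<cdot>\<^bsub>C\<^esub> f = v \<cdot>\<^bsub>C\<^esub> g \<and>
    (\<forall>V. \<forall>h \<in> hom C (Cod C f) V. \<forall>k \<in> hom C (Cod C g) V.
      h \<cdot>\<^bsub>C\<^esub> f = k \<cdot>\<^bsub>C\<^esub> g \<longrightarrow>
      (\<exists>!m. m \<in> hom C (Cod C u) V \<and> m \<cdot>\<^bsub>C\<^esub> u = h \<and> m \<cdot>\<^bsub>C\<^esub> v = k))"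

text \<open>The map into a product or pullback with projections \<open>p\<close>, \<open>q\<close>, and the map out of
  a coproduct or pushout with injections \<open>j\<close>, \<open>k\<close>.\<close>

definition tuple :: "('o, 'a) cat \<Rightarrow> 'a \<Rightarrow> 'a \<Rightarrow> 'a \<Rightarrow> 'a \<Rightarrow> 'a" where
  "tuple C p q u v =
    (THE m. m \<in> hom C (Dom C u) (Dom C p) \<and> p \<cdot>\<^bsub>C\<^esub> m = u \<and> q \<cdot>\<^bsub>C\<^esub> m = v)"

definition cotuple :: "('o, 'a) cat \<Rightarrow> 'a \<Rightarrow> 'a \<Rightarrow> 'a \<Rightarrow> 'a \<Rightarrow> 'a" where
  "cotuple C j k u v =
    (THE m. m \<in> hom C (Cod C j) (Cod C u) \<and> m \<cdot>\<^bsub>C\<^esub> j = u \<and> m \<cdot>\<^bsub>C\<^esub> k = v)"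

definition finitely_complete :: "('o, 'a) cat \<Rightarrow> bool" where
  "finitely_complete C \<longleftrightarrow> (\<exists>T. is_terminal C T) \<and>
    (\<forall>f \<in> Arr C. \<forall>g \<in> Arr C. Cod C f = Cod C g \<longrightarrow> (\<exists>p q. is_pullback C p q f g))"

definition finitely_cocomplete :: "('o, 'a) cat \<Rightarrow> bool" where
  "finitely_cocomplete C \<longleftrightarrow> (\<exists>Z. is_initial C Z) \<and>
    (\<forall>f \<in> Arr C. \<forall>g \<in> Arr C. Dom C f = Dom C g \<longrightarrow> (\<exists>u v. is_pushout C u v f g))"

text \<open>Products, exponentials, base changes and pushforwards are chosen once and for all by
  \<open>SOME\<close>; in a locally cartesian closed category with finite limits they all exist.\<close>

definition prod_projs :: "('o, 'a) cat \<Rightarrow> 'o \<Rightarrow> 'o \<Rightarrow> 'a \<times> 'a" where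
  "prod_projs C X Y = (SOME (p, q). is_product C X Y p q)"

definition pr1 :: "('o, 'a) cat \<Rightarrow> 'o \<Rightarrow> 'o \<Rightarrow> 'a" where
  "pr1 C X Y = fst (prod_projs C X Y)"

definition pr2 :: "('o, 'a) cat \<Rightarrow> 'o \<Rightarrow> 'o \<Rightarrow> 'a" where
  "pr2 C X Y = snd (prod_projs C X Y)"

definition prod_obj :: "('o, 'a) cat \<Rightarrow> 'o \<Rightarrow> 'o \<Rightarrow> 'o" where
  "prod_obj C X Y = Dom C (pr1 C X Y)"

definition prod_map :: "('o, 'a) cat \<Rightarrow> 'a \<Rightarrow> 'a \<Rightarrow> 'a" where
  "prod_map C f g =
    tuple C (pr1 C (Cod C f) (Cod C g)) (pr2 C (Cod C f) (Cod C g))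
      (f \<cdot>\<^bsub>C\<^esub> pr1 C (Dom C f) (Dom C g)) (g \<cdot>\<^bsub>C\<^esub> pr2 C (Dom C f) (Dom C g))"

definition is_exponential :: "('o, 'a) cat \<Rightarrow> 'o \<Rightarrow> 'o \<Rightarrow> 'o \<Rightarrow> 'a \<Rightarrow> bool" where
  "is_exponential C X Y P ev \<longleftrightarrow>
    P \<in> Obj C \<and> ev \<in> hom C (prod_obj C P X) Y \<and>
    (\<forall>V \<in> Obj C. \<forall>g \<in> hom C (prod_obj C V X) Y.
      \<exists>!h. h \<in> hom C V P \<and> ev \<cdot>\<^bsub>C\<^esub> prod_map C h (Id C X) = g)"

definition cartesian_closed :: "('o, 'a) cat \<Rightarrow> bool" where
  "cartesian_closed C \<longleftrightarrow> (\<exists>T. is_terminal C T) \<and>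
    (\<forall>X \<in> Obj C. \<forall>Y \<in> Obj C. \<exists>p q. is_product C X Y p q) \<and>
    (\<forall>X \<in> Obj C. \<forall>Y \<in> Obj C. \<exists>P ev. is_exponential C X Y P ev)"

definition exp_data :: "('o, 'a) cat \<Rightarrow> 'o \<Rightarrow> 'o \<Rightarrow> 'o \<times> 'a" where
  "exp_data C X Y = (SOME (P, ev). is_exponential C X Y P ev)"

definition exp_obj :: "('o, 'a) cat \<Rightarrow> 'o \<Rightarrow> 'o \<Rightarrow> 'o" where
  "exp_obj C X Y = fst (exp_data C X Y)"

definition exp_ev :: "('o, 'a) cat \<Rightarrow> 'o \<Rightarrow> 'o \<Rightarrow> 'a" where
  "exp_ev C X Y = snd (exp_data C X Y)"

definition exp_transpose :: "('o, 'a) cat \<Rightarrow> 'o \<Rightarrow> 'o \<Rightarrow> 'o \<Rightarrow> 'a \<Rightarrow> 'a" where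
  "exp_transpose C X Y V g =
    (THE h. h \<in> hom C V (exp_obj C X Y) \<and> exp_ev C X Y \<cdot>\<^bsub>C\<^esub> prod_map C h (Id C X) = g)"

text \<open>A morphism of the slice over \<open>B\<close> is stored together with its source and target,
  so that \<open>(x, f, y)\<close> stands for \<open>f\<close> regarded as a morphism from \<open>x\<close> to \<open>y\<close> over \<open>B\<close>.\<close>

definition hom_over :: "('o, 'a) cat \<Rightarrow> 'a \<Rightarrow> 'a \<Rightarrow> 'a set" where
  "hom_over C x y = {f \<in> hom C (Dom C x) (Dom C y). y \<cdot>\<^bsub>C\<^esub> f = x}"

definition slice :: "('o, 'a) cat \<Rightarrow> 'o \<Rightarrow> ('a, 'a \<times> 'a \<times> 'a) cat" where
  "slice C B =
    \<lparr> Obj = {x \<in> Arr C. Cod C x = B},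
      Arr = {(x, f, y). x \<in> Arr C \<and> Cod C x = B \<and> y \<in> Arr C \<and> Cod C y = B \<and>
               f \<in> hom_over C x y},
      Dom = (\<lambda>(x, f, y). x),
      Cod = (\<lambda>(x, f, y). y),
      Id = (\<lambda>x. (x, Id C (Dom C x), x)),
      Comp = (\<lambda>(y', g, z) (x, f, y). (x, g \<cdot>\<^bsub>C\<^esub> f, z)) \<rparr>"

definition underlying :: "'a \<times> 'a \<times> 'a \<Rightarrow> 'a" where
  "underlying = (\<lambda>(x, f, y). f)"

definition locally_cartesian_closed :: "('o, 'a) cat \<Rightarrow> bool" where
  "locally_cartesian_closed C \<longleftrightarrow> category C \<and> (\<exists>T. is_terminal C T) \<and>
    (\<forall>B \<in> Obj C. cartesian_closed (slice C B))"

definition is_retract :: "('o, 'a) cat \<Rightarrow> 'a \<Rightarrow> 'a \<Rightarrow> bool" where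
  "is_retract C f g \<longleftrightarrow> f \<in> Arr C \<and> g \<in> Arr C \<and>
    (\<exists>s \<in> hom C (Dom C f) (Dom C g). \<exists>r \<in> hom C (Dom C g) (Dom C f).
     \<exists>s' \<in> hom C (Cod C f) (Cod C g). \<exists>r' \<in> hom C (Cod C g) (Cod C f).
      r \<cdot>\<^bsub>C\<^esub> s = Id C (Dom C f) \<and> r' \<cdot>\<^bsub>C\<^esub> s' = Id C (Cod C f) \<and>
      g \<cdot>\<^bsub>C\<^esub> s = s' \<cdot>\<^bsub>C\<^esub> f \<and> f \<cdot>\<^bsub>C\<^esub> r = r' \<cdot>\<^bsub>C\<^esub> g)"

definition has_lifting :: "('o, 'a) cat \<Rightarrow> 'a \<Rightarrow> 'a \<Rightarrow> bool" where
  "has_lifting C l r \<longleftrightarrow>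
    (\<forall>u \<in> hom C (Dom C l) (Dom C r). \<forall>v \<in> hom C (Cod C l) (Cod C r).
      r \<cdot>\<^bsub>C\<^esub> u = v \<cdot>\<^bsub>C\<^esub> l \<longrightarrow>
      (\<exists>d \<in> hom C (Cod C l) (Dom C r). d \<cdot>\<^bsub>C\<^esub> l = u \<and> r \<cdot>\<^bsub>C\<^esub> d = v))"

text \<open>Quillen's closed model axioms, which ask for finite limits and colimits only.\<close>

definition model_structure :: "('o, 'a) cat \<Rightarrow> 'a set \<Rightarrow> 'a set \<Rightarrow> 'a set \<Rightarrow> bool" where
  "model_structure C W Cof Fib \<longleftrightarrow>
    category C \<and> finitely_complete C \<and> finitely_cocomplete C \<and>
    W \<subseteq> Arr C \<and> Cof \<subseteq> Arr C \<and> Fib \<subseteq> Arr C \<and>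
    (\<forall>f \<in> Arr C. \<forall>g \<in> Arr C. Cod C f = Dom C g \<longrightarrow>
      (f \<in> W \<and> g \<in> W \<longrightarrow> g \<cdot>\<^bsub>C\<^esub> f \<in> W) \<and>
      (f \<in> W \<and> g \<cdot>\<^bsub>C\<^esub> f \<in> W \<longrightarrow> g \<in> W) \<and>
      (g \<in> W \<and> g \<cdot>\<^bsub>C\<^esub> f \<in> W \<longrightarrow> f \<in> W)) \<and>
    (\<forall>f g. is_retract C f g \<longrightarrow>
      (g \<in> W \<longrightarrow> f \<in> W) \<and> (g \<in> Cof \<longrightarrow> f \<in> Cof) \<and> (g \<in> Fib \<longrightarrow> f \<in> Fib)) \<and>
    (\<forall>l \<in> Cof \<inter> W. \<forall>r \<in> Fib. has_lifting C l r) \<and>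
    (\<forall>l \<in> Cof. \<forall>r \<in> Fib \<inter> W. has_lifting C l r) \<and>
    (\<forall>f \<in> Arr C.
      (\<exists>l \<in> Cof \<inter> W. \<exists>r \<in> Fib. Cod C l = Dom C r \<and> r \<cdot>\<^bsub>C\<^esub> l = f) \<and>
      (\<exists>l \<in> Cof. \<exists>r \<in> Fib \<inter> W. Cod C l = Dom C r \<and> r \<cdot>\<^bsub>C\<^esub> l = f))"

definition right_proper :: "('o, 'a) cat \<Rightarrow> 'a set \<Rightarrow> 'a set \<Rightarrow> bool" where
  "right_proper C W Fib \<longleftrightarrow>
    (\<forall>p q f g. is_pullback C p q f g \<and> f \<in> W \<and> g \<in> Fib \<longrightarrow> q \<in> W)"

text \<open>For \<open>f : A \<rightarrow> B\<close> and \<open>g : X \<rightarrow> Y\<close>, the map from a pushout of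
  \<open>A \<times> Y\<close> and \<open>B \<times> X\<close> under \<open>A \<times> X\<close> to \<open>B \<times> Y\<close>.\<close>

definition is_pushout_product :: "('o, 'a) cat \<Rightarrow> 'a \<Rightarrow> 'a \<Rightarrow> 'a \<Rightarrow> bool" where
  "is_pushout_product C f g h \<longleftrightarrow> f \<in> Arr C \<and> g \<in> Arr C \<and>
    (\<exists>u v. is_pushout C u v (prod_map C (Id C (Dom C f)) g) (prod_map C f (Id C (Dom C g))) \<and>
      h = cotuple C u v (prod_map C f (Id C (Cod C g))) (prod_map C (Id C (Cod C f)) g))"

definition good_cylinder_of_terminal ::
  "('o, 'a) cat \<Rightarrow> 'a set \<Rightarrow> 'a set \<Rightarrow> 'o \<Rightarrow> 'o \<Rightarrow> 'a \<Rightarrow> 'a \<Rightarrow> bool" where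
  "good_cylinder_of_terminal C W Cof T I d0 d1 \<longleftrightarrow>
    is_terminal C T \<and> d0 \<in> hom C T I \<and> d1 \<in> hom C T I \<and>
    (\<exists>j k. is_coproduct C T T j k \<and> cotuple C j k d0 d1 \<in> Cof) \<and>
    bang C T I \<in> W"

definition disjoint_points :: "('o, 'a) cat \<Rightarrow> 'a \<Rightarrow> 'a \<Rightarrow> bool" where
  "disjoint_points C d0 d1 \<longleftrightarrow> (\<exists>p q. is_pullback C p q d0 d1 \<and> is_initial C (Dom C p))"

text \<open>An object over \<open>B\<close> is given by its structure map \<open>x\<close>. For \<open>i\<close> with codomain \<open>B\<close>,
  \<open>base_change C i x\<close> is the structure map of \<open>i\<^sup>*x\<close> over the domain of \<open>i\<close>, and
  \<open>base_change_top C i x\<close> is the projection to the domain of \<open>x\<close>.\<close>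

definition base_change_data :: "('o, 'a) cat \<Rightarrow> 'a \<Rightarrow> 'a \<Rightarrow> 'a \<times> 'a" where
  "base_change_data C i x = (SOME (p, q). is_pullback C p q x i)"

definition base_change_top :: "('o, 'a) cat \<Rightarrow> 'a \<Rightarrow> 'a \<Rightarrow> 'a" where
  "base_change_top C i x = fst (base_change_data C i x)"

definition base_change :: "('o, 'a) cat \<Rightarrow> 'a \<Rightarrow> 'a \<Rightarrow> 'a" where
  "base_change C i x = snd (base_change_data C i x)"

definition base_change_map :: "('o, 'a) cat \<Rightarrow> 'a \<Rightarrow> 'a \<Rightarrow> 'a \<Rightarrow> 'a \<Rightarrow> 'a" where
  "base_change_map C i x y f =
    tuple C (base_change_top C i y) (base_change C i y)
      (f \<cdot>\<^bsub>C\<^esub> base_change_top C i x) (base_change C i x)"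

text \<open>The value \<open>p = i\<^sub>*y\<close> of the right adjoint of base change along \<open>i\<close>, with the component
  \<open>c : i\<^sup>*i\<^sub>*y \<rightarrow> y\<close> of the counit as universal arrow.\<close>

definition is_pushforward :: "('o, 'a) cat \<Rightarrow> 'a \<Rightarrow> 'a \<Rightarrow> 'a \<Rightarrow> 'a \<Rightarrow> bool" where
  "is_pushforward C i y p c \<longleftrightarrow>
    p \<in> Arr C \<and> Cod C p = Cod C i \<and> c \<in> hom_over C (base_change C i p) y \<and>
    (\<forall>x \<in> Arr C. Cod C x = Cod C i \<longrightarrow>
      (\<forall>g \<in> hom_over C (base_change C i x) y.
        \<exists>!h. h \<in> hom_over C x p \<and> c \<cdot>\<^bsub>C\<^esub> base_change_map C i x p h = g))"

definition pushforward_data :: "('o, 'a) cat \<Rightarrow> 'a \<Rightarrow> 'a \<Rightarrow> 'a \<times> 'a" where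
  "pushforward_data C i y = (SOME (p, c). is_pushforward C i y p c)"

definition pushforward :: "('o, 'a) cat \<Rightarrow> 'a \<Rightarrow> 'a \<Rightarrow> 'a" where
  "pushforward C i y = fst (pushforward_data C i y)"

definition pushforward_counit :: "('o, 'a) cat \<Rightarrow> 'a \<Rightarrow> 'a \<Rightarrow> 'a" where
  "pushforward_counit C i y = snd (pushforward_data C i y)"

definition pushforward_transpose :: "('o, 'a) cat \<Rightarrow> 'a \<Rightarrow> 'a \<Rightarrow> 'a \<Rightarrow> 'a \<Rightarrow> 'a" where
  "pushforward_transpose C i x y g =
    (THE h. h \<in> hom_over C x (pushforward C i y) \<and>
      pushforward_counit C i y \<cdot>\<^bsub>C\<^esub> base_change_map C i x (pushforward C i y) h = g)"

definition pushforward_map :: "('o, 'a) cat \<Rightarrow> 'a \<Rightarrow> 'a \<Rightarrow> 'a \<Rightarrow> 'a \<Rightarrow> 'a" where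
  "pushforward_map C i x y f =
    pushforward_transpose C i (pushforward C i x) y (f \<cdot>\<^bsub>C\<^esub> pushforward_counit C i x)"

definition pushforward_unit :: "('o, 'a) cat \<Rightarrow> 'a \<Rightarrow> 'a \<Rightarrow> 'a" where
  "pushforward_unit C i x =
    pushforward_transpose C i x (base_change C i x) (Id C (Dom C (base_change C i x)))"

definition cylinder_over :: "('o, 'a) cat \<Rightarrow> 'o \<Rightarrow> 'o \<Rightarrow> 'a" where
  "cylinder_over C I B = pr1 C B I"

definition path_obj :: "('o, 'a) cat \<Rightarrow> 'o \<Rightarrow> 'a \<Rightarrow> 'a" where
  "path_obj C I y = exp_obj (slice C (Cod C y)) (cylinder_over C I (Cod C y)) y"

definition path_eval :: "('o, 'a) cat \<Rightarrow> 'o \<Rightarrow> 'a \<Rightarrow> 'a" where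
  "path_eval C I y = underlying (exp_ev (slice C (Cod C y)) (cylinder_over C I (Cod C y)) y)"

text \<open>The projections of the product of \<open>p\<close> and \<open>B \<times> I\<close> in the slice over \<open>B\<close>.\<close>

definition cyl_pr1 :: "('o, 'a) cat \<Rightarrow> 'o \<Rightarrow> 'a \<Rightarrow> 'a" where
  "cyl_pr1 C I p = underlying (pr1 (slice C (Cod C p)) p (cylinder_over C I (Cod C p)))"

definition cyl_pr2 :: "('o, 'a) cat \<Rightarrow> 'o \<Rightarrow> 'a \<Rightarrow> 'a" where
  "cyl_pr2 C I p = underlying (pr2 (slice C (Cod C p)) p (cylinder_over C I (Cod C p)))"

definition path_transpose :: "('o, 'a) cat \<Rightarrow> 'o \<Rightarrow> 'a \<Rightarrow> 'a \<Rightarrow> 'a \<Rightarrow> 'a" where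
  "path_transpose C I y x g =
    (let S = slice C (Cod C y); X = cylinder_over C I (Cod C y)
     in underlying (exp_transpose S X y x (prod_obj S x X, g, y)))"

text \<open>Evaluation at a point \<open>d : 1 \<rightarrow> I\<close>: the point gives a section \<open>B \<rightarrow> B \<times> I\<close>, and
  evaluation is restricted along it.\<close>

definition path_ev :: "('o, 'a) cat \<Rightarrow> 'o \<Rightarrow> 'a \<Rightarrow> 'a \<Rightarrow> 'a" where
  "path_ev C I d y =
    (let p = path_obj C I y; B = Cod C y;
         sec = tuple C (pr1 C B I) (pr2 C B I) (Id C B) (d \<cdot>\<^bsub>C\<^esub> bang C (Dom C d) B)
     in path_eval C I y \<cdot>\<^bsub>C\<^esub>
          tuple C (cyl_pr1 C I p) (cyl_pr2 C I p) (Id C (Dom C p)) (sec \<cdot>\<^bsub>C\<^esub> p))"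

definition path_map :: "('o, 'a) cat \<Rightarrow> 'o \<Rightarrow> 'a \<Rightarrow> 'a \<Rightarrow> 'a \<Rightarrow> 'a" where
  "path_map C I y z f = path_transpose C I z (path_obj C I y) (f \<cdot>\<^bsub>C\<^esub> path_eval C I y)"

text \<open>The canonical comparison from the base change along \<open>i\<close> of the path object of \<open>y\<close> to the
  path object of the base change of \<open>y\<close>: the transpose of the base change of evaluation.\<close>

definition path_base_change :: "('o, 'a) cat \<Rightarrow> 'o \<Rightarrow> 'a \<Rightarrow> 'a \<Rightarrow> 'a" where
  "path_base_change C I i y =
    (let p = path_obj C I y; p' = base_change C i p;
         m = tuple C (cyl_pr1 C I p) (cyl_pr2 C I p)
               (base_change_top C i p \<cdot>\<^bsub>C\<^esub> cyl_pr1 C I p')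
               (prod_map C i (Id C I) \<cdot>\<^bsub>C\<^esub> cyl_pr2 C I p')
     in path_transpose C I (base_change C i y) p'
          (tuple C (base_change_top C i y) (base_change C i y)
            (path_eval C I y \<cdot>\<^bsub>C\<^esub> m) (p' \<cdot>\<^bsub>C\<^esub> cyl_pr1 C I p')))"

text \<open>Here \<open>e\<close> is an object over \<open>B\<close>, \<open>a\<close> an object over the domain of \<open>i\<close>, and \<open>f\<close> a map
  from \<open>a\<close> to \<open>i\<^sup>*e\<close>. The pullback of \<open>i\<^sub>*f\<close> along the unit is formed with \<open>base_change\<close>, so that
  \<open>unglue\<close> is its projection to the domain of \<open>e\<close> and \<open>glue_top\<close> its projection to
  the domain of \<open>i\<^sub>*a\<close>; \<open>glue\<close> is the structure map over \<open>B\<close>.\<close>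

definition unglue :: "('o, 'a) cat \<Rightarrow> 'a \<Rightarrow> 'a \<Rightarrow> 'a \<Rightarrow> 'a \<Rightarrow> 'a" where
  "unglue C i e a f =
    base_change C (pushforward_unit C i e) (pushforward_map C i a (base_change C i e) f)"

definition glue_top :: "('o, 'a) cat \<Rightarrow> 'a \<Rightarrow> 'a \<Rightarrow> 'a \<Rightarrow> 'a \<Rightarrow> 'a" where
  "glue_top C i e a f =
    base_change_top C (pushforward_unit C i e) (pushforward_map C i a (base_change C i e) f)"

definition glue :: "('o, 'a) cat \<Rightarrow> 'a \<Rightarrow> 'a \<Rightarrow> 'a \<Rightarrow> 'a \<Rightarrow> 'a" where
  "glue C i e a f = e \<cdot>\<^bsub>C\<^esub> unglue C i e a f"

text \<open>The canonical comparison from the base change of the glue object along \<open>i\<close> to \<open>a\<close>: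
  the adjoint transpose of \<open>glue_top\<close>.\<close>

definition glue_restrict :: "('o, 'a) cat \<Rightarrow> 'a \<Rightarrow> 'a \<Rightarrow> 'a \<Rightarrow> 'a \<Rightarrow> 'a" where
  "glue_restrict C i e a f =
    pushforward_counit C i a \<cdot>\<^bsub>C\<^esub>
      base_change_map C i (glue C i e a f) (pushforward C i a) (glue_top C i e a f)"

end

theory Submission
  imports Defs
begin

text \<open>
  A homotopy is a map out of a cylinder, and a map over \<open>B\<close> into the glue object is a map to \<open>e\<close> together with
  a lift to \<open>a\<close> of its restriction along \<open>i\<close>. The homotopy section is therefore obtained by extending
  the given homotopy along the pushout product of \<open>i\<^sup>*e \<rightarrow> e\<close> with \<open>{1} \<rightarrow> I\<close>, against the fibration \<open>e\<close>.

  The homotopy retraction is a map to \<open>e\<close> out of the mapping cylinder \<open>M\<close> of \<open>w\<close>, prescribed on the union of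
  the restriction of \<open>M\<close> along \<open>i\<close> with the free end of \<open>M\<close>. Since colimits are stable under pullback, this union is a
  subobject (the ends of the cylinder are disjoint), and its inclusion is a weak equivalence as soon as \<open>dw\<close> and \<open>w\<close>
  are. For \<open>dw\<close>, factor it as a trivial cofibration followed by a fibration \<open>p\<close>: the homotopy section
  yields a strict section of \<open>p\<close>, and the homotopy retraction then makes \<open>p\<close> a retract of a weak equivalence.
  For \<open>w\<close>, factor it as a cofibration \<open>k\<close> followed by a trivial fibration: the restriction of \<open>k\<close> along \<open>i\<close> is a
  trivial cofibration between fibrant objects, so it has a deformation retraction, and this extends to \<open>k\<close>.
\<close>

text \<open>The two halves are not symmetric. A homotopy section ends at an identity, so its value
  at the end \<open>1\<close> is known on the whole total space and only the end \<open>0\<close>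
  has to be found: a single extension problem. For a homotopy retraction the value at the end
  \<open>0\<close> must moreover factor through \<open>w\<close>, so the cylinder has to be
  collapsed along \<open>w\<close> at that end before lifting. The inclusion to be lifted is then no
  evident pushout product, and its acyclicity has to come from \<open>w\<close> and
  \<open>dw\<close> themselves. Fibrancy of the glue object over \<open>B\<close> is never
  established. Every lifting problem is posed against \<open>e\<close>, against \<open>a\<close>, or
  against a factor of a factorization, and maps into the glue object are assembled afterwards from
  its universal property. Stability of pushouts rests on local cartesian closure: pulling back along
  \<open>z\<close> is taking the product with \<open>z\<close> in a slice, and slice exponentials
  make this a left adjoint.\<close>

context category
begin

section \<open>Arrows, monomorphisms and rewriting under composition\<close>

lemma homD:
  assumes "f \<in> hom C X Y"
  shows "f \<in> Arr C" "Dom C f = X" "Cod C f = Y" "X \<in> Obj C" "Y \<in> Obj C"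
  using assms dom_obj cod_obj by (auto simp: hom_def)

lemma homI: "f \<in> Arr C \<Longrightarrow> Dom C f = X \<Longrightarrow> Cod C f = Y \<Longrightarrow> f \<in> hom C X Y"
  by (simp add: hom_def)

text \<open>Typing is given by equations for \<open>Dom\<close> and \<open>Cod\<close>, so that the
  simplifier discharges the side conditions of composition by rewriting; facts stated with
  \<open>hom\<close> are unfolded by \<open>homD\<close> before they enter the simpset.\<close>

lemma comp_simps [simp]:
  assumes "f \<in> Arr C" "g \<in> Arr C" "Cod C f = Dom C g"
  shows "g \<cdot> f \<in> Arr C" "Dom C (g \<cdot> f) = Dom C f" "Cod C (g \<cdot> f) = Cod C g"
  using comp_hom[of f "Dom C f" "Cod C f" g "Cod C g"] assms by (auto simp: hom_def)

lemma assoc_simp [simp]: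
  assumes "f \<in> Arr C" "g \<in> Arr C" "h \<in> Arr C" "Cod C f = Dom C g" "Cod C g = Dom C h"
  shows "(h \<cdot> g) \<cdot> f = h \<cdot> (g \<cdot> f)"
  using assoc[of f "Dom C f" "Cod C f" g "Cod C g" h "Cod C h"] assms by (auto simp: hom_def)

lemma id_simps [simp]:
  assumes "X \<in> Obj C"
  shows "Id C X \<in> Arr C" "Dom C (Id C X) = X" "Cod C (Id C X) = X"
  using id_hom[OF assms] by (auto simp: hom_def)

lemma id_comp [simp]:
  assumes "f \<in> Arr C"
  shows "Cod C f = X \<Longrightarrow> Id C X \<cdot> f = f" "Dom C f = X \<Longrightarrow> f \<cdot> Id C X = f"
  using id_left[of f "Dom C f" "Cod C f"] id_right[of f "Dom C f" "Cod C f"] assms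
  by (auto simp: hom_def)

lemma dom_cod_obj [simp]:
  assumes "f \<in> Arr C" shows "Dom C f \<in> Obj C" "Cod C f \<in> Obj C"
  using assms dom_obj cod_obj by auto

text \<open>\<open>assoc_simp\<close> nests composites to the right, so an equation with left side
  \<open>g \<cdot> f\<close> no longer matches once another arrow stands to its right. This rule and
  \<open>reassoc2\<close> restate such an equation with an arbitrary tail \<open>x\<close>.\<close>

lemma reassoc:
  assumes "g \<cdot> f = k" "f \<in> hom C X Y" "g \<in> hom C Y Z" "Cod C x = X" "x \<in> Arr C"
  shows "g \<cdot> (f \<cdot> x) = k \<cdot> x"
proof -
  have "(g \<cdot> f) \<cdot> x = g \<cdot> (f \<cdot> x)" using assms(2-5) by (intro assoc_simp) (auto simp: hom_def)
  then show ?thesis using assms(1) by simp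
qed

lemma reassoc2:
  assumes "g \<cdot> f = k \<cdot> h" "f \<in> hom C X Y" "g \<in> hom C Y Z" "h \<in> hom C X Y'" "k \<in> hom C Y' Z"
    "Cod C x = X" "x \<in> Arr C"
  shows "g \<cdot> (f \<cdot> x) = k \<cdot> (h \<cdot> x)"
  using reassoc[OF assms(1,2,3,6,7)] assms by (simp add: hom_def)

lemma monoI:
  assumes "f \<in> hom C X Y"
    and "\<And>V g h. g \<in> hom C V X \<Longrightarrow> h \<in> hom C V X \<Longrightarrow> f \<cdot> g = f \<cdot> h \<Longrightarrow> g = h"
  shows "is_mono C f"
  using assms by (auto simp: is_mono_def hom_def)

lemma monoD:
  assumes "is_mono C f" "f \<in> hom C X Y" "g \<in> hom C V X" "h \<in> hom C V X" "f \<cdot> g = f \<cdot> h"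
  shows "g = h"
  using assms unfolding is_mono_def by (auto simp: hom_def)

lemma mono_comp:
  assumes "is_mono C f" "is_mono C g" "f \<in> hom C X Y" "g \<in> hom C Y Z"
  shows "is_mono C (g \<cdot> f)"
proof (rule monoI)
  show "g \<cdot> f \<in> hom C X Z" using assms comp_hom by blast
  fix V u v assume u: "u \<in> hom C V X" and v: "v \<in> hom C V X" and eq: "(g \<cdot> f) \<cdot> u = (g \<cdot> f) \<cdot> v"
  have "g \<cdot> (f \<cdot> u) = g \<cdot> (f \<cdot> v)" using eq u v assms(3,4) by (simp add: hom_def)
  then have "f \<cdot> u = f \<cdot> v" using monoD[OF assms(2,4)] comp_hom[OF u assms(3)] comp_hom[OF v assms(3)] by blast
  then show "u = v" using monoD[OF assms(1,3) u v] by blast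
qed

lemma split_mono:
  assumes "f \<in> hom C X Y" "g \<in> hom C Y X" "g \<cdot> f = Id C X"
  shows "is_mono C f"
proof (rule monoI[OF assms(1)])
  fix V u v assume u: "u \<in> hom C V X" and v: "v \<in> hom C V X" and eq: "f \<cdot> u = f \<cdot> v"
  have "g \<cdot> (f \<cdot> u) = u" "g \<cdot> (f \<cdot> v) = v" using reassoc[OF assms(3,1,2)] u v by (auto simp: hom_def)
  then show "u = v" using eq by metis
qed

subsection \<open>Pullbacks\<close>

lemma pbD:
  assumes "is_pullback C p q f g"
  shows "f \<in> Arr C" "g \<in> Arr C" "Cod C g = Cod C f" "p \<in> Arr C" "q \<in> Arr C"
    "Dom C q = Dom C p" "Cod C p = Dom C f" "Cod C q = Dom C g" "f \<cdot> p = g \<cdot> q"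
  using assms by (auto simp: is_pullback_def hom_def)

lemma pb_map:
  assumes "is_pullback C p q f g" "u \<in> hom C V (Dom C f)" "v \<in> hom C V (Dom C g)" "f \<cdot> u = g \<cdot> v"
  shows "\<exists>m. m \<in> hom C V (Dom C p) \<and> p \<cdot> m = u \<and> q \<cdot> m = v"
  using assms unfolding is_pullback_def by blast

lemma pb_uniq:
  assumes "is_pullback C p q f g" "m \<in> hom C V (Dom C p)" "n \<in> hom C V (Dom C p)"
    "p \<cdot> m = p \<cdot> n" "q \<cdot> m = q \<cdot> n"
  shows "m = n"
proof -
  note D = pbD[OF assms(1)]
  have "p \<cdot> n \<in> hom C V (Dom C f)" "q \<cdot> n \<in> hom C V (Dom C g)"
    using D assms(3) by (auto simp: hom_def)
  moreover have "f \<cdot> (p \<cdot> n) = g \<cdot> (q \<cdot> n)"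
    using reassoc2[OF D(9), of "Dom C p" "Dom C f" _ "Dom C g"] D assms(3) by (auto simp: hom_def)
  ultimately have "\<exists>!m. m \<in> hom C V (Dom C p) \<and> p \<cdot> m = p \<cdot> n \<and> q \<cdot> m = q \<cdot> n"
    using assms(1) unfolding is_pullback_def by blast
  then show ?thesis using assms by metis
qed

lemma pb_tuple:
  assumes "is_pullback C p q f g" "u \<in> hom C V (Dom C f)" "v \<in> hom C V (Dom C g)" "f \<cdot> u = g \<cdot> v"
  shows "tuple C p q u v \<in> hom C V (Dom C p)" "p \<cdot> tuple C p q u v = u" "q \<cdot> tuple C p q u v = v"
proof -
  have V: "Dom C u = V" using assms(2) by (simp add: hom_def)
  have "\<exists>!m. m \<in> hom C V (Dom C p) \<and> p \<cdot> m = u \<and> q \<cdot> m = v"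
    using assms unfolding is_pullback_def by blast
  from theI'[OF this] show "tuple C p q u v \<in> hom C V (Dom C p)" "p \<cdot> tuple C p q u v = u" "q \<cdot> tuple C p q u v = v"
    unfolding tuple_def V by auto
qed

lemma pb_tuple_eq:
  assumes "is_pullback C p q f g" "m \<in> hom C V (Dom C p)" "p \<cdot> m = u" "q \<cdot> m = v"
  shows "tuple C p q u v = m"
proof -
  note D = pbD[OF assms(1)]
  have uv: "u \<in> hom C V (Dom C f)" "v \<in> hom C V (Dom C g)"
    using D assms by (auto simp: hom_def)
  have e: "f \<cdot> u = g \<cdot> v"
    using reassoc2[OF D(9), of "Dom C p" "Dom C f" _ "Dom C g" m] D assms by (auto simp: hom_def)
  note t = pb_tuple[OF assms(1) uv e]
  show ?thesis by (rule pb_uniq[OF assms(1) t(1) assms(2)]) (use t assms in auto)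
qed

lemma pbI:
  assumes "f \<in> hom C X Y" "g \<in> hom C Z Y" "p \<in> hom C P X" "q \<in> hom C P Z" "f \<cdot> p = g \<cdot> q"
    and "\<And>V u v. u \<in> hom C V X \<Longrightarrow> v \<in> hom C V Z \<Longrightarrow> f \<cdot> u = g \<cdot> v \<Longrightarrow>
      \<exists>m. m \<in> hom C V P \<and> p \<cdot> m = u \<and> q \<cdot> m = v"
    and "\<And>V m n. m \<in> hom C V P \<Longrightarrow> n \<in> hom C V P \<Longrightarrow> p \<cdot> m = p \<cdot> n \<Longrightarrow> q \<cdot> m = q \<cdot> n \<Longrightarrow> m = n"
  shows "is_pullback C p q f g"
proof -
  note D = homD[OF assms(1)] homD[OF assms(2)] homD[OF assms(3)] homD[OF assms(4)]
  show ?thesis unfolding is_pullback_def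
  proof (intro conjI allI ballI impI)
    fix V u v assume "u \<in> hom C V (Dom C f)" "v \<in> hom C V (Dom C g)" "f \<cdot> u = g \<cdot> v"
    then obtain m where m: "m \<in> hom C V P" "p \<cdot> m = u" "q \<cdot> m = v" using assms(6) D by metis
    then show "\<exists>!m. m \<in> hom C V (Dom C p) \<and> p \<cdot> m = u \<and> q \<cdot> m = v"
      using assms(7) D by metis
  qed (use assms D in auto)
qed

lemma pb_sym:
  assumes "is_pullback C p q f g" shows "is_pullback C q p g f"
proof -
  note D = pbD[OF assms]
  show ?thesis
  proof (rule pbI[of _ "Dom C g" "Cod C f" _ "Dom C f" _ "Dom C p"])
    fix V u v assume "u \<in> hom C V (Dom C g)" "v \<in> hom C V (Dom C f)" "g \<cdot> u = f \<cdot> v"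
    then show "\<exists>m. m \<in> hom C V (Dom C p) \<and> q \<cdot> m = u \<and> p \<cdot> m = v"
      using pb_map[OF assms, of v V u] by auto
  qed (use D pb_uniq[OF assms] in \<open>auto simp: homI\<close>)
qed

lemma pb_paste:
  assumes pb: "is_pullback C p q f g" and pb': "is_pullback C p' q' q h"
  shows "is_pullback C (p \<cdot> p') q' f (g \<cdot> h)"
proof -
  note D [simp] = pbD(1-8)[OF pb] pbD(1-8)[OF pb'] and S = pbD(9)[OF pb] and S' = pbD(9)[OF pb']
  have h: "Cod C h = Dom C g" using D by metis
  have S1: "f \<cdot> (p \<cdot> x) = g \<cdot> (q \<cdot> x)" if "Cod C x = Dom C p" "x \<in> Arr C" for x
    using reassoc2[OF S _ _ _ _ that, of "Dom C f" _ "Dom C g"] by (auto simp: hom_def)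
  have S2: "q \<cdot> (p' \<cdot> x) = h \<cdot> (q' \<cdot> x)" if "Cod C x = Dom C p'" "x \<in> Arr C" for x
    using reassoc2[OF S' _ _ _ _ that, of "Dom C p" _ "Dom C h"] h by (auto simp: hom_def)
  show ?thesis
  proof (rule pbI[of _ "Dom C f" "Cod C f" _ "Dom C h" _ "Dom C p'"])
    show "f \<in> hom C (Dom C f) (Cod C f)" "g \<cdot> h \<in> hom C (Dom C h) (Cod C f)"
      "p \<cdot> p' \<in> hom C (Dom C p') (Dom C f)" "q' \<in> hom C (Dom C p') (Dom C h)"
      using h by (auto simp: hom_def)
    show "f \<cdot> p \<cdot> p' = (g \<cdot> h) \<cdot> q'" using S1[of p'] S' h by simp
  next
    fix V u v assume u: "u \<in> hom C V (Dom C f)" and v: "v \<in> hom C V (Dom C h)" and e: "f \<cdot> u = (g \<cdot> h) \<cdot> v"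
    note uv [simp] = homD[OF u] homD[OF v]
    obtain m where m: "m \<in> hom C V (Dom C p)" "p \<cdot> m = u" "q \<cdot> m = h \<cdot> v"
      using pb_map[OF pb u, of "h \<cdot> v"] e h by (auto simp: hom_def)
    obtain n where n: "n \<in> hom C V (Dom C p')" "p' \<cdot> n = m" "q' \<cdot> n = v"
      using pb_map[OF pb' _ v, of m] m v by (auto simp: hom_def)
    show "\<exists>m. m \<in> hom C V (Dom C p') \<and> (p \<cdot> p') \<cdot> m = u \<and> q' \<cdot> m = v"
      using m n by (intro exI[of _ n]) (auto simp: hom_def)
  next
    fix V m n assume m: "m \<in> hom C V (Dom C p')" and n: "n \<in> hom C V (Dom C p')"
      and e: "(p \<cdot> p') \<cdot> m = (p \<cdot> p') \<cdot> n" "q' \<cdot> m = q' \<cdot> n"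
    note uv [simp] = homD[OF m] homD[OF n]
    have "p' \<cdot> m = p' \<cdot> n"
      by (rule pb_uniq[OF pb, of _ V]) (use e S2[of m] S2[of n] in \<open>auto simp: hom_def\<close>)
    then show "m = n" using pb_uniq[OF pb' m n] e by blast
  qed
qed

text \<open>A cone \<open>u\<close>, \<open>v\<close> on the smaller square becomes a cone on the
  outer one by composing with \<open>p\<close>; the mediating map is compared with \<open>u\<close>
  through the joint injectivity of \<open>p\<close> and \<open>q\<close>. The composite
  \<open>p \<cdot> p'\<close> appears as a separate arrow \<open>r\<close> so that the outer square
  may be supplied in any syntactic form.\<close>

lemma pb_cancel:
  assumes pb: "is_pullback C p q f g" and pb': "is_pullback C r q' f (g \<cdot> h)"
    and h: "h \<in> hom C Z' (Dom C g)"
    and p': "p' \<in> hom C (Dom C r) (Dom C p)" and e1: "p \<cdot> p' = r" and e2: "q \<cdot> p' = h \<cdot> q'"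
  shows "is_pullback C p' q' q h"
proof -
  note [simp] = homD[OF h] homD[OF p']
  note D [simp] = pbD(1-8)[OF pb] pbD(1-8)[OF pb'] and S = pbD(9)[OF pb] and S' = pbD(9)[OF pb']
  have q': "Cod C q' = Z'" using D by simp
  have E1: "p \<cdot> (p' \<cdot> x) = r \<cdot> x" if "Cod C x = Dom C r" "x \<in> Arr C" for x
    using reassoc[OF e1 p' _ that, of "Dom C f"] by (auto simp: hom_def)
  have E2: "q \<cdot> (p' \<cdot> x) = h \<cdot> (q' \<cdot> x)" if "Cod C x = Dom C r" "x \<in> Arr C" for x
    using reassoc2[OF e2 p' _ _ h that, of ] q' by (auto simp: hom_def)
  have S1: "f \<cdot> (p \<cdot> x) = g \<cdot> (q \<cdot> x)" if "Cod C x = Dom C p" "x \<in> Arr C" for x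
    using reassoc2[OF S _ _ _ _ that, of "Dom C f" _ "Dom C g"] by (auto simp: hom_def)
  show ?thesis
  proof (rule pbI[of _ "Dom C p" "Dom C g" _ Z' _ "Dom C r"])
    fix V u v assume u: "u \<in> hom C V (Dom C p)" and v: "v \<in> hom C V Z'" and e: "q \<cdot> u = h \<cdot> v"
    note [simp] = homD[OF u] homD[OF v]
    have "f \<cdot> (p \<cdot> u) = (g \<cdot> h) \<cdot> v" using S1[of u] e by simp
    then obtain m where m: "m \<in> hom C V (Dom C r)" "r \<cdot> m = p \<cdot> u" "q' \<cdot> m = v"
      using pb_map[OF pb', of "p \<cdot> u" V v] by (auto simp: hom_def)
    note [simp] = homD[OF m(1)]
    have "p' \<cdot> m = u" by (rule pb_uniq[OF pb, of _ V]) (use m e E1[of m] E2[of m] in \<open>auto simp: hom_def\<close>)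
    then show "\<exists>m. m \<in> hom C V (Dom C r) \<and> p' \<cdot> m = u \<and> q' \<cdot> m = v" using m by auto
  next
    fix V m n assume m: "m \<in> hom C V (Dom C r)" and n: "n \<in> hom C V (Dom C r)"
      and e: "p' \<cdot> m = p' \<cdot> n" "q' \<cdot> m = q' \<cdot> n"
    note [simp] = homD[OF m] homD[OF n]
    have "r \<cdot> m = r \<cdot> n" using E1[of m] E1[of n] e by simp
    then show "m = n" using pb_uniq[OF pb' m n] e by blast
  qed (use q' e2 in \<open>auto simp: hom_def\<close>)
qed

lemma pb_mono:
  assumes pb: "is_pullback C p q f g" and g: "is_mono C g"
  shows "is_mono C p"
proof -
  note D [simp] = pbD(1-8)[OF pb] and S = pbD(9)[OF pb]
  have S1: "f \<cdot> (p \<cdot> x) = g \<cdot> (q \<cdot> x)" if "Cod C x = Dom C p" "x \<in> Arr C" for x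
    using reassoc2[OF S _ _ _ _ that, of "Dom C f" _ "Dom C g"] by (auto simp: hom_def)
  show ?thesis
  proof (rule monoI[of _ "Dom C p" "Dom C f"])
    fix V m n assume m: "m \<in> hom C V (Dom C p)" and n: "n \<in> hom C V (Dom C p)" and e: "p \<cdot> m = p \<cdot> n"
    note [simp] = homD[OF m] homD[OF n]
    have "g \<cdot> (q \<cdot> m) = g \<cdot> (q \<cdot> n)" using S1[of m] S1[of n] unfolding e by simp
    then have "q \<cdot> m = q \<cdot> n" using monoD[OF g, of "Dom C g" "Cod C g" "q \<cdot> m" V "q \<cdot> n"] by (auto simp: hom_def)
    then show "m = n" using pb_uniq[OF pb m n e] by blast
  qed (auto simp: hom_def)
qed

lemma pb_id:
  assumes "f \<in> hom C X Y"
  shows "is_pullback C f (Id C X) (Id C Y) f"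
proof -
  note [simp] = homD[OF assms]
  show ?thesis
    by (rule pbI[of _ Y Y _ X _ X]) (auto simp: hom_def)
qed

text \<open>Because \<open>i\<close> cancels, restricting along \<open>i\<close> an object that
  already lives over \<open>D\<close> changes nothing. This lets universal properties stated over
  \<open>B\<close> be applied to objects over \<open>D\<close>.\<close>

lemma pb_along_mono:
  assumes i: "is_mono C i" "i \<in> hom C D B" and b: "b \<in> hom C V D"
  shows "is_pullback C (Id C V) b (i \<cdot> b) i"
proof -
  note [simp] = homD[OF i(2)] homD[OF b]
  show ?thesis
  proof (rule pbI[of _ V B _ D _ V])
    fix V' u v assume u: "u \<in> hom C V' V" and v: "v \<in> hom C V' D" and e: "(i \<cdot> b) \<cdot> u = i \<cdot> v"
    note [simp] = homD[OF u] homD[OF v]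
    have "b \<cdot> u = v" by (rule monoD[OF i, of _ V']) (use e in \<open>simp_all add: hom_def\<close>)
    then show "\<exists>m. m \<in> hom C V' V \<and> Id C V \<cdot> m = u \<and> b \<cdot> m = v" using u by auto
  next
    fix V' m n assume "m \<in> hom C V' V" "n \<in> hom C V' V" "Id C V \<cdot> m = Id C V \<cdot> n"
    then show "m = n" by (simp add: hom_def)
  qed (simp_all add: hom_def)
qed

subsection \<open>Pushouts\<close>

lemma poD:
  assumes "is_pushout C u v f g"
  shows "f \<in> Arr C" "g \<in> Arr C" "Dom C g = Dom C f" "u \<in> Arr C" "v \<in> Arr C"
    "Cod C v = Cod C u" "Dom C u = Cod C f" "Dom C v = Cod C g" "u \<cdot> f = v \<cdot> g"
  using assms by (auto simp: is_pushout_def hom_def)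

lemma po_map:
  assumes "is_pushout C u v f g" "h \<in> hom C (Cod C f) V" "k \<in> hom C (Cod C g) V" "h \<cdot> f = k \<cdot> g"
  shows "\<exists>m. m \<in> hom C (Cod C u) V \<and> m \<cdot> u = h \<and> m \<cdot> v = k"
  using assms unfolding is_pushout_def by blast

lemma po_uniq:
  assumes "is_pushout C u v f g" "m \<in> hom C (Cod C u) V" "n \<in> hom C (Cod C u) V"
    "m \<cdot> u = n \<cdot> u" "m \<cdot> v = n \<cdot> v"
  shows "m = n"
proof -
  note D [simp] = poD(1-8)[OF assms(1)] and S = poD(9)[OF assms(1)]
  note [simp] = homD[OF assms(2)] homD[OF assms(3)]
  have "n \<cdot> u \<in> hom C (Cod C f) V" "n \<cdot> v \<in> hom C (Cod C g) V"
    by (auto simp: hom_def)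
  moreover have "(n \<cdot> u) \<cdot> f = (n \<cdot> v) \<cdot> g" using S by simp
  ultimately have "\<exists>!m. m \<in> hom C (Cod C u) V \<and> m \<cdot> u = n \<cdot> u \<and> m \<cdot> v = n \<cdot> v"
    using assms(1) unfolding is_pushout_def by blast
  then show ?thesis using assms by metis
qed

lemma po_cotuple:
  assumes "is_pushout C u v f g" "h \<in> hom C (Cod C f) V" "k \<in> hom C (Cod C g) V" "h \<cdot> f = k \<cdot> g"
  shows "cotuple C u v h k \<in> hom C (Cod C u) V" "cotuple C u v h k \<cdot> u = h" "cotuple C u v h k \<cdot> v = k"
proof -
  have V: "Cod C h = V" using assms(2) by (simp add: hom_def)
  have "\<exists>!m. m \<in> hom C (Cod C u) V \<and> m \<cdot> u = h \<and> m \<cdot> v = k"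
    using assms unfolding is_pushout_def by blast
  from theI'[OF this] show "cotuple C u v h k \<in> hom C (Cod C u) V" "cotuple C u v h k \<cdot> u = h"
    "cotuple C u v h k \<cdot> v = k"
    unfolding cotuple_def V by auto
qed

lemma poI:
  assumes "f \<in> hom C Z X" "g \<in> hom C Z Y" "u \<in> hom C X P" "v \<in> hom C Y P" "u \<cdot> f = v \<cdot> g"
    and "\<And>V h k. h \<in> hom C X V \<Longrightarrow> k \<in> hom C Y V \<Longrightarrow> h \<cdot> f = k \<cdot> g \<Longrightarrow>
      \<exists>m. m \<in> hom C P V \<and> m \<cdot> u = h \<and> m \<cdot> v = k"
    and "\<And>V m n. m \<in> hom C P V \<Longrightarrow> n \<in> hom C P V \<Longrightarrow> m \<cdot> u = n \<cdot> u \<Longrightarrow> m \<cdot> v = n \<cdot> v \<Longrightarrow> m = n"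
  shows "is_pushout C u v f g"
proof -
  note D = homD[OF assms(1)] homD[OF assms(2)] homD[OF assms(3)] homD[OF assms(4)]
  show ?thesis unfolding is_pushout_def
  proof (intro conjI allI ballI impI)
    fix V h k assume "h \<in> hom C (Cod C f) V" "k \<in> hom C (Cod C g) V" "h \<cdot> f = k \<cdot> g"
    then obtain m where m: "m \<in> hom C P V" "m \<cdot> u = h" "m \<cdot> v = k" using assms(6) D by metis
    then show "\<exists>!m. m \<in> hom C (Cod C u) V \<and> m \<cdot> u = h \<and> m \<cdot> v = k"
      using assms(7) D by metis
  qed (use assms D in auto)
qed

lemma po_sym:
  assumes "is_pushout C u v f g" shows "is_pushout C v u g f"
proof -
  note D = poD[OF assms]
  show ?thesis
  proof (rule poI[of _ "Dom C f" "Cod C g" _ "Cod C f" _ "Cod C u"])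
    fix V h k assume "h \<in> hom C (Cod C g) V" "k \<in> hom C (Cod C f) V" "h \<cdot> g = k \<cdot> f"
    then show "\<exists>m. m \<in> hom C (Cod C u) V \<and> m \<cdot> v = h \<and> m \<cdot> u = k"
      using po_map[OF assms, of k V h] by auto
  qed (use D po_uniq[OF assms] in \<open>auto simp: homI\<close>)
qed

end

subsection \<open>Slices\<close>

lemma slice_sel [simp]:
  "Obj (slice C B) = {x \<in> Arr C. Cod C x = B}"
  "Dom (slice C B) (x, f, y) = x"
  "Cod (slice C B) (x, f, y) = y"
  "Id (slice C B) x = (x, Id C (Dom C x), x)"
  "Comp (slice C B) (y', g, z) (x, f, y) = (x, Comp C g f, z)"
  by (simp_all add: slice_def)

lemma underlying_simp [simp]: "underlying (x, f, y) = f"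
  by (simp add: underlying_def)

lemma slice_hom:
  "F \<in> hom (slice C B) x y \<longleftrightarrow>
    (\<exists>f. F = (x, f, y) \<and> x \<in> Arr C \<and> Cod C x = B \<and> y \<in> Arr C \<and> Cod C y = B \<and> f \<in> hom_over C x y)"
  by (auto simp: hom_def slice_def)

lemma hom_overD:
  assumes "f \<in> hom_over C x y"
  shows "f \<in> hom C (Dom C x) (Dom C y)" "Comp C y f = x"
  using assms by (auto simp: hom_over_def)

context category
begin

text \<open>A cone \<open>u\<close>, \<open>v\<close> over \<open>x\<close> and \<open>y\<close> is
  a pair of slice arrows out of \<open>x \<cdot> u\<close>, so products over \<open>B\<close> are
  pullbacks. Slice arrows carry their source and target, hence the first two equations, which
  recover the projections from their underlying arrows.\<close>

lemma slice_product:
  assumes P: "is_product (slice C B) x y P Q"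
    and x: "x \<in> Arr C" "Cod C x = B" and y: "y \<in> Arr C" "Cod C y = B"
  shows "P = (x \<cdot> underlying P, underlying P, x)" "Q = (x \<cdot> underlying P, underlying Q, y)"
    "is_pullback C (underlying P) (underlying Q) x y"
proof -
  let ?S = "slice C B"
  have "P \<in> hom ?S (Dom ?S P) x" "Q \<in> hom ?S (Dom ?S P) y" using P by (auto simp: is_product_def)
  then obtain z p q where Pz: "P = (z, p, x)" and Qz: "Q = (z, q, y)"
    and z: "z \<in> Arr C" "Cod C z = B" and p: "p \<in> hom_over C z x" and q: "q \<in> hom_over C z y"
    by (auto simp: slice_hom)
  note p = hom_overD[OF p] and q = hom_overD[OF q]
  note [simp] = homD[OF p(1)] homD[OF q(1)] x y z
  show "P = (x \<cdot> underlying P, underlying P, x)" "Q = (x \<cdot> underlying P, underlying Q, y)"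
    using Pz Qz p q by auto
  have UP: "\<exists>!m. m \<in> hom ?S t z \<and> Comp ?S P m = U \<and> Comp ?S Q m = V"
    if "U \<in> hom ?S t x" "V \<in> hom ?S t y" for t U V
    using P that unfolding is_product_def by (auto simp: Pz)
  have "is_pullback C p q x y"
  proof (rule pbI[of _ "Dom C x" B _ "Dom C y" _ "Dom C z"])
    fix V u v assume u: "u \<in> hom C V (Dom C x)" and v: "v \<in> hom C V (Dom C y)" and e: "x \<cdot> u = y \<cdot> v"
    note [simp] = homD[OF u] homD[OF v]
    let ?t = "x \<cdot> u"
    have "(?t, u, x) \<in> hom ?S ?t x" "(?t, v, y) \<in> hom ?S ?t y"
      using u v e by (auto simp: slice_hom hom_over_def)
    from ex1_implies_ex[OF UP[OF this]] obtain m where "m \<in> hom ?S ?t z"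
      "Comp ?S P m = (?t, u, x)" "Comp ?S Q m = (?t, v, y)" by blast
    then show "\<exists>m. m \<in> hom C V (Dom C z) \<and> p \<cdot> m = u \<and> q \<cdot> m = v"
      by (auto simp: slice_hom Pz Qz hom_over_def)
  next
    fix V m n assume m: "m \<in> hom C V (Dom C z)" and n: "n \<in> hom C V (Dom C z)"
      and e: "p \<cdot> m = p \<cdot> n" "q \<cdot> m = q \<cdot> n"
    note [simp] = homD[OF m] homD[OF n]
    let ?t = "z \<cdot> m"
    have 1: "z \<cdot> m = x \<cdot> (p \<cdot> m)" "z \<cdot> n = x \<cdot> (p \<cdot> n)" "z \<cdot> m = y \<cdot> (q \<cdot> m)"
      using reassoc[OF p(2,1), of B m] reassoc[OF p(2,1), of B n] reassoc[OF q(2,1), of B m] by (auto simp: hom_def)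
    have "(?t, p \<cdot> m, x) \<in> hom ?S ?t x" "(?t, q \<cdot> m, y) \<in> hom ?S ?t y"
      using 1 by (auto simp: slice_hom hom_over_def homI)
    note U = UP[OF this]
    have "(?t, m, z) \<in> hom ?S ?t z" "(?t, n, z) \<in> hom ?S ?t z"
      using m n 1 e by (auto simp: slice_hom hom_over_def)
    moreover have "Comp ?S P (?t, m, z) = (?t, p \<cdot> m, x)" "Comp ?S P (?t, n, z) = (?t, p \<cdot> m, x)"
      "Comp ?S Q (?t, m, z) = (?t, q \<cdot> m, y)" "Comp ?S Q (?t, n, z) = (?t, q \<cdot> m, y)"
      using e by (auto simp: Pz Qz)
    ultimately have "(?t, m, z) = (?t, n, z)" using U by blast
    then show "m = n" by simp
  qed (use p q in \<open>auto simp: hom_def\<close>)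
  then show "is_pullback C (underlying P) (underlying Q) x y" using Pz Qz by simp
qed

end

locale lcc_category = category C for C :: "('o, 'a) cat" (structure) +
  fixes T :: 'o
  assumes lcc: "locally_cartesian_closed C"
    and complete: "finitely_complete C"
    and terminal: "is_terminal C T"
begin

lemma T_obj [simp]: "T \<in> Obj C"
  using terminal by (simp add: is_terminal_def)

lemma bang_hom: "X \<in> Obj C \<Longrightarrow> bang C T X \<in> hom C X T"
  using terminal theI'[of "\<lambda>f. f \<in> hom C X T"] unfolding bang_def is_terminal_def by simp

lemma bang_simps [simp]:
  assumes "X \<in> Obj C"
  shows "bang C T X \<in> Arr C" "Dom C (bang C T X) = X" "Cod C (bang C T X) = T"
  using homD[OF bang_hom[OF assms]] by auto

lemma to_T_uniq: "f \<in> hom C X T \<Longrightarrow> g \<in> hom C X T \<Longrightarrow> f = g"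
  using terminal homD(4)[of f X T] unfolding is_terminal_def by blast

lemma bang_comp [simp]:
  "f \<in> Arr C \<Longrightarrow> Cod C f = X \<Longrightarrow> bang C T X \<cdot> f = bang C T (Dom C f)"
  by (rule to_T_uniq[of _ "Dom C f"]) (auto simp: hom_def)

lemma pb_ex:
  assumes "f \<in> Arr C" "g \<in> Arr C" "Cod C f = Cod C g"
  shows "\<exists>p q. is_pullback C p q f g"
  using complete assms unfolding finitely_complete_def by blast

subsection \<open>Products\<close>

text \<open>Over a terminal object the commutation condition on cones holds by itself; the pullback
  lemmas therefore serve for products as well.\<close>

lemma product_iff_pullback:
  assumes "X \<in> Obj C" "Y \<in> Obj C"
  shows "is_product C X Y p q \<longleftrightarrow> is_pullback C p q (bang C T X) (bang C T Y)"
proof -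
  have 1: "bang C T X \<cdot> u = bang C T Y \<cdot> v" if "u \<in> hom C V X" "v \<in> hom C V Y" for u v V
    using that assms by (auto simp: hom_def)
  have 2: "(\<forall>V. \<forall>u \<in> hom C V X. \<forall>v \<in> hom C V Y. bang C T X \<cdot> u = bang C T Y \<cdot> v \<longrightarrow> Q V u v) \<longleftrightarrow>
    (\<forall>V. \<forall>u \<in> hom C V X. \<forall>v \<in> hom C V Y. Q V u v)" for Q
    using 1 by blast
  show ?thesis unfolding is_product_def is_pullback_def
    using 1[of p "Dom C p" q] assms unfolding bang_simps(2)[OF assms(1)] bang_simps(2)[OF assms(2)] 2
    by (simp del: bang_comp) blast
qed

lemma prod_pb:
  assumes "X \<in> Obj C" "Y \<in> Obj C"
  shows "is_pullback C (pr1 C X Y) (pr2 C X Y) (bang C T X) (bang C T Y)"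
proof -
  have "\<exists>pq. case pq of (p, q) \<Rightarrow> is_product C X Y p q"
    using pb_ex[of "bang C T X" "bang C T Y"] assms by (simp add: product_iff_pullback)
  from someI_ex[OF this] show ?thesis
    using assms by (auto simp: product_iff_pullback prod_projs_def pr1_def pr2_def split: prod.splits)
qed

lemma pr_simps [simp]:
  assumes "X \<in> Obj C" "Y \<in> Obj C"
  shows "pr1 C X Y \<in> Arr C" "Dom C (pr1 C X Y) = prod_obj C X Y" "Cod C (pr1 C X Y) = X"
    "pr2 C X Y \<in> Arr C" "Dom C (pr2 C X Y) = prod_obj C X Y" "Cod C (pr2 C X Y) = Y"
  using pbD[OF prod_pb[OF assms]] assms by (auto simp: prod_obj_def)

lemma prod_obj_obj [simp]: "X \<in> Obj C \<Longrightarrow> Y \<in> Obj C \<Longrightarrow> prod_obj C X Y \<in> Obj C"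
  using pr_simps(1,2) dom_cod_obj(1) by metis

abbreviation pair :: "'a \<Rightarrow> 'a \<Rightarrow> 'a" where
  "pair u v \<equiv> tuple C (pr1 C (Cod C u) (Cod C v)) (pr2 C (Cod C u) (Cod C v)) u v"

lemma pair_tuple:
  assumes "u \<in> hom C V X" "v \<in> hom C V Y"
  shows "tuple C (pr1 C X Y) (pr2 C X Y) u v \<in> hom C V (prod_obj C X Y)"
    "pr1 C X Y \<cdot> tuple C (pr1 C X Y) (pr2 C X Y) u v = u"
    "pr2 C X Y \<cdot> tuple C (pr1 C X Y) (pr2 C X Y) u v = v"
proof -
  note [simp] = homD[OF assms(1)] homD[OF assms(2)]
  note t = pb_tuple[OF prod_pb, of X Y u V v]
  show "tuple C (pr1 C X Y) (pr2 C X Y) u v \<in> hom C V (prod_obj C X Y)"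
    "pr1 C X Y \<cdot> tuple C (pr1 C X Y) (pr2 C X Y) u v = u"
    "pr2 C X Y \<cdot> tuple C (pr1 C X Y) (pr2 C X Y) u v = v"
    using t assms by auto
qed

lemma prod_ext:
  assumes "X \<in> Obj C" "Y \<in> Obj C" "m \<in> hom C V (prod_obj C X Y)" "n \<in> hom C V (prod_obj C X Y)"
    "pr1 C X Y \<cdot> m = pr1 C X Y \<cdot> n" "pr2 C X Y \<cdot> m = pr2 C X Y \<cdot> n"
  shows "m = n"
  using pb_uniq[OF prod_pb[OF assms(1,2)], of m V n] assms by auto

lemma pair_simps [simp]:
  assumes "u \<in> Arr C" "v \<in> Arr C" "Dom C v = Dom C u" "Cod C u = X" "Cod C v = Y"
  shows "tuple C (pr1 C X Y) (pr2 C X Y) u v \<in> Arr C"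
    "Dom C (tuple C (pr1 C X Y) (pr2 C X Y) u v) = Dom C u"
    "Cod C (tuple C (pr1 C X Y) (pr2 C X Y) u v) = prod_obj C X Y"
    "pr1 C X Y \<cdot> tuple C (pr1 C X Y) (pr2 C X Y) u v = u"
    "pr2 C X Y \<cdot> tuple C (pr1 C X Y) (pr2 C X Y) u v = v"
  using pair_tuple[of u "Dom C u" X v Y] assms by (auto simp: hom_def)

lemma pair_re [simp]:
  assumes "u \<in> Arr C" "v \<in> Arr C" "Dom C v = Dom C u" "Cod C u = X" "Cod C v = Y" "Cod C x = Dom C u" "x \<in> Arr C"
  shows "pr1 C X Y \<cdot> (tuple C (pr1 C X Y) (pr2 C X Y) u v \<cdot> x) = u \<cdot> x"
    "pr2 C X Y \<cdot> (tuple C (pr1 C X Y) (pr2 C X Y) u v \<cdot> x) = v \<cdot> x"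
  using reassoc[OF pair_simps(4)[OF assms(1-5)], of "Dom C u" "prod_obj C X Y" X x]
    reassoc[OF pair_simps(5)[OF assms(1-5)], of "Dom C u" "prod_obj C X Y" Y x] assms by (auto simp: hom_def)

lemma prod_map_simps [simp]:
  assumes "f \<in> Arr C" "g \<in> Arr C"
  shows "prod_map C f g \<in> Arr C" "Dom C (prod_map C f g) = prod_obj C (Dom C f) (Dom C g)"
    "Cod C (prod_map C f g) = prod_obj C (Cod C f) (Cod C g)"
  using assms unfolding prod_map_def by auto

lemma prod_map_pr [simp]:
  assumes "f \<in> Arr C" "g \<in> Arr C" "Cod C f = X" "Cod C g = Y"
  shows "pr1 C X Y \<cdot> prod_map C f g = f \<cdot> pr1 C (Dom C f) (Dom C g)"
    "pr2 C X Y \<cdot> prod_map C f g = g \<cdot> pr2 C (Dom C f) (Dom C g)"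
  using assms unfolding prod_map_def by auto

lemma prod_map_pr_re [simp]:
  assumes "f \<in> Arr C" "g \<in> Arr C" "Cod C f = X" "Cod C g = Y" "x \<in> Arr C" "Cod C x = prod_obj C (Dom C f) (Dom C g)"
  shows "pr1 C X Y \<cdot> (prod_map C f g \<cdot> x) = f \<cdot> (pr1 C (Dom C f) (Dom C g) \<cdot> x)"
    "pr2 C X Y \<cdot> (prod_map C f g \<cdot> x) = g \<cdot> (pr2 C (Dom C f) (Dom C g) \<cdot> x)"
proof -
  have "pr1 C X Y \<cdot> (prod_map C f g \<cdot> x) = (pr1 C X Y \<cdot> prod_map C f g) \<cdot> x"
    "pr2 C X Y \<cdot> (prod_map C f g \<cdot> x) = (pr2 C X Y \<cdot> prod_map C f g) \<cdot> x"
    using assms by (auto simp del: prod_map_pr)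
  then show "pr1 C X Y \<cdot> (prod_map C f g \<cdot> x) = f \<cdot> (pr1 C (Dom C f) (Dom C g) \<cdot> x)"
    "pr2 C X Y \<cdot> (prod_map C f g \<cdot> x) = g \<cdot> (pr2 C (Dom C f) (Dom C g) \<cdot> x)"
    using assms by auto
qed

lemma prod_map_comp:
  assumes "f \<in> Arr C" "f' \<in> Arr C" "Cod C f = Dom C f'" "g \<in> Arr C" "g' \<in> Arr C" "Cod C g = Dom C g'"
  shows "prod_map C f' g' \<cdot> prod_map C f g = prod_map C (f' \<cdot> f) (g' \<cdot> g)"
  by (rule prod_ext[of "Cod C f'" "Cod C g'" _ "prod_obj C (Dom C f) (Dom C g)"])
    (use assms in \<open>auto simp: hom_def\<close>)

lemma prod_map_id: "X \<in> Obj C \<Longrightarrow> Y \<in> Obj C \<Longrightarrow> prod_map C (Id C X) (Id C Y) = Id C (prod_obj C X Y)"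
  by (rule prod_ext[of X Y _ "prod_obj C X Y"]) (auto simp: hom_def)

text \<open>The second coordinate is untouched, so only the first has to be lifted along
  \<open>f\<close>. Cylinders are thereby stable under pullback, and multiplying with an object
  preserves monos.\<close>

lemma prod_map_pullback:
  assumes "f \<in> hom C X Y" "Z \<in> Obj C"
  shows "is_pullback C (prod_map C f (Id C Z)) (pr1 C X Z) (pr1 C Y Z) f"
proof -
  note [simp] = homD[OF assms(1)] assms(2)
  show ?thesis
  proof (rule pbI[of _ "prod_obj C Y Z" Y _ X _ "prod_obj C X Z"])
    fix V u v assume u: "u \<in> hom C V (prod_obj C Y Z)" and v: "v \<in> hom C V X" and e: "pr1 C Y Z \<cdot> u = f \<cdot> v"
    note [simp] = homD[OF u] homD[OF v]
    let ?m = "tuple C (pr1 C X Z) (pr2 C X Z) v (pr2 C Y Z \<cdot> u)"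
    have "prod_map C f (Id C Z) \<cdot> ?m = u"
      by (rule prod_ext[of Y Z _ V]) (auto simp: hom_def e)
    then show "\<exists>m. m \<in> hom C V (prod_obj C X Z) \<and> prod_map C f (Id C Z) \<cdot> m = u \<and> pr1 C X Z \<cdot> m = v"
      by (intro exI[of _ ?m]) (auto simp: hom_def)
  next
    fix V m n assume m: "m \<in> hom C V (prod_obj C X Z)" and n: "n \<in> hom C V (prod_obj C X Z)"
      and e: "prod_map C f (Id C Z) \<cdot> m = prod_map C f (Id C Z) \<cdot> n" "pr1 C X Z \<cdot> m = pr1 C X Z \<cdot> n"
    note [simp] = homD[OF m] homD[OF n]
    have "pr2 C Y Z \<cdot> (prod_map C f (Id C Z) \<cdot> m) = pr2 C Y Z \<cdot> (prod_map C f (Id C Z) \<cdot> n)" using e by simp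
    then have "pr2 C X Z \<cdot> m = pr2 C X Z \<cdot> n" by simp
    then show "m = n" using prod_ext[of X Z m V n] m n e by simp
  qed (auto simp: hom_def)
qed

subsection \<open>Exponentials in slices\<close>

text \<open>The exponential of \<open>y\<close> by \<open>f\<close> in the slice over
  \<open>Cod C f\<close>, unfolded into the base category: \<open>P\<close> is the exponential,
  \<open>p\<close> and \<open>q\<close> the projections of its product with \<open>f\<close>, and
  \<open>\<epsilon>\<close> the evaluation. The product of a test object \<open>x\<close> with
  \<open>f\<close> may be any pullback \<open>s\<close>, \<open>t\<close>, not just the chosen one,
  so that the most convenient model can be used each time.\<close>

definition is_slice_exp :: "'a \<Rightarrow> 'a \<Rightarrow> 'a \<Rightarrow> 'a \<Rightarrow> 'a \<Rightarrow> 'a \<Rightarrow> bool" where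
  "is_slice_exp f y P p q \<epsilon> \<longleftrightarrow> is_pullback C p q P f \<and> y \<in> Arr C \<and> Cod C y = Cod C f \<and>
    \<epsilon> \<in> hom C (Dom C p) (Dom C y) \<and> y \<cdot> \<epsilon> = P \<cdot> p \<and>
    (\<forall>x s t g. is_pullback C s t x f \<and> g \<in> hom C (Dom C s) (Dom C y) \<and> y \<cdot> g = x \<cdot> s \<longrightarrow>
      (\<exists>!h. h \<in> hom C (Dom C x) (Dom C P) \<and> P \<cdot> h = x \<and> \<epsilon> \<cdot> tuple C p q (h \<cdot> s) t = g))"

lemma slice_prod:
  assumes "x \<in> Arr C" "y \<in> Arr C" "Cod C x = B" "Cod C y = B"
  shows "is_product (slice C B) x y (pr1 (slice C B) x y) (pr2 (slice C B) x y)"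
proof -
  have "B \<in> Obj C" using assms by auto
  then have "cartesian_closed (slice C B)" using lcc by (simp add: locally_cartesian_closed_def)
  then have "\<exists>p q. is_product (slice C B) x y p q"
    using assms unfolding cartesian_closed_def by auto
  then have "\<exists>pq. case pq of (p, q) \<Rightarrow> is_product (slice C B) x y p q" by auto
  from someI_ex[OF this] show ?thesis
    by (auto simp: prod_projs_def pr1_def pr2_def split: prod.splits)
qed

lemma slice_exp_data:
  assumes "x \<in> Arr C" "y \<in> Arr C" "Cod C x = B" "Cod C y = B"
  shows "is_exponential (slice C B) x y (exp_obj (slice C B) x y) (exp_ev (slice C B) x y)"
proof -
  have "B \<in> Obj C" using assms by auto
  then have "cartesian_closed (slice C B)" using lcc by (simp add: locally_cartesian_closed_def)
  then have "\<exists>p q. is_exponential (slice C B) x y p q"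
    using assms unfolding cartesian_closed_def by auto
  then have "\<exists>pq. case pq of (p, q) \<Rightarrow> is_exponential (slice C B) x y p q" by auto
  from someI_ex[OF this] show ?thesis
    by (auto simp: exp_data_def exp_obj_def exp_ev_def split: prod.splits)
qed

lemma slice_prod_map:
  assumes f: "f \<in> Arr C" "Cod C f = B" and x: "x \<in> Arr C" "Cod C x = B" and p: "P \<in> Arr C" "Cod C P = B"
    and h: "h \<in> hom_over C x P"
  defines "S \<equiv> slice C B"
  shows "prod_map S (x, h, P) (Id S f) =
    (x \<cdot> underlying (pr1 S x f),
     tuple C (underlying (pr1 S P f)) (underlying (pr2 S P f)) (h \<cdot> underlying (pr1 S x f)) (underlying (pr2 S x f)),
     P \<cdot> underlying (pr1 S P f))"
proof -
  note X = slice_product[OF slice_prod[OF x(1) f(1) x(2) f(2)] x f, folded S_def]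
  note PP = slice_product[OF slice_prod[OF p(1) f(1) p(2) f(2)] p f, folded S_def]
  let ?px = "underlying (pr1 S x f)" and ?qx = "underlying (pr2 S x f)"
    and ?pp = "underlying (pr1 S P f)" and ?qp = "underlying (pr2 S P f)"
  note h = hom_overD[OF h]
  note [simp] = homD[OF h(1)] pbD(1-8)[OF X(3)] pbD(1-8)[OF PP(3)] f x p
  define m where "m = tuple C ?pp ?qp (h \<cdot> ?px) ?qx"
  have e: "P \<cdot> (h \<cdot> ?px) = f \<cdot> ?qx" using reassoc[OF h(2) h(1), of B ?px] pbD(9)[OF X(3)] by (auto simp: hom_def)
  have m: "m \<in> hom C (Dom C ?px) (Dom C ?pp)" "?pp \<cdot> m = h \<cdot> ?px" "?qp \<cdot> m = ?qx"
    unfolding m_def using pb_tuple[OF PP(3), of "h \<cdot> ?px" "Dom C ?px" ?qx] e by (auto simp: hom_def)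
  note [simp] = homD[OF m(1)]
  have e2: "P \<cdot> (h \<cdot> ?px) = x \<cdot> ?px" using reassoc[OF h(2) h(1), of B ?px] by (auto simp: hom_def)
  have mh: "(x \<cdot> ?px, m, P \<cdot> ?pp) \<in> hom S (x \<cdot> ?px) (P \<cdot> ?pp)"
    unfolding slice_hom[of _ C B, folded S_def] using m e2 by (auto simp: hom_over_def)
  let ?M = "(x \<cdot> ?px, m, P \<cdot> ?pp)"
  have "prod_map S (x, h, P) (Id S f) = tuple S (pr1 S P f) (pr2 S P f) (x \<cdot> ?px, h \<cdot> ?px, P) (x \<cdot> ?px, ?qx, f)"
  proof -
    have "Comp S (x, h, P) (pr1 S x f) = (x \<cdot> ?px, h \<cdot> ?px, P)"
      by (subst X(1)) (simp add: S_def)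
    moreover have q: "Id C (Dom C f) \<cdot> ?qx = ?qx" by simp
    have "Comp S (Id S f) (pr2 S x f) = (x \<cdot> ?px, ?qx, f)"
      by (subst X(2)) (use q in \<open>simp add: S_def\<close>)
    ultimately show ?thesis unfolding prod_map_def by (simp add: S_def)
  qed
  also have "\<dots> = ?M"
    unfolding tuple_def
  proof (rule the_equality)
    have c: "Comp S (pr1 S P f) ?M = (x \<cdot> ?px, h \<cdot> ?px, P) \<and> Comp S (pr2 S P f) ?M = (x \<cdot> ?px, ?qx, f)"
      using PP(1,2) m(2,3) unfolding S_def by (metis slice_sel(5))
    moreover have D: "Dom S (pr1 S P f) = P \<cdot> ?pp" using PP(1) unfolding S_def by (metis slice_sel(2))
    ultimately show "?M \<in> hom S (Dom S (x \<cdot> ?px, h \<cdot> ?px, P)) (Dom S (pr1 S P f)) \<and>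
      Comp S (pr1 S P f) ?M = (x \<cdot> ?px, h \<cdot> ?px, P) \<and> Comp S (pr2 S P f) ?M = (x \<cdot> ?px, ?qx, f)"
      using mh by (simp add: S_def)
    fix N assume N: "N \<in> hom S (Dom S (x \<cdot> ?px, h \<cdot> ?px, P)) (Dom S (pr1 S P f)) \<and>
      Comp S (pr1 S P f) N = (x \<cdot> ?px, h \<cdot> ?px, P) \<and> Comp S (pr2 S P f) N = (x \<cdot> ?px, ?qx, f)"
    then have "N \<in> hom S (x \<cdot> ?px) (P \<cdot> ?pp)" using D by (simp add: S_def)
    then obtain n where Nn: "N = (x \<cdot> ?px, n, P \<cdot> ?pp)" and n: "n \<in> hom_over C (x \<cdot> ?px) (P \<cdot> ?pp)"
      unfolding S_def slice_hom by blast
    have n: "n \<in> hom C (Dom C ?px) (Dom C ?pp)" using hom_overD(1)[OF n] by simp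
    have "?pp \<cdot> n = h \<cdot> ?px" "?qp \<cdot> n = ?qx"
      using N PP(1,2) unfolding Nn S_def by (metis slice_sel(5) prod.inject)+
    then have "n = m" using pb_uniq[OF PP(3) n m(1)] m by simp
    then show "N = ?M" using Nn by simp
  qed
  finally show ?thesis unfolding m_def .
qed

lemma pb_iso:
  assumes "is_pullback C p q f g" "is_pullback C p' q' f g"
  shows "\<exists>m n. m \<in> hom C (Dom C p) (Dom C p') \<and> n \<in> hom C (Dom C p') (Dom C p) \<and>
    m \<cdot> n = Id C (Dom C p') \<and> n \<cdot> m = Id C (Dom C p) \<and>
    p' \<cdot> m = p \<and> q' \<cdot> m = q \<and> p \<cdot> n = p' \<and> q \<cdot> n = q'"
proof -
  note [simp] = pbD(1-8)[OF assms(1)] pbD(1-8)[OF assms(2)]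
  obtain m where m: "m \<in> hom C (Dom C p) (Dom C p')" "p' \<cdot> m = p" "q' \<cdot> m = q"
    using pb_map[OF assms(2), of p "Dom C p" q] pbD(9)[OF assms(1)] by (auto simp: hom_def)
  obtain n where n: "n \<in> hom C (Dom C p') (Dom C p)" "p \<cdot> n = p'" "q \<cdot> n = q'"
    using pb_map[OF assms(1), of p' "Dom C p'" q'] pbD(9)[OF assms(2)] by (auto simp: hom_def)
  note [simp] = homD[OF m(1)] homD[OF n(1)]
  have R: "p' \<cdot> (m \<cdot> n) = p'" "q' \<cdot> (m \<cdot> n) = q'" "p \<cdot> (n \<cdot> m) = p" "q \<cdot> (n \<cdot> m) = q"
    using reassoc[OF m(2,1), of "Dom C f" n] reassoc[OF m(3,1), of "Dom C g" n] reassoc[OF n(2,1), of "Dom C f" m]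
      reassoc[OF n(3,1), of "Dom C g" m] m n by (auto simp: hom_def)
  have "m \<cdot> n = Id C (Dom C p')"
    by (rule pb_uniq[OF assms(2), of _ "Dom C p'"]) (use R in \<open>auto simp: hom_def\<close>)
  moreover have "n \<cdot> m = Id C (Dom C p)"
    by (rule pb_uniq[OF assms(1), of _ "Dom C p"]) (use R in \<open>auto simp: hom_def\<close>)
  ultimately show ?thesis using m n by blast
qed

text \<open>The exponential of the slice speaks of the chosen product of \<open>x\<close> and
  \<open>f\<close> only. Any other pullback of \<open>x\<close> and \<open>f\<close> is isomorphic
  to it, and transposition carries over along that isomorphism.\<close>

lemma slice_exponential:
  assumes f: "f \<in> Arr C" "Cod C f = B" and y: "y \<in> Arr C" "Cod C y = B"
  defines "S \<equiv> slice C B"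
  assumes E: "is_exponential S f y P ev"
  shows "is_slice_exp f y P (underlying (pr1 S P f)) (underlying (pr2 S P f)) (underlying ev)"
    "ev = (P \<cdot> underlying (pr1 S P f), underlying ev, y)" "P \<in> Arr C" "Cod C P = B"
proof -
  have P: "P \<in> Arr C" "Cod C P = B" using E by (auto simp: is_exponential_def S_def)
  then show "P \<in> Arr C" "Cod C P = B" .
  note PP = slice_product[OF slice_prod[OF P(1) f(1) P(2) f(2)] P f, folded S_def]
  let ?pp = "underlying (pr1 S P f)" and ?qp = "underlying (pr2 S P f)"
  have po: "prod_obj S x f = x \<cdot> underlying (pr1 S x f)" if "x \<in> Arr C" "Cod C x = B" for x
    using slice_product(1)[OF slice_prod[OF that(1) f(1) that(2) f(2)] that f, folded S_def]
    unfolding prod_obj_def S_def by (metis slice_sel(2))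
  obtain \<epsilon> where ev: "ev = (P \<cdot> ?pp, \<epsilon>, y)" and eps: "\<epsilon> \<in> hom_over C (P \<cdot> ?pp) y"
    using E po[OF P] unfolding is_exponential_def S_def slice_hom by auto
  then show "ev = (P \<cdot> ?pp, underlying ev, y)" by simp
  note eps = hom_overD[OF eps]
  note [simp] = f y P homD(1,2,3)[OF eps(1)] pbD(1-8)[OF PP(3)]
  have eps1: "\<epsilon> \<in> hom C (Dom C ?pp) (Dom C y)" using eps(1) by simp
  have main: "\<exists>!h. h \<in> hom C (Dom C x) (Dom C P) \<and> P \<cdot> h = x \<and> \<epsilon> \<cdot> tuple C ?pp ?qp (h \<cdot> s) t = g"
    if pb: "is_pullback C s t x f" and g: "g \<in> hom C (Dom C s) (Dom C y)" and ge: "y \<cdot> g = x \<cdot> s" for x s t g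
  proof -
    note [simp] = pbD(1-8)[OF pb] homD[OF g]
    have x: "x \<in> Arr C" "Cod C x = B" using pbD(3)[OF pb] by auto
    note X = slice_product[OF slice_prod[OF x(1) f(1) x(2) f(2)] x f, folded S_def]
    let ?px = "underlying (pr1 S x f)" and ?qx = "underlying (pr2 S x f)"
    note [simp] = pbD(1-8)[OF X(3)]
    obtain m n where m: "m \<in> hom C (Dom C s) (Dom C ?px)" and n: "n \<in> hom C (Dom C ?px) (Dom C s)"
      and mn: "m \<cdot> n = Id C (Dom C ?px)" "n \<cdot> m = Id C (Dom C s)" "?px \<cdot> m = s" "?qx \<cdot> m = t"
        "s \<cdot> n = ?px" "t \<cdot> n = ?qx"
      using pb_iso[OF pb X(3)] by blast
    note [simp] = homD[OF m] homD[OF n]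
    have gn: "y \<cdot> (g \<cdot> n) = x \<cdot> ?px" using reassoc[OF ge, of "Dom C s" "Dom C y" B n] g mn by (auto simp: hom_def)
    \<comment> \<open>\<open>g\<close> is defined on the given pullback; precomposing with
      \<open>n\<close> moves it to the chosen product.\<close>
    have "(x \<cdot> ?px, g \<cdot> n, y) \<in> hom S (prod_obj S x f) y"
      using gn unfolding slice_hom[of _ C B, folded S_def] po[OF x] by (auto simp: hom_over_def homI x)
    then have "\<exists>!H. H \<in> hom S x P \<and> Comp S ev (prod_map S H (Id S f)) = (x \<cdot> ?px, g \<cdot> n, y)"
      using E x unfolding is_exponential_def by (auto simp: S_def)
    moreover have "H \<in> hom S x P \<longleftrightarrow> (\<exists>h. H = (x, h, P) \<and> h \<in> hom C (Dom C x) (Dom C P) \<and> P \<cdot> h = x)" for H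
      unfolding S_def slice_hom using x P by (auto simp: hom_over_def)
    ultimately have "\<exists>!H. (\<exists>h. H = (x, h, P) \<and> h \<in> hom C (Dom C x) (Dom C P) \<and> P \<cdot> h = x) \<and>
      Comp S ev (prod_map S H (Id S f)) = (x \<cdot> ?px, g \<cdot> n, y)" by simp
    then have 1: "\<exists>!h. h \<in> hom C (Dom C x) (Dom C P) \<and> P \<cdot> h = x \<and>
      Comp S ev (prod_map S (x, h, P) (Id S f)) = (x \<cdot> ?px, g \<cdot> n, y)"
      by (elim ex1E) (auto intro!: ex1I)
    \<comment> \<open>The evaluation equations on the two models of the product are equivalent
      because \<open>m\<close> and \<open>n\<close> are mutually inverse.\<close>
    have 2: "Comp S ev (prod_map S (x, h, P) (Id S f)) = (x \<cdot> ?px, g \<cdot> n, y) \<longleftrightarrow>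
       \<epsilon> \<cdot> tuple C ?pp ?qp (h \<cdot> s) t = g" if h: "h \<in> hom C (Dom C x) (Dom C P)" "P \<cdot> h = x" for h
    proof -
      note [simp] = homD[OF h(1)]
      have ho: "h \<in> hom_over C x P" using h by (simp add: hom_over_def)
      have e1: "P \<cdot> (h \<cdot> ?px) = f \<cdot> ?qx" using reassoc[OF h(2,1), of B ?px] pbD(9)[OF X(3)] by (auto simp: hom_def)
      have t1: "tuple C ?pp ?qp (h \<cdot> ?px) ?qx \<in> hom C (Dom C ?px) (Dom C ?pp)"
        "?pp \<cdot> tuple C ?pp ?qp (h \<cdot> ?px) ?qx = h \<cdot> ?px" "?qp \<cdot> tuple C ?pp ?qp (h \<cdot> ?px) ?qx = ?qx"
        using pb_tuple[OF PP(3), of "h \<cdot> ?px" "Dom C ?px" ?qx] e1 by (auto simp: hom_def)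
      note [simp] = homD[OF t1(1)]
      have t2: "tuple C ?pp ?qp (h \<cdot> s) t = tuple C ?pp ?qp (h \<cdot> ?px) ?qx \<cdot> m"
        by (rule pb_tuple_eq[OF PP(3), of _ "Dom C s"])
          (use reassoc[OF t1(2,1), of _ m] reassoc[OF t1(3,1), of _ m] mn in \<open>auto simp: hom_def\<close>)
      have "Comp S ev (prod_map S (x, h, P) (Id S f)) = (x \<cdot> ?px, \<epsilon> \<cdot> tuple C ?pp ?qp (h \<cdot> ?px) ?qx, y)"
        unfolding S_def slice_prod_map[OF f x P ho] ev[unfolded S_def] by simp
      moreover have "\<epsilon> \<cdot> tuple C ?pp ?qp (h \<cdot> ?px) ?qx = g \<cdot> n \<longleftrightarrow>
        (\<epsilon> \<cdot> tuple C ?pp ?qp (h \<cdot> ?px) ?qx) \<cdot> m = g"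
      proof
        assume "\<epsilon> \<cdot> tuple C ?pp ?qp (h \<cdot> ?px) ?qx = g \<cdot> n"
        then show "(\<epsilon> \<cdot> tuple C ?pp ?qp (h \<cdot> ?px) ?qx) \<cdot> m = g" using mn by simp
      next
        assume "(\<epsilon> \<cdot> tuple C ?pp ?qp (h \<cdot> ?px) ?qx) \<cdot> m = g"
        then have "g \<cdot> n = ((\<epsilon> \<cdot> tuple C ?pp ?qp (h \<cdot> ?px) ?qx) \<cdot> m) \<cdot> n" by simp
        also have "\<dots> = \<epsilon> \<cdot> tuple C ?pp ?qp (h \<cdot> ?px) ?qx" using mn by simp
        finally show "\<epsilon> \<cdot> tuple C ?pp ?qp (h \<cdot> ?px) ?qx = g \<cdot> n" by simp
      qed
      ultimately show ?thesis using t2 by simp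
    qed
    from 1 obtain h where h: "h \<in> hom C (Dom C x) (Dom C P)" "P \<cdot> h = x"
      "Comp S ev (prod_map S (x, h, P) (Id S f)) = (x \<cdot> ?px, g \<cdot> n, y)" by blast
    show ?thesis
    proof (rule ex1I[of _ h])
      show "h \<in> hom C (Dom C x) (Dom C P) \<and> P \<cdot> h = x \<and> \<epsilon> \<cdot> tuple C ?pp ?qp (h \<cdot> s) t = g"
        using h 2 by blast
      fix h' assume "h' \<in> hom C (Dom C x) (Dom C P) \<and> P \<cdot> h' = x \<and> \<epsilon> \<cdot> tuple C ?pp ?qp (h' \<cdot> s) t = g"
      then show "h' = h" using 1 2 h by blast
    qed
  qed
  show "is_slice_exp f y P ?pp ?qp (underlying ev)"
    unfolding is_slice_exp_def using main PP(3) eps1 eps(2) by (auto simp: ev)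
qed

lemma slice_exp_ex:
  assumes "f \<in> Arr C" "y \<in> Arr C" "Cod C y = Cod C f"
  shows "\<exists>P p q \<epsilon>. is_slice_exp f y P p q \<epsilon>"
  using slice_exponential(1)[OF assms(1) refl assms(2,3) slice_exp_data] assms by blast

end

context category
begin

lemma tuple_comp:
  assumes "is_pullback C p q f g" "u \<in> hom C V (Dom C f)" "v \<in> hom C V (Dom C g)" "f \<cdot> u = g \<cdot> v"
    "m \<in> hom C V' V"
  shows "tuple C p q u v \<cdot> m = tuple C p q (u \<cdot> m) (v \<cdot> m)"
proof -
  note t = pb_tuple[OF assms(1-4)]
  note [simp] = pbD(1-8)[OF assms(1)] homD[OF t(1)] homD[OF assms(5)]
  show ?thesis
    by (rule pb_tuple_eq[OF assms(1), of _ V', symmetric])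
      (use reassoc[OF t(2,1), of "Dom C f" m] reassoc[OF t(3,1), of "Dom C g" m] in \<open>auto simp: hom_def\<close>)
qed

end

context lcc_category
begin

lemma slice_expD:
  assumes "is_slice_exp f y P p q \<epsilon>"
  shows "is_pullback C p q P f" "y \<in> Arr C" "Cod C y = Cod C f" "\<epsilon> \<in> hom C (Dom C p) (Dom C y)" "y \<cdot> \<epsilon> = P \<cdot> p"
  using assms by (auto simp: is_slice_exp_def)

lemma slice_exp_map:
  assumes "is_slice_exp f y P p q \<epsilon>" "is_pullback C s t x f" "g \<in> hom C (Dom C s) (Dom C y)" "y \<cdot> g = x \<cdot> s"
  shows "\<exists>h. h \<in> hom C (Dom C x) (Dom C P) \<and> P \<cdot> h = x \<and> \<epsilon> \<cdot> tuple C p q (h \<cdot> s) t = g"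
  using assms unfolding is_slice_exp_def by blast

lemma slice_exp_tuple:
  assumes E: "is_slice_exp f y P p q \<epsilon>" and pb: "is_pullback C s t x f"
    and h: "h \<in> hom C (Dom C x) (Dom C P)" "P \<cdot> h = x"
  shows "tuple C p q (h \<cdot> s) t \<in> hom C (Dom C s) (Dom C p)"
    "p \<cdot> tuple C p q (h \<cdot> s) t = h \<cdot> s" "q \<cdot> tuple C p q (h \<cdot> s) t = t"
    "y \<cdot> (\<epsilon> \<cdot> tuple C p q (h \<cdot> s) t) = x \<cdot> s"
    "m \<in> hom C V (Dom C s) \<Longrightarrow> tuple C p q (h \<cdot> s) t \<cdot> m = tuple C p q (h \<cdot> (s \<cdot> m)) (t \<cdot> m)"
proof -
  note D = slice_expD[OF E]
  note [simp] = pbD(1-8)[OF D(1)] pbD(1-8)[OF pb] homD[OF h(1)] homD[OF D(4)] D(2,3)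
  have e: "P \<cdot> (h \<cdot> s) = f \<cdot> t"
    using reassoc[OF h(2,1), of "Cod C P" s] pbD(9)[OF pb] by (auto simp: hom_def)
  have hs: "h \<cdot> s \<in> hom C (Dom C s) (Dom C P)" "t \<in> hom C (Dom C s) (Dom C f)" by (auto simp: hom_def)
  note t = pb_tuple[OF D(1) hs e]
  show "tuple C p q (h \<cdot> s) t \<in> hom C (Dom C s) (Dom C p)"
    "p \<cdot> tuple C p q (h \<cdot> s) t = h \<cdot> s" "q \<cdot> tuple C p q (h \<cdot> s) t = t" by (fact t)+
  note [simp] = homD[OF t(1)]
  have "y \<cdot> (\<epsilon> \<cdot> tuple C p q (h \<cdot> s) t) = P \<cdot> (p \<cdot> tuple C p q (h \<cdot> s) t)"
    using reassoc[OF D(5,4), of "Cod C y" "tuple C p q (h \<cdot> s) t"] by (auto simp: hom_def)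
  also have "\<dots> = P \<cdot> (h \<cdot> s)" using t by simp
  also have "\<dots> = x \<cdot> s" using reassoc[OF h(2,1), of "Cod C P" s] by (auto simp: hom_def)
  finally show "y \<cdot> (\<epsilon> \<cdot> tuple C p q (h \<cdot> s) t) = x \<cdot> s" .
  assume m: "m \<in> hom C V (Dom C s)"
  show "tuple C p q (h \<cdot> s) t \<cdot> m = tuple C p q (h \<cdot> (s \<cdot> m)) (t \<cdot> m)"
    using tuple_comp[OF D(1) hs e m] homD[OF m] by simp
qed

lemma slice_exp_uniq:
  assumes E: "is_slice_exp f y P p q \<epsilon>" and pb: "is_pullback C s t x f"
    and h: "h \<in> hom C (Dom C x) (Dom C P)" "P \<cdot> h = x"
    and h': "h' \<in> hom C (Dom C x) (Dom C P)" "P \<cdot> h' = x"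
    and eq: "\<epsilon> \<cdot> tuple C p q (h \<cdot> s) t = \<epsilon> \<cdot> tuple C p q (h' \<cdot> s) t"
  shows "h = h'"
proof -
  note D = slice_expD[OF E] and t = slice_exp_tuple[OF E pb h]
  have "\<epsilon> \<cdot> tuple C p q (h \<cdot> s) t \<in> hom C (Dom C s) (Dom C y)" using D(4) t(1) comp_hom by blast
  then have "\<exists>!h'. h' \<in> hom C (Dom C x) (Dom C P) \<and> P \<cdot> h' = x \<and>
      \<epsilon> \<cdot> tuple C p q (h' \<cdot> s) t = \<epsilon> \<cdot> tuple C p q (h \<cdot> s) t"
    using E pb t(4) unfolding is_slice_exp_def by blast
  then show ?thesis using h h' eq by metis
qed

subsection \<open>Stability of colimits under pullback\<close>

text \<open>A map from \<open>O'\<close> to \<open>V\<close>, paired with \<open>z\<close>, is a map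
  over \<open>Z\<close> into the projection of \<open>prod_obj C V Z\<close>; transposed along
  \<open>z\<close> it becomes a section over \<open>Z\<close> of an exponential. Any two such
  sections agree, being maps out of an initial object.\<close>

lemma initial_strict:
  assumes Z: "is_initial C Z" and z: "z \<in> hom C O' Z" and f: "f \<in> hom C O' V" and g: "g \<in> hom C O' V"
  shows "f = g"
proof -
  note [simp] = homD[OF z] homD[OF f] homD[OF g]
  let ?y = "pr2 C V Z"
  obtain Q p q \<epsilon> where E: "is_slice_exp z ?y Q p q \<epsilon>" using slice_exp_ex[of z ?y] by auto
  have pb: "is_pullback C z (Id C O') (Id C Z) z" using pb_id[OF z] .
  have ex: "\<exists>h. h \<in> hom C Z (Dom C Q) \<and> Q \<cdot> h = Id C Z \<and> \<epsilon> \<cdot> tuple C p q (h \<cdot> z) (Id C O') = pair k z"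
    if "k \<in> hom C O' V" for k
    using slice_exp_map[OF E pb, of "pair k z"] homD[OF that] by (auto simp: hom_def)
  obtain h where h: "h \<in> hom C Z (Dom C Q)" "\<epsilon> \<cdot> tuple C p q (h \<cdot> z) (Id C O') = pair f z" using ex[OF f] by blast
  obtain h' where h': "h' \<in> hom C Z (Dom C Q)" "\<epsilon> \<cdot> tuple C p q (h' \<cdot> z) (Id C O') = pair g z" using ex[OF g] by blast
  have "h = h'" using Z h(1) h'(1) homD(5)[OF h(1)] unfolding is_initial_def by blast
  then have "pair f z = pair g z" using h h' by simp
  then have "pr1 C V Z \<cdot> pair f z = pr1 C V Z \<cdot> pair g z" by simp
  then show ?thesis by simp
qed

lemma initial_mono:
  assumes "is_initial C Z" "f \<in> hom C Z X"
  shows "is_mono C f"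
  using monoI[OF assms(2)] initial_strict[OF assms(1)] by blast

text \<open>Maps into \<open>V\<close> out of the pullbacks along \<open>z\<close> correspond to
  maps over \<open>P\<close> into the exponential of the projection of \<open>prod_obj C V P\<close>
  by \<open>z\<close>. Compatible maps \<open>h\<close>, \<open>k\<close> transpose to compatible
  maps \<open>H\<close>, \<open>K\<close>, which the original pushout glues to a map
  \<open>M\<close>; transposing back gives the map out of \<open>Z\<close>.\<close>

lemma pushout_stable:
  assumes po: "is_pushout C u v f g" and z: "z \<in> hom C Z (Cod C u)"
    and pa: "is_pullback C a a' u z" and pb: "is_pullback C b b' v z" and pc: "is_pullback C c c' (u \<cdot> f) z"
    and f': "f' \<in> hom C (Dom C c) (Dom C a)" "a \<cdot> f' = f \<cdot> c" "a' \<cdot> f' = c'"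
    and g': "g' \<in> hom C (Dom C c) (Dom C b)" "b \<cdot> g' = g \<cdot> c" "b' \<cdot> g' = c'"
  shows "is_pushout C a' b' f' g'"
proof -
  define P where "P = Cod C u"
  note Da = pbD(1-8)[OF pa] and Db = pbD(1-8)[OF pb] and Dc = pbD(1-8)[OF pc]
  note Dp = poD(1-8)[OF po]
  note z = z[folded P_def]
  have [simp]: "Cod C u = P" by (simp add: P_def)
  note [simp] = Dp homD[OF z]
  have Da [simp]: "a \<in> Arr C" "a' \<in> Arr C" "Dom C a' = Dom C a" "Cod C a = Cod C f" "Cod C a' = Z" using Da by auto
  have Db [simp]: "b \<in> Arr C" "b' \<in> Arr C" "Dom C b' = Dom C b" "Cod C b = Cod C g" "Cod C b' = Z" using Db by auto
  have Dc [simp]: "c \<in> Arr C" "c' \<in> Arr C" "Dom C c' = Dom C c" "Cod C c = Dom C f" "Cod C c' = Z" using Dc by auto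
  note [simp] = homD(1-3)[OF f'(1)] homD(1-3)[OF g'(1)]
  have vg: "v \<cdot> g = u \<cdot> f" using poD(9)[OF po] by simp
  have vgc: "v \<cdot> (g \<cdot> x) = u \<cdot> (f \<cdot> x)" if "Cod C x = Dom C f" "x \<in> Arr C" for x
    by (rule reassoc2[OF vg _ _ _ _ that, of "Cod C g" P "Cod C f"]) (auto simp: hom_def)
  note ea = pbD(9)[OF pa] and eb = pbD(9)[OF pb]
  have PObj [simp]: "P \<in> Obj C" using homD(5)[OF z] .
  note pid = pb_id[OF z]
  have E: "\<exists>Q p q \<epsilon>. is_slice_exp z (pr2 C V P) Q p q \<epsilon>" if "V \<in> Obj C" for V
    using slice_exp_ex[of z "pr2 C V P"] that by simp
  show ?thesis
  proof (rule poI[of _ "Dom C c" "Dom C a" _ "Dom C b" _ Z])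
    show "a' \<cdot> f' = b' \<cdot> g'" using f' g' by simp
    fix V h k assume h: "h \<in> hom C (Dom C a) V" and k: "k \<in> hom C (Dom C b) V" and hk: "h \<cdot> f' = k \<cdot> g'"
    note [simp] = homD[OF h] homD[OF k]
    obtain Q p q \<epsilon> where E: "is_slice_exp z (pr2 C V P) Q p q \<epsilon>" using E[of V] by auto
    note ED = slice_expD[OF E]
    have [simp]: "Cod C Q = P" using pbD(3)[OF ED(1)] homD(3)[OF z] by metis
    note [simp] = pbD(1,2,4-8)[OF ED(1)]
    have eps: "\<epsilon> \<in> Arr C" "Dom C \<epsilon> = Dom C p" "Cod C \<epsilon> = prod_obj C V P" using homD[OF ED(4)] by auto
    note [simp] = eps
    \<comment> \<open>Pairing \<open>h\<close> with \<open>u \<cdot> a\<close> turns it into a map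
      over \<open>P\<close>, the form that can be transposed.\<close>
    obtain H where H: "H \<in> hom C (Cod C f) (Dom C Q)" "Q \<cdot> H = u" "\<epsilon> \<cdot> tuple C p q (H \<cdot> a) a' = pair h (u \<cdot> a)"
      using slice_exp_map[OF E pa, of "pair h (u \<cdot> a)"] by (auto simp: hom_def)
    obtain K where K: "K \<in> hom C (Cod C g) (Dom C Q)" "Q \<cdot> K = v" "\<epsilon> \<cdot> tuple C p q (K \<cdot> b) b' = pair k (v \<cdot> b)"
      using slice_exp_map[OF E pb, of "pair k (v \<cdot> b)"] by (auto simp: hom_def)
    note [simp] = homD(1-3)[OF H(1)] homD(1-3)[OF K(1)]
    have H1: "H \<in> hom C (Dom C u) (Dom C Q)" and K1: "K \<in> hom C (Dom C v) (Dom C Q)" using H K by auto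
    note tH = slice_exp_tuple[OF E pa H1 H(2)] and tK = slice_exp_tuple[OF E pb K1 K(2)]
    note [simp] = homD(1-3)[OF tH(1)] homD(1-3)[OF tK(1)]
    have Hf: "H \<cdot> f = K \<cdot> g"
    proof (rule slice_exp_uniq[OF E pc])
      show "H \<cdot> f \<in> hom C (Dom C (u \<cdot> f)) (Dom C Q)" "K \<cdot> g \<in> hom C (Dom C (u \<cdot> f)) (Dom C Q)"
        by (auto simp: hom_def)
      show "Q \<cdot> H \<cdot> f = u \<cdot> f" using reassoc[OF H(2,1), of P f] by (auto simp: hom_def)
      show "Q \<cdot> K \<cdot> g = u \<cdot> f" using reassoc[OF K(2,1), of P g] vg by (auto simp: hom_def)
      have "\<epsilon> \<cdot> tuple C p q ((H \<cdot> f) \<cdot> c) c' = \<epsilon> \<cdot> (tuple C p q (H \<cdot> a) a' \<cdot> f')"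
        using tH(5)[OF f'(1)] f' by simp
      also have "\<dots> = pair h (u \<cdot> a) \<cdot> f'"
        using reassoc[OF H(3) tH(1), of "prod_obj C V P" f'] by (auto simp: hom_def)
      also have "\<dots> = pair (h \<cdot> f') (u \<cdot> (f \<cdot> c))"
        by (rule prod_ext[of V P _ "Dom C c"]) (use f' in \<open>auto simp: hom_def\<close>)
      also have "\<dots> = pair k (v \<cdot> b) \<cdot> g'"
        by (rule prod_ext[of V P _ "Dom C c"]) (use g' hk vgc[of c] in \<open>auto simp: hom_def\<close>)
      also have "\<dots> = \<epsilon> \<cdot> (tuple C p q (K \<cdot> b) b' \<cdot> g')"
        using reassoc[OF K(3) tK(1), of "prod_obj C V P" g'] by (auto simp: hom_def)
      also have "\<dots> = \<epsilon> \<cdot> tuple C p q ((K \<cdot> g) \<cdot> c) c'"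
        using tK(5)[OF g'(1)] g' by simp
      finally show "\<epsilon> \<cdot> tuple C p q ((H \<cdot> f) \<cdot> c) c' = \<epsilon> \<cdot> tuple C p q ((K \<cdot> g) \<cdot> c) c'" .
    qed
    obtain M where M: "M \<in> hom C P (Dom C Q)" "M \<cdot> u = H" "M \<cdot> v = K"
      using po_map[OF po H(1) K(1) Hf] by auto
    note [simp] = homD(1-3)[OF M(1)]
    \<comment> \<open>\<open>M\<close> is a section of the exponential. The pullback of the identity
      of \<open>P\<close> along \<open>z\<close> is \<open>Z\<close> itself, so the section
      evaluates to a map out of \<open>Z\<close>.\<close>
    have QM: "Q \<cdot> M = Id C P"
      by (rule po_uniq[OF po, of _ P]) (use M H K in \<open>auto simp: hom_def\<close>)
    have M1: "M \<in> hom C (Dom C (Id C P)) (Dom C Q)" using M by simp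
    note tM = slice_exp_tuple[OF E pid M1 QM]
    note [simp] = homD(1-3)[OF tM(1)]
    let ?m = "pr1 C V P \<cdot> (\<epsilon> \<cdot> tuple C p q (M \<cdot> z) (Id C Z))"
    have "?m \<cdot> a' = pr1 C V P \<cdot> (\<epsilon> \<cdot> (tuple C p q (M \<cdot> z) (Id C Z) \<cdot> a'))" by simp
    also have "\<dots> = pr1 C V P \<cdot> (\<epsilon> \<cdot> tuple C p q (H \<cdot> a) a')"
      using tM(5)[of a' "Dom C a"] ea reassoc[OF M(2), of "Cod C f" P _ a] by (auto simp: hom_def)
    also have "\<dots> = h" using H(3) by simp
    finally have ma: "?m \<cdot> a' = h" .
    have "?m \<cdot> b' = pr1 C V P \<cdot> (\<epsilon> \<cdot> (tuple C p q (M \<cdot> z) (Id C Z) \<cdot> b'))" by simp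
    also have "\<dots> = pr1 C V P \<cdot> (\<epsilon> \<cdot> tuple C p q (K \<cdot> b) b')"
      using tM(5)[of b' "Dom C b"] eb reassoc[OF M(3), of "Cod C g" P _ b] by (auto simp: hom_def)
    also have "\<dots> = k" using K(3) by simp
    finally have mb: "?m \<cdot> b' = k" .
    show "\<exists>m. m \<in> hom C Z V \<and> m \<cdot> a' = h \<and> m \<cdot> b' = k"
      by (rule exI[of _ ?m], intro conjI ma mb) (auto simp: hom_def)
  next
    fix V m n assume m: "m \<in> hom C Z V" and n: "n \<in> hom C Z V" and eq: "m \<cdot> a' = n \<cdot> a'" "m \<cdot> b' = n \<cdot> b'"
    note [simp] = homD[OF m] homD[OF n]
    obtain Q p q \<epsilon> where E: "is_slice_exp z (pr2 C V P) Q p q \<epsilon>" using E[of V] by auto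
    note ED = slice_expD[OF E]
    have [simp]: "Cod C Q = P" using pbD(3)[OF ED(1)] homD(3)[OF z] by metis
    note [simp] = pbD(1,2,4-8)[OF ED(1)]
    have eps: "\<epsilon> \<in> Arr C" "Dom C \<epsilon> = Dom C p" "Cod C \<epsilon> = prod_obj C V P" using homD[OF ED(4)] by auto
    note [simp] = eps
    have ex: "\<exists>M. M \<in> hom C P (Dom C Q) \<and> Q \<cdot> M = Id C P \<and> \<epsilon> \<cdot> tuple C p q (M \<cdot> z) (Id C Z) = pair m z"
      if "m \<in> hom C Z V" for m
      using slice_exp_map[OF E pid, of "pair m z"] homD[OF that] by (auto simp: hom_def)
    obtain M where M: "M \<in> hom C P (Dom C Q)" "Q \<cdot> M = Id C P" "\<epsilon> \<cdot> tuple C p q (M \<cdot> z) (Id C Z) = pair m z"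
      using ex[OF m] by blast
    obtain N where N: "N \<in> hom C P (Dom C Q)" "Q \<cdot> N = Id C P" "\<epsilon> \<cdot> tuple C p q (N \<cdot> z) (Id C Z) = pair n z"
      using ex[OF n] by blast
    \<comment> \<open>Restricting a section along \<open>w\<close> corresponds, after evaluation, to
      precomposing \<open>m\<close> with the pullback \<open>s'\<close>. Used with \<open>u\<close>
      and \<open>v\<close> it turns equality on the two pieces into equality of transposes.\<close>
    have key: "\<epsilon> \<cdot> tuple C p q ((M \<cdot> w) \<cdot> s) s' = pair (m \<cdot> s') (z \<cdot> s')"
      if M: "M \<in> hom C P (Dom C Q)" "Q \<cdot> M = Id C P" "\<epsilon> \<cdot> tuple C p q (M \<cdot> z) (Id C Z) = pair m z"
        and m: "m \<in> hom C Z V" and s: "is_pullback C s s' w z" for M m w s s'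
    proof -
      note [simp] = homD(1-3)[OF M(1)] homD(1-3)[OF m]
      have [simp]: "w \<in> Arr C" "Cod C w = P" "s \<in> Arr C" "s' \<in> Arr C" "Cod C s = Dom C w" "Cod C s' = Z" "Dom C s' = Dom C s"
        using pbD(1-8)[OF s] by auto
      have M1: "M \<in> hom C (Dom C (Id C P)) (Dom C Q)" using M by simp
      note tM = slice_exp_tuple[OF E pid M1 M(2)]
      have "\<epsilon> \<cdot> tuple C p q ((M \<cdot> w) \<cdot> s) s' = \<epsilon> \<cdot> (tuple C p q (M \<cdot> z) (Id C Z) \<cdot> s')"
        using tM(5)[of s' "Dom C s"] pbD(9)[OF s] by (auto simp: hom_def)
      also have "\<dots> = pair m z \<cdot> s'"
        using reassoc[OF M(3) tM(1), of "prod_obj C V P" s'] by (auto simp: hom_def)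
      also have "\<dots> = pair (m \<cdot> s') (z \<cdot> s')"
        by (rule prod_ext[of V P _ "Dom C s"]) (auto simp: hom_def)
      finally show ?thesis .
    qed
    note [simp] = homD(1-3)[OF M(1)] homD(1-3)[OF N(1)]
    have Q: "Q \<cdot> (M \<cdot> x) = x" "Q \<cdot> (N \<cdot> x) = x" if "x \<in> Arr C" "Cod C x = P" for x
      using reassoc[OF M(2,1), of P x] reassoc[OF N(2,1), of P x] that by (auto simp: hom_def)
    have "M \<cdot> u = N \<cdot> u"
      by (rule slice_exp_uniq[OF E pa])
        (use key[OF M m pa] key[OF N n pa] eq Q[of u] in \<open>auto simp: hom_def\<close>)
    moreover have "M \<cdot> v = N \<cdot> v"
      by (rule slice_exp_uniq[OF E pb])
        (use key[OF M m pb] key[OF N n pb] eq Q[of v] in \<open>auto simp: hom_def\<close>)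
    ultimately have "M = N" using po_uniq[OF po, of M "Dom C Q" N] M N by simp
    then have "pr1 C V P \<cdot> pair m z = pr1 C V P \<cdot> pair n z" using M(3) N(3) by simp
    then show "m = n" by simp
  qed (auto simp: hom_def)
qed

text \<open>The third pullback and the induced maps are constructed here. The map \<open>c\<close>
  out of the new apex is kept in the conclusion because \<open>endpoints\<close> needs to know that
  this apex lies over an initial object.\<close>

lemma pushout_stable_ex:
  assumes po: "is_pushout C u v f g" and z: "z \<in> hom C Z (Cod C u)"
    and pa: "is_pullback C a a' u z" and pb: "is_pullback C b b' v z"
  shows "\<exists>c f' g'. is_pushout C a' b' f' g' \<and> c \<in> hom C (Dom C f') (Dom C f) \<and> a \<cdot> f' = f \<cdot> c \<and> b \<cdot> g' = g \<cdot> c"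
proof -
  note [simp] = poD(1-8)[OF po] homD[OF z] pbD(4-8)[OF pa] pbD(4-8)[OF pb]
  obtain c c' where pc: "is_pullback C c c' (u \<cdot> f) z" using pb_ex[of "u \<cdot> f" z] by auto
  note [simp] = pbD(4-8)[OF pc]
  have e: "u \<cdot> (f \<cdot> c) = z \<cdot> c'" using pbD(9)[OF pc] by simp
  have e': "v \<cdot> (g \<cdot> c) = z \<cdot> c'"
    using e reassoc2[OF poD(9)[OF po], of "Dom C f" "Cod C f" "Cod C u" "Cod C g" c] by (simp add: hom_def)
  obtain f' where f': "f' \<in> hom C (Dom C c) (Dom C a)" "a \<cdot> f' = f \<cdot> c" "a' \<cdot> f' = c'"
    using pb_map[OF pa, of "f \<cdot> c" "Dom C c" c'] e by (auto simp: hom_def)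
  obtain g' where g': "g' \<in> hom C (Dom C c) (Dom C b)" "b \<cdot> g' = g \<cdot> c" "b' \<cdot> g' = c'"
    using pb_map[OF pb, of "g \<cdot> c" "Dom C c" c'] e' by (auto simp: hom_def)
  show ?thesis using pushout_stable[OF po z pa pb pc f' g'] f' g' homD[OF f'(1)]
    by (intro exI[of _ c] exI[of _ f'] exI[of _ g']) (auto simp: hom_def)
qed

text \<open>The pulled back coprojections are jointly epic, so two maps out of \<open>V\<close> may
  be compared on those generalized elements of \<open>V\<close> that land in one of the two pieces.
  This is case distinction on the position of a point in a pushout.\<close>

lemma pushout_cover:
  assumes po: "is_pushout C u v f g" and z: "z \<in> hom C V (Cod C u)"
    and m: "m \<in> hom C V W" and n: "n \<in> hom C V W"
    and A: "\<And>S x y. x \<in> hom C S V \<Longrightarrow> y \<in> hom C S (Dom C u) \<Longrightarrow> z \<cdot> x = u \<cdot> y \<Longrightarrow> m \<cdot> x = n \<cdot> x"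
    and B: "\<And>S x y. x \<in> hom C S V \<Longrightarrow> y \<in> hom C S (Dom C v) \<Longrightarrow> z \<cdot> x = v \<cdot> y \<Longrightarrow> m \<cdot> x = n \<cdot> x"
  shows "m = n"
proof -
  note [simp] = poD(1-8)[OF po] homD[OF z]
  obtain a a' where pa: "is_pullback C a a' u z" using pb_ex[of u z] by auto
  obtain b b' where pb: "is_pullback C b b' v z" using pb_ex[of v z] by auto
  obtain f' g' where po': "is_pushout C a' b' f' g'" using pushout_stable_ex[OF po z pa pb] by blast
  note [simp] = pbD(4-8)[OF pa] pbD(4-8)[OF pb]
  have "m \<cdot> a' = n \<cdot> a'" using A[of a' "Dom C a" a] pbD(9)[OF pa] by (simp add: hom_def)
  moreover have "m \<cdot> b' = n \<cdot> b'" using B[of b' "Dom C b" b] pbD(9)[OF pb] by (simp add: hom_def)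
  ultimately show ?thesis using po_uniq[OF po', of m W n] m n by simp
qed

text \<open>Cover \<open>V\<close> by the parts that \<open>y\<close> sends into the two pieces. On
  the first the mono \<open>n \<cdot> u\<close> cancels; on the second the pullback hypothesis
  supplies a common preimage in the intersection, where \<open>u \<cdot> f\<close> and
  \<open>v \<cdot> g\<close> agree.\<close>

lemma union_mono_aux:
  assumes po: "is_pushout C u v f g" and pb: "is_pullback C f g (n \<cdot> u) (n \<cdot> v)"
    and n: "n \<in> hom C (Cod C u) X" and mono: "is_mono C (n \<cdot> u)"
    and x: "x \<in> hom C V (Dom C u)" and y: "y \<in> hom C V (Cod C u)" and e: "n \<cdot> (u \<cdot> x) = n \<cdot> y"
  shows "u \<cdot> x = y"
proof -
  note [simp] = poD(1-8)[OF po] homD[OF n] homD[OF x] homD[OF y]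
  have nyx: "n \<cdot> (y \<cdot> s) = n \<cdot> (u \<cdot> (x \<cdot> s))" if "s \<in> Arr C" "Cod C s = V" for s
    using reassoc2[OF e, of V "Cod C u" X "Cod C u" s] that by (auto simp: hom_def)
  show ?thesis
  proof (rule pushout_cover[OF po y, of _ "Cod C u"])
    fix S s t assume s: "s \<in> hom C S V" and t: "t \<in> hom C S (Dom C u)" and st: "y \<cdot> s = u \<cdot> t"
    note [simp] = homD[OF s] homD[OF t]
    have "(n \<cdot> u) \<cdot> (x \<cdot> s) = (n \<cdot> u) \<cdot> t" using nyx[of s] st by simp
    then have "x \<cdot> s = t" using monoD[OF mono, of "Dom C u" X "x \<cdot> s" S t] by (auto simp: hom_def)
    then show "(u \<cdot> x) \<cdot> s = y \<cdot> s" using st by simp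
  next
    fix S s t assume s: "s \<in> hom C S V" and t: "t \<in> hom C S (Dom C v)" and st: "y \<cdot> s = v \<cdot> t"
    note [simp] = homD[OF s] homD[OF t]
    have "(n \<cdot> u) \<cdot> (x \<cdot> s) = (n \<cdot> v) \<cdot> t" using nyx[of s] st by simp
    then obtain d where d: "d \<in> hom C S (Dom C f)" "f \<cdot> d = x \<cdot> s" "g \<cdot> d = t"
      using pb_map[OF pb, of "x \<cdot> s" S t] by (auto simp: hom_def)
    then show "(u \<cdot> x) \<cdot> s = y \<cdot> s"
      using st reassoc2[OF poD(9)[OF po], of "Dom C f" "Cod C f" "Cod C u" "Cod C g" d] homD[OF d(1)] by (auto simp: hom_def)
  qed (auto simp: hom_def)
qed

text \<open>A pushout over the intersection of two subobjects is their union. The position of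
  \<open>x\<close> is split by \<open>pushout_cover\<close>, and the auxiliary lemma treats an
  arbitrary \<open>y\<close>, once for each piece by symmetry.\<close>

lemma union_mono:
  assumes po: "is_pushout C u v f g" and pb: "is_pullback C f g (n \<cdot> u) (n \<cdot> v)"
    and n: "n \<in> hom C (Cod C u) X" and mono: "is_mono C (n \<cdot> u)" "is_mono C (n \<cdot> v)"
  shows "is_mono C n"
proof (rule monoI[OF n])
  note [simp] = poD(1-8)[OF po] homD[OF n]
  fix V x y assume x: "x \<in> hom C V (Cod C u)" and y: "y \<in> hom C V (Cod C u)" and e: "n \<cdot> x = n \<cdot> y"
  note [simp] = homD[OF x] homD[OF y]
  have nyx: "n \<cdot> (x \<cdot> s) = n \<cdot> (y \<cdot> s)" if "s \<in> Arr C" "Cod C s = V" for s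
    using reassoc2[OF e, of V "Cod C u" X "Cod C u" s] that by (auto simp: hom_def)
  note aux = union_mono_aux[OF po pb n mono(1)]
  have n': "n \<in> hom C (Cod C v) X" using n by simp
  note aux' = union_mono_aux[OF po_sym[OF po] pb_sym[OF pb] n' mono(2)]
  show "x = y"
  proof (rule pushout_cover[OF po x x y])
    fix S s t assume s: "s \<in> hom C S V" and t: "t \<in> hom C S (Dom C u)" and st: "x \<cdot> s = u \<cdot> t"
    note [simp] = homD[OF s] homD[OF t]
    show "x \<cdot> s = y \<cdot> s" using aux[OF t, of "y \<cdot> s"] st nyx[of s] by (auto simp: hom_def)
  next
    fix S s t assume s: "s \<in> hom C S V" and t: "t \<in> hom C S (Dom C v)" and st: "x \<cdot> s = v \<cdot> t"
    note [simp] = homD[OF s] homD[OF t]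
    show "x \<cdot> s = y \<cdot> s" using aux'[OF t, of "y \<cdot> s"] st nyx[of s] by (auto simp: hom_def)
  qed
qed

subsection \<open>Base change and pushforward\<close>

lemma base_change_pb:
  assumes "x \<in> Arr C" "i \<in> Arr C" "Cod C x = Cod C i"
  shows "is_pullback C (base_change_top C i x) (base_change C i x) x i"
proof -
  have "\<exists>pq. case pq of (p, q) \<Rightarrow> is_pullback C p q x i" using pb_ex[OF assms] by auto
  from someI_ex[OF this] show ?thesis
    by (auto simp: base_change_data_def base_change_top_def base_change_def split: prod.splits)
qed

abbreviation bct :: "'a \<Rightarrow> 'a \<Rightarrow> 'a \<Rightarrow> 'a \<Rightarrow> 'a" where
  "bct i x u v \<equiv> tuple C (base_change_top C i x) (base_change C i x) u v"

lemma bct_spec: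
  assumes i: "i \<in> hom C D B" and x: "x \<in> hom C X B" and m: "m \<in> hom C V X" and t: "t \<in> hom C V D" and e: "x \<cdot> m = i \<cdot> t"
  shows "bct i x m t \<in> hom C V (Dom C (base_change_top C i x))" "base_change_top C i x \<cdot> bct i x m t = m"
    "base_change C i x \<cdot> bct i x m t = t"
    "k \<in> hom C V' V \<Longrightarrow> bct i x m t \<cdot> k = bct i x (m \<cdot> k) (t \<cdot> k)"
proof -
  note [simp] = homD[OF x] homD[OF i] homD[OF m] homD[OF t]
  have bc: "is_pullback C (base_change_top C i x) (base_change C i x) x i" by (rule base_change_pb) auto
  note pb_tuple[OF bc, of m V t]
  then show "bct i x m t \<in> hom C V (Dom C (base_change_top C i x))" "base_change_top C i x \<cdot> bct i x m t = m"
    "base_change C i x \<cdot> bct i x m t = t" using e m t by auto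
  show "bct i x m t \<cdot> k = bct i x (m \<cdot> k) (t \<cdot> k)" if "k \<in> hom C V' V"
    using tuple_comp[OF bc, of m V t k V'] e m t that by auto
qed

text \<open>As \<open>i\<close> is mono, maps over \<open>B\<close> into \<open>i \<cdot> y\<close>
  from the restriction of an object are the same as maps over \<open>D\<close> into
  \<open>y\<close>. Hence the exponential of \<open>i \<cdot> y\<close> by \<open>i\<close> over
  \<open>B\<close> already has the universal property of the pushforward.\<close>

lemma pushforward_ex:
  assumes i: "is_mono C i" "i \<in> hom C D B" and y: "y \<in> hom C Y D"
  shows "\<exists>p c. is_pushforward C i y p c"
proof -
  note [simp] = homD[OF i(2)] homD[OF y]
  obtain P p q \<epsilon> where E: "is_slice_exp i (i \<cdot> y) P p q \<epsilon>" using slice_exp_ex[of i "i \<cdot> y"] by auto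
  note ED = slice_expD[OF E]
  have P [simp]: "P \<in> Arr C" "Cod C P = B" using pbD(1,3)[OF ED(1)] by auto
  note [simp] = pbD(4-8)[OF ED(1)]
  have eps: "\<epsilon> \<in> hom C (Dom C p) Y" using ED(4) by simp
  note [simp] = homD(1-3)[OF eps]
  let ?t = "base_change_top C i P" and ?b = "base_change C i P"
  have bc: "is_pullback C ?t ?b P i" by (rule base_change_pb) auto
  note [simp] = pbD(4-8)[OF bc]
  \<comment> \<open>\<open>\<phi>\<close> compares the chosen base change of \<open>P\<close> with
    the product on which evaluation is defined; the counit is evaluation after
    \<open>\<phi>\<close>.\<close>
  obtain \<phi> where phi: "\<phi> \<in> hom C (Dom C ?t) (Dom C p)" "p \<cdot> \<phi> = ?t" "q \<cdot> \<phi> = ?b"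
    using pb_map[OF ED(1), of ?t "Dom C ?t" ?b] pbD(9)[OF bc] by (auto simp: hom_def)
  note [simp] = homD(1-3)[OF phi(1)]
  \<comment> \<open>Here the mono \<open>i\<close> cancels: evaluation, a priori only over
    \<open>B\<close>, is a map over \<open>D\<close>.\<close>
  have yeps: "y \<cdot> \<epsilon> = q"
    by (rule monoD[OF i, of _ "Dom C p"]) (use ED(5) pbD(9)[OF ED(1)] in \<open>auto simp: hom_def\<close>)
  have c: "\<epsilon> \<cdot> \<phi> \<in> hom_over C ?b y"
    using reassoc[OF yeps eps, of D \<phi>] phi(3) by (auto simp: hom_over_def hom_def)
  have "is_pushforward C i y P (\<epsilon> \<cdot> \<phi>)" unfolding is_pushforward_def
  proof (intro conjI ballI impI)
    fix x g assume x: "x \<in> Arr C" "Cod C x = Cod C i" and g: "g \<in> hom_over C (base_change C i x) y"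
    let ?s = "base_change_top C i x" and ?u = "base_change C i x"
    have xb: "is_pullback C ?s ?u x i" by (rule base_change_pb) (use x in auto)
    note [simp] = pbD(4-8)[OF xb] x
    note g = hom_overD[OF g]
    note [simp] = homD(1-3)[OF g(1)]
    have ge: "(i \<cdot> y) \<cdot> g = x \<cdot> ?s" using g pbD(9)[OF xb] by simp
    have ex1: "\<exists>!h. h \<in> hom C (Dom C x) (Dom C P) \<and> P \<cdot> h = x \<and> \<epsilon> \<cdot> tuple C p q (h \<cdot> ?s) ?u = g"
      using E xb g(1) ge unfolding is_slice_exp_def by auto
    have eq: "(\<epsilon> \<cdot> \<phi>) \<cdot> base_change_map C i x P h = \<epsilon> \<cdot> tuple C p q (h \<cdot> ?s) ?u"
      if h: "h \<in> hom C (Dom C x) (Dom C P)" "P \<cdot> h = x" for h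
    proof -
      note [simp] = homD(1-3)[OF h(1)]
      have e: "P \<cdot> (h \<cdot> ?s) = i \<cdot> ?u"
        using reassoc[OF h(2,1), of B ?s] pbD(9)[OF xb] by (auto simp: hom_def)
      have t: "bct i P (h \<cdot> ?s) ?u \<in> hom C (Dom C ?s) (Dom C ?t)" "?t \<cdot> bct i P (h \<cdot> ?s) ?u = h \<cdot> ?s"
        "?b \<cdot> bct i P (h \<cdot> ?s) ?u = ?u"
        using pb_tuple[OF bc, of "h \<cdot> ?s" "Dom C ?s" ?u] e by (auto simp: hom_def)
      note [simp] = homD(1-3)[OF t(1)]
      have "tuple C p q (h \<cdot> ?s) ?u = \<phi> \<cdot> bct i P (h \<cdot> ?s) ?u"
        by (rule pb_tuple_eq[OF ED(1), of _ "Dom C ?s"])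
          (use reassoc[OF phi(2,1), of "Dom C P" "bct i P (h \<cdot> ?s) ?u"] reassoc[OF phi(3,1), of D "bct i P (h \<cdot> ?s) ?u"] t
            in \<open>auto simp: hom_def\<close>)
      then show ?thesis by (simp add: base_change_map_def)
    qed
    from ex1 obtain h where h: "h \<in> hom C (Dom C x) (Dom C P)" "P \<cdot> h = x" "\<epsilon> \<cdot> tuple C p q (h \<cdot> ?s) ?u = g" by blast
    show "\<exists>!h. h \<in> hom_over C x P \<and> (\<epsilon> \<cdot> \<phi>) \<cdot> base_change_map C i x P h = g"
    proof (rule ex1I[of _ h])
      show "h \<in> hom_over C x P \<and> (\<epsilon> \<cdot> \<phi>) \<cdot> base_change_map C i x P h = g"
        using h eq[of h] by (auto simp: hom_over_def)
      fix k assume k: "k \<in> hom_over C x P \<and> (\<epsilon> \<cdot> \<phi>) \<cdot> base_change_map C i x P k = g"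
      then have "k \<in> hom C (Dom C x) (Dom C P)" "P \<cdot> k = x" by (auto simp: hom_over_def)
      moreover from this have "\<epsilon> \<cdot> tuple C p q (k \<cdot> ?s) ?u = g" using eq[of k] k by simp
      ultimately show "k = h" using ex1 h by blast
    qed
  qed (use c in auto)
  then show ?thesis by blast
qed

lemma pushforward_spec:
  assumes "is_mono C i" "i \<in> hom C D B" "y \<in> hom C Y D"
  shows "is_pushforward C i y (pushforward C i y) (pushforward_counit C i y)"
proof -
  have "\<exists>pc. case pc of (p, c) \<Rightarrow> is_pushforward C i y p c" using pushforward_ex[OF assms] by auto
  from someI_ex[OF this] show ?thesis
    by (auto simp: pushforward_data_def pushforward_def pushforward_counit_def split: prod.splits)
qed

lemma pushforward_transpose_spec:
  assumes "is_mono C i" "i \<in> hom C D B" "y \<in> hom C Y D" "x \<in> hom C X B" "g \<in> hom_over C (base_change C i x) y"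
  shows "pushforward_transpose C i x y g \<in> hom C X (Dom C (pushforward C i y))"
    "pushforward C i y \<cdot> pushforward_transpose C i x y g = x"
    "pushforward_counit C i y \<cdot> base_change_map C i x (pushforward C i y) (pushforward_transpose C i x y g) = g"
proof -
  have "\<exists>!h. h \<in> hom_over C x (pushforward C i y) \<and>
      pushforward_counit C i y \<cdot> base_change_map C i x (pushforward C i y) h = g"
    using pushforward_spec[OF assms(1-3)] assms(5) homD[OF assms(4)] homD[OF assms(2)] unfolding is_pushforward_def by auto
  from theI'[OF this, folded pushforward_transpose_def] homD[OF assms(4)]
  show "pushforward_transpose C i x y g \<in> hom C X (Dom C (pushforward C i y))"
    "pushforward C i y \<cdot> pushforward_transpose C i x y g = x"
    "pushforward_counit C i y \<cdot> base_change_map C i x (pushforward C i y) (pushforward_transpose C i x y g) = g"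
    by (auto simp: hom_over_def)
qed

text \<open>The universal property of the pushforward, relative to arbitrary pullbacks along \<open>i\<close>
  rather than the chosen ones.\<close>

context
  fixes i D B y Y
  assumes i: "is_mono C i" "i \<in> hom C D B" and y: "y \<in> hom C Y D"
begin

private abbreviation "p \<equiv> pushforward C i y"
private abbreviation "c \<equiv> pushforward_counit C i y"

lemma pushforward_typing:
  shows "p \<in> Arr C" "Cod C p = B" "c \<in> hom C (Dom C (base_change_top C i p)) Y"
    "y \<cdot> c = base_change C i p" "is_pullback C (base_change_top C i p) (base_change C i p) p i"
proof -
  note S = pushforward_spec[OF i y, unfolded is_pushforward_def] and [simp] = homD[OF i(2)] homD[OF y]
  show p: "p \<in> Arr C" "Cod C p = B" using S by auto
  show pb: "is_pullback C (base_change_top C i p) (base_change C i p) p i"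
    by (rule base_change_pb) (use p in auto)
  have "c \<in> hom_over C (base_change C i p) y" using S by auto
  then show "c \<in> hom C (Dom C (base_change_top C i p)) Y" "y \<cdot> c = base_change C i p"
    using pbD(6)[OF pb] by (auto simp: hom_over_def)
qed

lemma pushforward_map_ex:
  assumes pb: "is_pullback C s t x i" and g: "g \<in> hom C (Dom C s) Y" "y \<cdot> g = t"
  shows "\<exists>h. h \<in> hom C (Dom C x) (Dom C p) \<and> p \<cdot> h = x \<and> c \<cdot> bct i p (h \<cdot> s) t = g"
proof -
  note ty = pushforward_typing
  note [simp] = homD[OF i(2)] homD[OF y] ty(1,2) homD(1-3)[OF g(1)] pbD(4-8)[OF ty(5)] homD(1-3)[OF ty(3)]
  have [simp]: "x \<in> Arr C" "Cod C x = B" using pbD[OF pb] by auto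
  note [simp] = pbD(4-8)[OF pb]
  let ?s = "base_change_top C i x" and ?t = "base_change C i x"
  have xb: "is_pullback C ?s ?t x i" by (rule base_change_pb) auto
  note [simp] = pbD(4-8)[OF xb]
  obtain m n where m: "m \<in> hom C (Dom C s) (Dom C ?s)" and n: "n \<in> hom C (Dom C ?s) (Dom C s)"
    and mn: "m \<cdot> n = Id C (Dom C ?s)" "n \<cdot> m = Id C (Dom C s)" "?s \<cdot> m = s" "?t \<cdot> m = t" "s \<cdot> n = ?s" "t \<cdot> n = ?t"
    using pb_iso[OF pb xb] by blast
  note [simp] = homD(1-3)[OF m] homD(1-3)[OF n]
  have gn: "g \<cdot> n \<in> hom_over C ?t y"
    using reassoc[OF g(2,1), of D n] mn by (auto simp: hom_over_def hom_def)
  have x: "x \<in> hom C (Dom C x) B" by (simp add: hom_def)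
  note T = pushforward_transpose_spec[OF i y x gn]
  let ?h = "pushforward_transpose C i x y (g \<cdot> n)"
  note [simp] = homD(1-3)[OF T(1)]
  have e: "p \<cdot> (?h \<cdot> ?s) = i \<cdot> ?t" using reassoc[OF T(2,1), of B ?s] pbD(9)[OF xb] by (auto simp: hom_def)
  have p: "p \<in> hom C (Dom C p) B" by (simp add: hom_def)
  note b = bct_spec[OF i(2) p, of "?h \<cdot> ?s" "Dom C ?s" ?t, OF _ _ e]
  have b4: "bct i p (?h \<cdot> ?s) ?t \<cdot> m = bct i p (?h \<cdot> s) t"
    using b(4)[of m "Dom C s"] m mn by (auto simp: hom_def)
  have "c \<cdot> (bct i p (?h \<cdot> ?s) ?t \<cdot> m) = (g \<cdot> n) \<cdot> m"
    using reassoc[OF T(3)[unfolded base_change_map_def] b(1) ty(3), of m] by (auto simp: hom_def)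
  then have "c \<cdot> bct i p (?h \<cdot> s) t = g" using b4 mn by simp
  then show ?thesis using T(1,2) by blast
qed

lemma pushforward_map_uniq:
  assumes pb: "is_pullback C s t x i"
    and h: "h \<in> hom C (Dom C x) (Dom C p)" "p \<cdot> h = x" and k: "k \<in> hom C (Dom C x) (Dom C p)" "p \<cdot> k = x"
    and eq: "c \<cdot> bct i p (h \<cdot> s) t = c \<cdot> bct i p (k \<cdot> s) t"
  shows "h = k"
proof -
  note ty = pushforward_typing
  note [simp] = homD[OF i(2)] homD[OF y] ty(1,2) pbD(4-8)[OF ty(5)] homD(1-3)[OF ty(3)]
  have x [simp]: "x \<in> Arr C" "Cod C x = B" using pbD[OF pb] by auto
  note [simp] = pbD(4-8)[OF pb]
  let ?s = "base_change_top C i x" and ?t = "base_change C i x"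
  have xb: "is_pullback C ?s ?t x i" by (rule base_change_pb) auto
  note [simp] = pbD(4-8)[OF xb]
  obtain n where n: "n \<in> hom C (Dom C ?s) (Dom C s)" and mn: "s \<cdot> n = ?s" "t \<cdot> n = ?t"
    using pb_iso[OF pb xb] by blast
  note [simp] = homD(1-3)[OF n]
  have p: "p \<in> hom C (Dom C p) B" by (simp add: hom_def)
  have B: "base_change_map C i x p h = bct i p (h \<cdot> s) t \<cdot> n" "bct i p (h \<cdot> s) t \<in> hom C (Dom C s) (Dom C (base_change_top C i p))"
    if h: "h \<in> hom C (Dom C x) (Dom C p)" "p \<cdot> h = x" for h
  proof -
    note [simp] = homD(1-3)[OF h(1)]
    have e: "p \<cdot> (h \<cdot> s) = i \<cdot> t" using reassoc[OF h(2,1), of B s] pbD(9)[OF pb] by (auto simp: hom_def)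
    note b = bct_spec[OF i(2) p, of "h \<cdot> s" "Dom C s" t, OF _ _ e]
    show "bct i p (h \<cdot> s) t \<in> hom C (Dom C s) (Dom C (base_change_top C i p))" by (rule b(1)) (auto simp: hom_def)
    show "base_change_map C i x p h = bct i p (h \<cdot> s) t \<cdot> n"
      using b(4)[of n "Dom C ?s"] n mn by (auto simp: hom_def base_change_map_def)
  qed
  have cb: "c \<cdot> base_change_map C i x p h = c \<cdot> base_change_map C i x p k"
  proof -
    note [simp] = homD(1-3)[OF B(2)[OF h]] homD(1-3)[OF B(2)[OF k]]
    have "c \<cdot> base_change_map C i x p h = (c \<cdot> bct i p (h \<cdot> s) t) \<cdot> n" using B(1)[OF h] by simp
    also have "\<dots> = c \<cdot> base_change_map C i x p k" using B(1)[OF k] eq by simp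
    finally show ?thesis .
  qed
  have "c \<cdot> base_change_map C i x p h \<in> hom_over C ?t y"
  proof -
    note [simp] = homD(1-3)[OF B(2)[OF h]] homD(1-3)[OF h(1)]
    have e: "p \<cdot> (h \<cdot> ?s) = i \<cdot> ?t" using reassoc[OF h(2,1), of B ?s] pbD(9)[OF xb] by (auto simp: hom_def)
    note b = bct_spec[OF i(2) p, of "h \<cdot> ?s" "Dom C ?s" ?t, OF _ _ e]
    have b1: "bct i p (h \<cdot> ?s) ?t \<in> hom C (Dom C ?s) (Dom C (base_change_top C i p))" by (rule b(1)) (auto simp: hom_def)
    have b3: "base_change C i p \<cdot> bct i p (h \<cdot> ?s) ?t = ?t" by (rule b(3)) (auto simp: hom_def)
    note [simp] = homD(1-3)[OF b1]
    have "y \<cdot> (c \<cdot> bct i p (h \<cdot> ?s) ?t) = ?t" using reassoc[OF ty(4,3), of D "bct i p (h \<cdot> ?s) ?t"] b3 by (auto simp: hom_def)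
    then show ?thesis by (auto simp: base_change_map_def hom_over_def hom_def)
  qed
  then have "\<exists>!h'. h' \<in> hom_over C x p \<and> c \<cdot> base_change_map C i x p h' = c \<cdot> base_change_map C i x p h"
    using pushforward_spec[OF i y] x unfolding is_pushforward_def by auto
  moreover have "h \<in> hom_over C x p" "k \<in> hom_over C x p" using h k by (auto simp: hom_over_def)
  ultimately show ?thesis using cb by metis
qed

end

subsection \<open>The glue construction\<close>

context
  fixes i D B e Y a A dw
  assumes i: "is_mono C i" "i \<in> hom C D B" and e: "e \<in> hom C Y B" and a: "a \<in> hom C A D"
    and dw: "dw \<in> hom_over C a (base_change C i e)"
begin

private abbreviation "te \<equiv> base_change_top C i e"
private abbreviation "be \<equiv> base_change C i e"
private abbreviation "w \<equiv> unglue C i e a dw"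
private abbreviation "E \<equiv> glue C i e a dw"
private abbreviation "G \<equiv> glue_top C i e a dw"
private abbreviation "pa \<equiv> pushforward C i a"
private abbreviation "ca \<equiv> pushforward_counit C i a"
private abbreviation "pe \<equiv> pushforward C i be"
private abbreviation "ce \<equiv> pushforward_counit C i be"
private abbreviation "\<eta> \<equiv> pushforward_unit C i e"
private abbreviation "F \<equiv> pushforward_map C i a be dw"
private abbreviation "\<kappa> \<equiv> glue_restrict C i e a dw"

lemma glue_base: "is_pullback C te be e i"
  using homD[OF i(2)] homD[OF e] by (intro base_change_pb) auto

private lemma base_typing [simp]:
  shows "i \<in> Arr C" "Dom C i = D" "Cod C i = B" "e \<in> Arr C" "Dom C e = Y" "Cod C e = B"
    "a \<in> Arr C" "Dom C a = A" "Cod C a = D" "D \<in> Obj C" "B \<in> Obj C" "Y \<in> Obj C" "A \<in> Obj C"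
    "te \<in> Arr C" "be \<in> Arr C" "Dom C be = Dom C te" "Cod C te = Y" "Cod C be = D"
    "dw \<in> Arr C" "Dom C dw = A" "Cod C dw = Dom C te"
proof -
  show [simp]: "i \<in> Arr C" "Dom C i = D" "Cod C i = B" "e \<in> Arr C" "Dom C e = Y" "Cod C e = B"
    "a \<in> Arr C" "Dom C a = A" "Cod C a = D" "D \<in> Obj C" "B \<in> Obj C" "Y \<in> Obj C" "A \<in> Obj C"
    using homD[OF i(2)] homD[OF e] homD[OF a] by auto
  show [simp]: "te \<in> Arr C" "be \<in> Arr C" "Dom C be = Dom C te" "Cod C te = Y" "Cod C be = D"
    using pbD[OF glue_base] by auto
  show "dw \<in> Arr C" "Dom C dw = A" "Cod C dw = Dom C te" using homD[OF hom_overD(1)[OF dw]] by auto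
qed

private lemma be_hom: "be \<in> hom C (Dom C te) D"
  by (simp add: hom_def)

private lemma dw_hom: "dw \<in> hom C A (Dom C te)" "be \<cdot> dw = a"
  using hom_overD[OF dw] by auto

private lemmas pa_typing = pushforward_typing[OF i a]
private lemmas pe_typing = pushforward_typing[OF i be_hom]

private lemma pf_typing [simp]:
  shows "pa \<in> Arr C" "Cod C pa = B" "pe \<in> Arr C" "Cod C pe = B"
    "ca \<in> Arr C" "Dom C ca = Dom C (base_change_top C i pa)" "Cod C ca = A"
    "ce \<in> Arr C" "Dom C ce = Dom C (base_change_top C i pe)" "Cod C ce = Dom C te"
    "base_change_top C i pa \<in> Arr C" "Cod C (base_change_top C i pa) = Dom C pa"
    "base_change_top C i pe \<in> Arr C" "Cod C (base_change_top C i pe) = Dom C pe"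
    "base_change C i pa \<in> Arr C" "Dom C (base_change C i pa) = Dom C (base_change_top C i pa)"
    "Cod C (base_change C i pa) = D"
    "base_change C i pe \<in> Arr C" "Dom C (base_change C i pe) = Dom C (base_change_top C i pe)"
    "Cod C (base_change C i pe) = D"
  using pa_typing(1,2) pe_typing(1,2) homD[OF pa_typing(3)] homD[OF pe_typing(3)]
    pbD[OF pa_typing(5)] pbD[OF pe_typing(5)] by auto

private lemma pa_hom: "pa \<in> hom C (Dom C pa) B" and pe_hom: "pe \<in> hom C (Dom C pe) B"
  by (simp_all add: hom_def)

private lemma eta_spec: "\<eta> \<in> hom C Y (Dom C pe)" "pe \<cdot> \<eta> = e" "ce \<cdot> bct i pe (\<eta> \<cdot> te) be = Id C (Dom C te)"
proof -
  have "Id C (Dom C be) \<in> hom_over C be be" by (auto simp: hom_over_def hom_def)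
  note T = pushforward_transpose_spec[OF i be_hom e this, folded pushforward_unit_def]
  then show "\<eta> \<in> hom C Y (Dom C pe)" "pe \<cdot> \<eta> = e" "ce \<cdot> bct i pe (\<eta> \<cdot> te) be = Id C (Dom C te)"
    by (auto simp: base_change_map_def)
qed

private lemma F_spec: "F \<in> hom C (Dom C pa) (Dom C pe)" "pe \<cdot> F = pa"
  "ce \<cdot> bct i pe (F \<cdot> base_change_top C i pa) (base_change C i pa) = dw \<cdot> ca"
proof -
  have "be \<cdot> (dw \<cdot> ca) = base_change C i pa"
    using reassoc[OF dw_hom(2,1), of D ca] pa_typing(4) by (simp add: hom_def)
  then have "dw \<cdot> ca \<in> hom_over C (base_change C i pa) be" by (auto simp: hom_over_def hom_def)
  note T = pushforward_transpose_spec[OF i be_hom pa_hom this, folded pushforward_map_def]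
  then show "F \<in> hom C (Dom C pa) (Dom C pe)" "pe \<cdot> F = pa"
    "ce \<cdot> bct i pe (F \<cdot> base_change_top C i pa) (base_change C i pa) = dw \<cdot> ca"
    by (auto simp: base_change_map_def)
qed

private lemma ef_typing [simp]:
  "\<eta> \<in> Arr C" "Dom C \<eta> = Y" "Cod C \<eta> = Dom C pe" "F \<in> Arr C" "Dom C F = Dom C pa" "Cod C F = Dom C pe"
  using homD[OF eta_spec(1)] homD[OF F_spec(1)] by auto

private lemma glue_pb: "is_pullback C G w F \<eta>"
  unfolding glue_top_def unglue_def by (rule base_change_pb) auto

private lemma w_typing [simp]: "w \<in> Arr C" "Dom C w = Dom C E" "Cod C w = Y"
  "G \<in> Arr C" "Dom C G = Dom C E" "Cod C G = Dom C pa" "E \<in> Arr C" "Cod C E = B"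
  using pbD[OF glue_pb] by (auto simp: glue_def)

private lemma glue_comp: "x \<in> Arr C \<Longrightarrow> Cod C x = Dom C E \<Longrightarrow> E \<cdot> x = e \<cdot> (w \<cdot> x)"
  using reassoc[OF glue_def[of C i e a dw, symmetric], of "Dom C E" Y B x] by (simp add: hom_def)

private lemma pa_G: "pa \<cdot> G = E"
proof -
  have "pa \<cdot> G = pe \<cdot> (F \<cdot> G)" using reassoc[OF F_spec(2,1), of B G] by (simp add: hom_def)
  also have "\<dots> = pe \<cdot> (\<eta> \<cdot> w)" using pbD(9)[OF glue_pb] by simp
  also have "\<dots> = E" using reassoc[OF eta_spec(2,1), of B w] by (simp add: hom_def glue_def)
  finally show ?thesis .
qed

text \<open>Naturality of the counit, evaluated at a generalized element of the restricted
  pushforward. \<open>F_spec\<close> is the universal case, through which every pair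
  \<open>s\<close>, \<open>t\<close> factors.\<close>

private lemma F_tuple:
  assumes s: "s \<in> hom C V (Dom C pa)" and t: "t \<in> hom C V D" and st: "pa \<cdot> s = i \<cdot> t"
  shows "ce \<cdot> bct i pe (F \<cdot> s) t = dw \<cdot> (ca \<cdot> bct i pa s t)"
proof -
  note b = bct_spec[OF i(2) pa_hom s t st]
  note [simp] = homD[OF s] homD[OF t] homD[OF b(1)]
  let ?T = "base_change_top C i pa" and ?U = "base_change C i pa"
  have e0: "pe \<cdot> (F \<cdot> ?T) = i \<cdot> ?U"
    using reassoc[OF F_spec(2,1), of B ?T] pbD(9)[OF pa_typing(5)] by (simp add: hom_def)
  have h0: "F \<cdot> ?T \<in> hom C (Dom C ?T) (Dom C pe)" "?U \<in> hom C (Dom C ?T) D" by (simp_all add: hom_def)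
  note b0 = bct_spec[OF i(2) pe_hom h0 e0]
  have "bct i pe (F \<cdot> s) t = bct i pe (F \<cdot> ?T) ?U \<cdot> bct i pa s t"
    using b0(4)[OF b(1)] b(2,3) by simp
  then show ?thesis
    using reassoc[OF F_spec(3) b0(1), of "Dom C te" "bct i pa s t"] b by (simp add: hom_def)
qed

text \<open>The triangle identity of the adjunction, carried from the universal element
  \<open>te\<close>, \<open>be\<close> to an arbitrary pair.\<close>

private lemma eta_tuple:
  assumes s: "s \<in> hom C V Y" and t: "t \<in> hom C V D" and st: "e \<cdot> s = i \<cdot> t"
  shows "ce \<cdot> bct i pe (\<eta> \<cdot> s) t = bct i e s t"
proof -
  note b = bct_spec[OF i(2) e s t st]
  note [simp] = homD[OF s] homD[OF t] homD[OF b(1)]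
  have e0: "pe \<cdot> (\<eta> \<cdot> te) = i \<cdot> be"
    using reassoc[OF eta_spec(2,1), of B te] pbD(9)[OF glue_base] by (simp add: hom_def)
  have h0: "\<eta> \<cdot> te \<in> hom C (Dom C te) (Dom C pe)" "be \<in> hom C (Dom C te) D" by (simp_all add: hom_def)
  note b0 = bct_spec[OF i(2) pe_hom h0 e0]
  have "bct i pe (\<eta> \<cdot> s) t = bct i pe (\<eta> \<cdot> te) be \<cdot> bct i e s t"
    using b0(4)[OF b(1)] b(2,3) by simp
  then show ?thesis
    using reassoc[OF eta_spec(3) b0(1), of "Dom C te" "bct i e s t"] b by (simp add: hom_def)
qed

private lemma E_hom: "E \<in> hom C (Dom C E) B"
  by (simp add: hom_def)

private lemma E_pb: "is_pullback C (base_change_top C i E) (base_change C i E) E i"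
  by (rule base_change_pb) auto

private lemma bE_typing [simp]:
  "base_change_top C i E \<in> Arr C" "Cod C (base_change_top C i E) = Dom C E"
  "base_change C i E \<in> Arr C" "Dom C (base_change C i E) = Dom C (base_change_top C i E)" "Cod C (base_change C i E) = D"
  using pbD[OF E_pb] by auto

private lemma kappa_def: "\<kappa> = ca \<cdot> bct i pa (G \<cdot> base_change_top C i E) (base_change C i E)"
  by (simp add: glue_restrict_def base_change_map_def)

private lemma G_square: "pa \<cdot> (G \<cdot> base_change_top C i E) = i \<cdot> base_change C i E"
  using reassoc[OF pa_G, of "Dom C E" "Dom C pa" B "base_change_top C i E"] pbD(9)[OF E_pb] by (simp add: hom_def)

private lemma kappa_hom: "\<kappa> \<in> hom C (Dom C (base_change_top C i E)) A" "a \<cdot> \<kappa> = base_change C i E"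
proof -
  have h: "G \<cdot> base_change_top C i E \<in> hom C (Dom C (base_change_top C i E)) (Dom C pa)"
    "base_change C i E \<in> hom C (Dom C (base_change_top C i E)) D" by (simp_all add: hom_def)
  note b = bct_spec[OF i(2) pa_hom h G_square]
  note [simp] = homD(1-3)[OF b(1)]
  show "\<kappa> \<in> hom C (Dom C (base_change_top C i E)) A" unfolding kappa_def by (simp add: hom_def)
  show "a \<cdot> \<kappa> = base_change C i E" unfolding kappa_def
    using reassoc[OF pa_typing(4,3), of D "bct i pa (G \<cdot> base_change_top C i E) (base_change C i E)"] b by (simp add: hom_def)
qed

private lemma kappa_typing [simp]:
  "\<kappa> \<in> Arr C" "Dom C \<kappa> = Dom C (base_change_top C i E)" "Cod C \<kappa> = A"
  using homD[OF kappa_hom(1)] by auto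

private lemma kappa_tuple:
  assumes m: "m \<in> hom C V (Dom C E)" and t: "t \<in> hom C V D" and e: "E \<cdot> m = i \<cdot> t"
  shows "\<kappa> \<cdot> bct i E m t = ca \<cdot> bct i pa (G \<cdot> m) t"
proof -
  note b = bct_spec[OF i(2) E_hom m t e]
  have h: "G \<cdot> base_change_top C i E \<in> hom C (Dom C (base_change_top C i E)) (Dom C pa)"
    "base_change C i E \<in> hom C (Dom C (base_change_top C i E)) D" by (simp_all add: hom_def)
  note b0 = bct_spec[OF i(2) pa_hom h G_square]
  note [simp] = homD(1-3)[OF b(1)] homD(1-3)[OF b0(1)]
  show ?thesis unfolding kappa_def using b0(4)[OF b(1)] b(2,3) by simp
qed

text \<open>Transpose the square that defines the glue object: the unit side becomes the restriction
  of \<open>w\<close> by the triangle identity, and the \<open>F\<close> side becomes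
  \<open>dw \<cdot> \<kappa>\<close> by naturality of the counit.\<close>

lemma unglue_restrict: "base_change_map C i E e w = dw \<cdot> \<kappa>"
proof -
  let ?T = "base_change_top C i E" and ?U = "base_change C i E"
  have U: "?U \<in> hom C (Dom C ?T) D" by (simp add: hom_def)
  have ew: "e \<cdot> (w \<cdot> ?T) = i \<cdot> ?U" using pbD(9)[OF E_pb] glue_comp[of ?T] by simp
  have "dw \<cdot> \<kappa> = ce \<cdot> bct i pe (F \<cdot> (G \<cdot> ?T)) ?U"
    unfolding kappa_def using F_tuple[OF _ U G_square] by (simp add: hom_def)
  also have "F \<cdot> (G \<cdot> ?T) = \<eta> \<cdot> (w \<cdot> ?T)"
    using reassoc2[OF pbD(9)[OF glue_pb], of "Dom C E" "Dom C pa" "Dom C pe" Y ?T] by (simp add: hom_def)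
  also have "ce \<cdot> bct i pe (\<eta> \<cdot> (w \<cdot> ?T)) ?U = bct i e (w \<cdot> ?T) ?U"
    using eta_tuple[OF _ U ew] by (simp add: hom_def)
  finally show ?thesis by (simp add: base_change_map_def)
qed

text \<open>\<open>v\<close> transposes to a map \<open>h\<close> into the pushforward of
  \<open>a\<close>. Together with \<open>u\<close> it forms a cone on the defining square, because
  both ways around have the transpose \<open>dw \<cdot> v\<close>.\<close>

private lemma glue_map_kappa:
  assumes pb: "is_pullback C s t x i" and u: "u \<in> hom C (Dom C x) Y" "e \<cdot> u = x"
    and v: "v \<in> hom C (Dom C s) A" "a \<cdot> v = t" and uv: "te \<cdot> (dw \<cdot> v) = u \<cdot> s"
  shows "\<exists>m. m \<in> hom C (Dom C x) (Dom C E) \<and> w \<cdot> m = u \<and> \<kappa> \<cdot> bct i E (m \<cdot> s) t = v"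
proof -
  note [simp] = homD(1-3)[OF u(1)] homD(1-3)[OF v(1)]
  have x [simp]: "x \<in> Arr C" "Cod C x = B" using pbD(1,3)[OF pb] by auto
  note [simp] = pbD(4-8)[OF pb]
  obtain h where h: "h \<in> hom C (Dom C x) (Dom C pa)" "pa \<cdot> h = x" "ca \<cdot> bct i pa (h \<cdot> s) t = v"
    using pushforward_map_ex[OF i a pb v] by blast
  note [simp] = homD(1-3)[OF h(1)]
  have phs: "pa \<cdot> (h \<cdot> s) = i \<cdot> t" using reassoc[OF h(2,1), of B s] pbD(9)[OF pb] by (simp add: hom_def)
  have eus: "e \<cdot> (u \<cdot> s) = i \<cdot> t" using reassoc[OF u(2,1), of B s] pbD(9)[OF pb] by (simp add: hom_def)
  \<comment> \<open>The two composites into the pushforward of \<open>be\<close> are compared by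
    their transposes, where \<open>uv\<close> applies.\<close>
  have Fh: "F \<cdot> h = \<eta> \<cdot> u"
  proof (rule pushforward_map_uniq[OF i be_hom pb])
    show "F \<cdot> h \<in> hom C (Dom C x) (Dom C pe)" "\<eta> \<cdot> u \<in> hom C (Dom C x) (Dom C pe)" by (simp_all add: hom_def)
    show "pe \<cdot> F \<cdot> h = x" using reassoc[OF F_spec(2,1), of B h] h by (simp add: hom_def)
    show "pe \<cdot> \<eta> \<cdot> u = x" using reassoc[OF eta_spec(2,1), of B u] u by (simp add: hom_def)
    have "ce \<cdot> bct i pe ((F \<cdot> h) \<cdot> s) t = dw \<cdot> v"
      using F_tuple[OF _ _ phs, of "Dom C s"] h(3) by (simp add: hom_def)
    also have "\<dots> = bct i e (u \<cdot> s) t"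
      by (rule pb_tuple_eq[OF glue_base, symmetric, of _ "Dom C s"])
        (use uv reassoc[OF dw_hom(2,1), of D v] v in \<open>simp_all add: hom_def\<close>)
    also have "\<dots> = ce \<cdot> bct i pe ((\<eta> \<cdot> u) \<cdot> s) t"
      using eta_tuple[OF _ _ eus, of "Dom C s"] by (simp add: hom_def)
    finally show "ce \<cdot> bct i pe ((F \<cdot> h) \<cdot> s) t = ce \<cdot> bct i pe ((\<eta> \<cdot> u) \<cdot> s) t" .
  qed
  obtain m where m: "m \<in> hom C (Dom C x) (Dom C E)" "G \<cdot> m = h" "w \<cdot> m = u"
    using pb_map[OF glue_pb, of h "Dom C x" u] Fh by (auto simp: hom_def)
  note [simp] = homD(1-3)[OF m(1)]
  have Em: "E \<cdot> m = x" using m(3) u glue_comp[of m] by simp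
  have Ems: "E \<cdot> (m \<cdot> s) = i \<cdot> t" using reassoc[OF Em m(1), of B s] pbD(9)[OF pb] by (simp add: hom_def)
  have "\<kappa> \<cdot> bct i E (m \<cdot> s) t = ca \<cdot> bct i pa (h \<cdot> s) t"
    using kappa_tuple[OF _ _ Ems, of "Dom C s"] reassoc[OF m(2,1), of "Dom C pa" s] by (simp add: hom_def)
  then show ?thesis using m h by auto
qed

text \<open>The component into the pushforward of \<open>a\<close> is determined by its transpose,
  which \<open>\<kappa>\<close> reads off; the other component is \<open>w\<close>.\<close>

private lemma glue_uniq_kappa:
  assumes pb: "is_pullback C s t x i"
    and m: "m \<in> hom C (Dom C x) (Dom C E)" "E \<cdot> m = x" and n: "n \<in> hom C (Dom C x) (Dom C E)"
    and eq: "w \<cdot> m = w \<cdot> n" "\<kappa> \<cdot> bct i E (m \<cdot> s) t = \<kappa> \<cdot> bct i E (n \<cdot> s) t"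
  shows "m = n"
proof -
  note [simp] = homD(1-3)[OF m(1)] homD(1-3)[OF n]
  have x [simp]: "x \<in> Arr C" "Cod C x = B" using pbD(1,3)[OF pb] by auto
  note [simp] = pbD(4-8)[OF pb]
  have nE: "E \<cdot> n = x" using m(2) eq(1) glue_comp[of m] glue_comp[of n] by simp
  have Ems: "E \<cdot> (m \<cdot> s) = i \<cdot> t" using reassoc[OF m(2,1), of B s] pbD(9)[OF pb] by (simp add: hom_def)
  have Ens: "E \<cdot> (n \<cdot> s) = i \<cdot> t" using reassoc[OF nE n, of B s] pbD(9)[OF pb] by (simp add: hom_def)
  have "G \<cdot> m = G \<cdot> n"
  proof (rule pushforward_map_uniq[OF i a pb])
    show "G \<cdot> m \<in> hom C (Dom C x) (Dom C pa)" "G \<cdot> n \<in> hom C (Dom C x) (Dom C pa)" by (simp_all add: hom_def)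
    show "pa \<cdot> G \<cdot> m = x" using reassoc[OF pa_G, of "Dom C E" "Dom C pa" B m] m by (simp add: hom_def)
    show "pa \<cdot> G \<cdot> n = x" using reassoc[OF pa_G, of "Dom C E" "Dom C pa" B n] nE by (simp add: hom_def)
    show "ca \<cdot> bct i pa ((G \<cdot> m) \<cdot> s) t = ca \<cdot> bct i pa ((G \<cdot> n) \<cdot> s) t"
      using kappa_tuple[OF _ _ Ems, of "Dom C s"] kappa_tuple[OF _ _ Ens, of "Dom C s"] eq(2) by (simp add: hom_def)
  qed
  then show ?thesis using pb_uniq[OF glue_pb, of m "Dom C x" n] m n eq by simp
qed

lemma unglue_hom: "w \<in> hom C (Dom C E) Y"
  by (simp add: hom_def)

lemma glue_kappa: "\<kappa> \<in> hom_over C (base_change C i E) a"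
  using kappa_hom by (simp add: hom_over_def)

text \<open>The object \<open>i \<cdot> a\<close> over \<open>B\<close> is its own restriction, so
  \<open>te \<cdot> dw\<close> and the identity of \<open>A\<close> define a map \<open>c\<close>
  into the glue object. It supplies the inverse of \<open>\<kappa>\<close> and the top edge of the
  square that exhibits \<open>a\<close> as the restriction of the glue object.\<close>

lemma glue_incl:
  shows "\<exists>c. c \<in> hom C A (Dom C E) \<and> w \<cdot> c = te \<cdot> dw \<and> c \<cdot> \<kappa> = base_change_top C i E \<and>
    \<kappa> \<cdot> bct i E c a = Id C A \<and> bct i E c a \<cdot> \<kappa> = Id C (Dom C (base_change_top C i E)) \<and> E \<cdot> c = i \<cdot> a"
proof -
  let ?T = "base_change_top C i E" and ?U = "base_change C i E"
  have ei: "e \<cdot> (te \<cdot> dw) = i \<cdot> a"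
    using reassoc2[OF pbD(9)[OF glue_base], of "Dom C te" Y B D dw] dw_hom by (simp add: hom_def)
  obtain c where c: "c \<in> hom C A (Dom C E)" "w \<cdot> c = te \<cdot> dw" "\<kappa> \<cdot> bct i E c a = Id C A"
    using glue_map_kappa[OF pb_along_mono[OF i a], of "te \<cdot> dw" "Id C A"] ei homD[OF a] by (auto simp: hom_def)
  note [simp] = homD(1-3)[OF c(1)]
  have Ec: "E \<cdot> c = i \<cdot> a" using c ei glue_comp[of c] by simp
  note b = bct_spec[OF i(2) E_hom c(1) a Ec]
  note [simp] = homD(1-3)[OF b(1)]
  \<comment> \<open>Both sides are maps into the glue object from an object over \<open>D\<close>;
    they are equal once their \<open>w\<close> and \<open>\<kappa>\<close> components agree.\<close>
  have ck: "c \<cdot> \<kappa> = ?T"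
  proof (rule glue_uniq_kappa)
    have U: "?U \<in> hom C (Dom C ?T) D" by (simp add: hom_def)
    have EcK: "E \<cdot> (c \<cdot> \<kappa>) = i \<cdot> ?U"
      using reassoc2[OF Ec, of A "Dom C E" B D \<kappa>] kappa_hom(2) by (simp add: hom_def)
    show "is_pullback C (Id C (Dom C ?T)) ?U (i \<cdot> ?U) i" by (rule pb_along_mono[OF i U])
    show "c \<cdot> \<kappa> \<in> hom C (Dom C (i \<cdot> ?U)) (Dom C E)" "?T \<in> hom C (Dom C (i \<cdot> ?U)) (Dom C E)" by (simp_all add: hom_def)
    show "E \<cdot> c \<cdot> \<kappa> = i \<cdot> ?U" by (rule EcK)
    have ewT: "e \<cdot> (w \<cdot> ?T) = i \<cdot> ?U" using pbD(9)[OF E_pb] glue_comp[of ?T] by simp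
    have "te \<cdot> (dw \<cdot> \<kappa>) = w \<cdot> ?T"
      using bct_spec(2)[OF i(2) e _ U ewT] unglue_restrict[symmetric] by (simp add: base_change_map_def hom_def)
    then show "w \<cdot> c \<cdot> \<kappa> = w \<cdot> ?T" using reassoc2[OF c(2,1), of Y "Dom C te" \<kappa>] by (simp add: hom_def)
    have "bct i E (c \<cdot> \<kappa>) ?U = bct i E c a \<cdot> \<kappa>" using b(4)[OF kappa_hom(1)] kappa_hom(2) by simp
    then have "\<kappa> \<cdot> bct i E (c \<cdot> \<kappa>) ?U = \<kappa>" using reassoc[OF c(3) b(1), of A \<kappa>] by (simp add: hom_def)
    moreover have "bct i E ?T ?U = Id C (Dom C ?T)" by (rule pb_tuple_eq[OF E_pb, of _ "Dom C ?T"]) (simp_all add: hom_def)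
    ultimately show "\<kappa> \<cdot> bct i E ((c \<cdot> \<kappa>) \<cdot> Id C (Dom C ?T)) ?U = \<kappa> \<cdot> bct i E (?T \<cdot> Id C (Dom C ?T)) ?U" by simp
  qed
  have "bct i E c a \<cdot> \<kappa> = Id C (Dom C ?T)"
    by (rule pb_uniq[OF E_pb, of _ "Dom C ?T"])
      (use reassoc[OF b(2,1), of "Dom C E" \<kappa>] reassoc[OF b(3,1), of D \<kappa>] ck kappa_hom in \<open>simp_all add: hom_def\<close>)
  then show ?thesis using c ck Ec by blast
qed

lemma glue_restrict_iso: "is_iso C \<kappa>"
proof -
  obtain c where c: "c \<in> hom C A (Dom C E)" "\<kappa> \<cdot> bct i E c a = Id C A"
    "bct i E c a \<cdot> \<kappa> = Id C (Dom C (base_change_top C i E))" "E \<cdot> c = i \<cdot> a"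
    using glue_incl by blast
  show ?thesis unfolding is_iso_def
    using bct_spec(1)[OF i(2) E_hom c(1) a c(4)] c(2,3) by auto
qed

text \<open>Here \<open>c\<close> is the top map of the pullback square exhibiting \<open>a\<close> as the restriction of the glue object.\<close>

lemma glue_spec:
  obtains c where "is_pullback C c a E i" "c \<in> hom C A (Dom C E)" "w \<cdot> c = te \<cdot> dw" "c \<cdot> \<kappa> = base_change_top C i E"
    "\<And>s t x u v. is_pullback C s t x i \<Longrightarrow> u \<in> hom C (Dom C x) Y \<Longrightarrow> e \<cdot> u = x \<Longrightarrow>
      v \<in> hom C (Dom C s) A \<Longrightarrow> a \<cdot> v = t \<Longrightarrow> te \<cdot> (dw \<cdot> v) = u \<cdot> s \<Longrightarrow>
      \<exists>m. m \<in> hom C (Dom C x) (Dom C E) \<and> w \<cdot> m = u \<and> m \<cdot> s = c \<cdot> v"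
    "\<And>s t x m n. is_pullback C s t x i \<Longrightarrow> m \<in> hom C (Dom C x) (Dom C E) \<Longrightarrow> E \<cdot> m = x \<Longrightarrow>
      n \<in> hom C (Dom C x) (Dom C E) \<Longrightarrow> w \<cdot> m = w \<cdot> n \<Longrightarrow> m \<cdot> s = n \<cdot> s \<Longrightarrow> m = n"
proof -
  let ?T = "base_change_top C i E" and ?U = "base_change C i E"
  obtain c where c: "c \<in> hom C A (Dom C E)" "w \<cdot> c = te \<cdot> dw" "c \<cdot> \<kappa> = ?T"
    "\<kappa> \<cdot> bct i E c a = Id C A" "bct i E c a \<cdot> \<kappa> = Id C (Dom C ?T)" "E \<cdot> c = i \<cdot> a"
    using glue_incl by blast
  note b = bct_spec[OF i(2) E_hom c(1) a c(6)]
  note [simp] = homD(1-3)[OF c(1)] homD(1-3)[OF b(1)]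
  show thesis
  proof (rule that[OF _ c(1-3)])
    show "is_pullback C c a E i"
    proof (rule pbI[of _ "Dom C E" B _ D _ A])
      fix V u v assume u: "u \<in> hom C V (Dom C E)" and v: "v \<in> hom C V D" and uv: "E \<cdot> u = i \<cdot> v"
      note [simp] = homD[OF u] homD[OF v]
      note b' = bct_spec[OF i(2) E_hom u v uv]
      note [simp] = homD(1-3)[OF b'(1)]
      have "c \<cdot> (\<kappa> \<cdot> bct i E u v) = u" using reassoc[OF c(3) kappa_hom(1) c(1), of "bct i E u v"] b' by simp
      moreover have "a \<cdot> (\<kappa> \<cdot> bct i E u v) = v" using reassoc[OF kappa_hom(2,1) a, of "bct i E u v"] b' by simp
      ultimately show "\<exists>m. m \<in> hom C V A \<and> c \<cdot> m = u \<and> a \<cdot> m = v"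
        by (intro exI[of _ "\<kappa> \<cdot> bct i E u v"]) (simp add: hom_def)
    next
      fix V m n assume m: "m \<in> hom C V A" and n: "n \<in> hom C V A" and eq: "c \<cdot> m = c \<cdot> n" "a \<cdot> m = a \<cdot> n"
      note [simp] = homD[OF m] homD[OF n]
      have "\<kappa> \<cdot> (bct i E c a \<cdot> m) = \<kappa> \<cdot> (bct i E c a \<cdot> n)" using b(4)[OF m] b(4)[OF n] eq by simp
      then show "m = n" using reassoc[OF c(4) b(1) kappa_hom(1), of m] reassoc[OF c(4) b(1) kappa_hom(1), of n] by simp
    qed (use c in \<open>simp_all add: hom_def\<close>)
  next
    fix s t x u v assume pb: "is_pullback C s t x i" and u: "u \<in> hom C (Dom C x) Y" "e \<cdot> u = x"
      and v: "v \<in> hom C (Dom C s) A" "a \<cdot> v = t" and uv: "te \<cdot> (dw \<cdot> v) = u \<cdot> s"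
    have x [simp]: "x \<in> Arr C" "Cod C x = B" using pbD(1,3)[OF pb] by auto
    note [simp] = pbD(4-8)[OF pb]
    obtain m where m: "m \<in> hom C (Dom C x) (Dom C E)" "w \<cdot> m = u" "\<kappa> \<cdot> bct i E (m \<cdot> s) t = v"
      using glue_map_kappa[OF pb u v uv] by blast
    note [simp] = homD(1-3)[OF m(1)]
    have Em: "E \<cdot> m = x" using m(2) u glue_comp[of m] by simp
    have Ems: "E \<cdot> (m \<cdot> s) = i \<cdot> t" using reassoc[OF Em m(1), of B s] pbD(9)[OF pb] by (simp add: hom_def)
    have ms: "m \<cdot> s \<in> hom C (Dom C s) (Dom C E)" "t \<in> hom C (Dom C s) D" by (simp_all add: hom_def)
    note b' = bct_spec[OF i(2) E_hom ms Ems]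
    note [simp] = homD(1-3)[OF b'(1)]
    have "m \<cdot> s = c \<cdot> v" using reassoc[OF c(3) kappa_hom(1) c(1), of "bct i E (m \<cdot> s) t"] b' m(3) by simp
    then show "\<exists>m. m \<in> hom C (Dom C x) (Dom C E) \<and> w \<cdot> m = u \<and> m \<cdot> s = c \<cdot> v" using m by blast
  next
    fix s t x m n assume "is_pullback C s t x i" "m \<in> hom C (Dom C x) (Dom C E)" "E \<cdot> m = x"
      "n \<in> hom C (Dom C x) (Dom C E)" "w \<cdot> m = w \<cdot> n" "m \<cdot> s = n \<cdot> s"
    then show "m = n" using glue_uniq_kappa[of s t x m n] by simp
  qed
qed

declare base_typing [simp del] pf_typing [simp del] ef_typing [simp del] w_typing [simp del]
  bE_typing [simp del] kappa_typing [simp del]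

end

end

locale lcc_interval = lcc_category C T for C :: "('o, 'a) cat" (structure) and T +
  fixes I :: 'o
  assumes I_obj [simp]: "I \<in> Obj C"
begin

subsection \<open>Cylinders\<close>

abbreviation cyl :: "'o \<Rightarrow> 'o" where "cyl X \<equiv> prod_obj C X I"
abbreviation prj :: "'o \<Rightarrow> 'a" where "prj X \<equiv> pr1 C X I"
abbreviation cmap :: "'a \<Rightarrow> 'a" where "cmap f \<equiv> prod_map C f (Id C I)"

definition ins :: "'a \<Rightarrow> 'o \<Rightarrow> 'a" where
  "ins d X = tuple C (pr1 C X I) (pr2 C X I) (Id C X) (d \<cdot> bang C T X)"

lemma cmap_comp:
  assumes "f \<in> Arr C" "g \<in> Arr C" "Cod C f = Dom C g"
  shows "cmap (g \<cdot> f) = cmap g \<cdot> cmap f"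
  using prod_map_comp[of f g "Id C I" "Id C I"] assms by simp

lemma cmap_id [simp]: "X \<in> Obj C \<Longrightarrow> cmap (Id C X) = Id C (cyl X)"
  by (rule prod_map_id) auto

lemma cmap_pb:
  assumes "f \<in> hom C X Y" shows "is_pullback C (cmap f) (prj X) (prj Y) f"
  using prod_map_pullback[OF assms] by simp

lemma ins_typing [simp]:
  assumes "d \<in> hom C T I" "X \<in> Obj C"
  shows "ins d X \<in> Arr C" "Dom C (ins d X) = X" "Cod C (ins d X) = cyl X" "prj X \<cdot> ins d X = Id C X"
    "pr2 C X I \<cdot> ins d X = d \<cdot> bang C T X"
  using homD[OF assms(1)] assms(2) unfolding ins_def by auto

lemma ins_hom: "d \<in> hom C T I \<Longrightarrow> X \<in> Obj C \<Longrightarrow> ins d X \<in> hom C X (cyl X)"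
  by (simp add: hom_def)

lemma ins_prj_re [simp]:
  assumes "d \<in> hom C T I" "x \<in> Arr C" "Cod C x = X"
  shows "prj X \<cdot> (ins d X \<cdot> x) = x"
  using reassoc[OF ins_typing(4) ins_hom, of d X X x] assms dom_cod_obj[of x] by (auto simp: hom_def)

lemma ins_nat:
  assumes d: "d \<in> hom C T I" and f: "f \<in> Arr C" "Cod C f = Y"
  shows "ins d Y \<cdot> f = cmap f \<cdot> ins d (Dom C f)"
proof -
  have [simp]: "Y \<in> Obj C" using f by auto
  note [simp] = f homD[OF d]
  have 1: "pr2 C Y I \<cdot> (ins d Y \<cdot> f) = (d \<cdot> bang C T Y) \<cdot> f"
    using reassoc[OF ins_typing(5) ins_hom, of d Y I f] d by (auto simp: hom_def)
  have 2: "pr2 C Y I \<cdot> (cmap f \<cdot> ins d (Dom C f)) = pr2 C (Dom C f) I \<cdot> ins d (Dom C f)"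
    using prod_map_pr_re(2)[of f "Id C I" Y I "ins d (Dom C f)"] d by simp
  show ?thesis
    by (rule prod_ext[of Y I _ "Dom C f"]) (use d 1 2 in \<open>auto simp: hom_def\<close>)
qed

subsection \<open>Fibred path objects\<close>

lemma path_exp:
  assumes y: "y \<in> hom C Y B"
  shows "is_slice_exp (prj B) y (path_obj C I y) (cyl_pr1 C I (path_obj C I y)) (cyl_pr2 C I (path_obj C I y)) (path_eval C I y)"
    "path_obj C I y \<in> Arr C" "Cod C (path_obj C I y) = B"
proof -
  note [simp] = homD[OF y]
  have E: "is_exponential (slice C B) (prj B) y (path_obj C I y) (exp_ev (slice C B) (prj B) y)"
    using slice_exp_data[of "prj B" y B] by (simp add: path_obj_def cylinder_over_def)
  note S = slice_exponential[OF _ _ _ _ E]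
  show "path_obj C I y \<in> Arr C" and c: "Cod C (path_obj C I y) = B" using S(3,4) by auto
  show "is_slice_exp (prj B) y (path_obj C I y) (cyl_pr1 C I (path_obj C I y)) (cyl_pr2 C I (path_obj C I y)) (path_eval C I y)"
    using S(1) c by (simp add: cyl_pr1_def cyl_pr2_def path_eval_def cylinder_over_def)
qed

lemma cyl_pr_pb:
  assumes x: "x \<in> hom C X B"
  shows "is_pullback C (cyl_pr1 C I x) (cyl_pr2 C I x) x (prj B)"
proof -
  note [simp] = homD[OF x]
  show ?thesis using slice_product(3)[OF slice_prod[of x "prj B" B]]
    by (simp add: cyl_pr1_def cyl_pr2_def cylinder_over_def)
qed

lemma cyl_pb:
  assumes x: "x \<in> hom C X B"
  shows "is_pullback C (prj X) (cmap x) x (prj B)"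
  by (rule pb_sym[OF cmap_pb[OF x]])

text \<open>Path objects are exponentials, so their homotopies are maps out of the chosen slice
  product of \<open>x\<close> with \<open>B \<times> I\<close>. The plain cylinder on
  \<open>Dom C x\<close> is another pullback of the same two maps; this is the comparison from it to
  the chosen one.\<close>

definition cyl_iso :: "'a \<Rightarrow> 'a" where
  "cyl_iso x = tuple C (cyl_pr1 C I x) (cyl_pr2 C I x) (prj (Dom C x)) (cmap x)"

lemma cyl_iso_spec:
  assumes x: "x \<in> hom C X B"
  shows "cyl_iso x \<in> hom C (cyl X) (Dom C (cyl_pr1 C I x))" "cyl_pr1 C I x \<cdot> cyl_iso x = prj X" "cyl_pr2 C I x \<cdot> cyl_iso x = cmap x"
proof -
  note [simp] = homD[OF x]
  show "cyl_iso x \<in> hom C (cyl X) (Dom C (cyl_pr1 C I x))" "cyl_pr1 C I x \<cdot> cyl_iso x = prj X" "cyl_pr2 C I x \<cdot> cyl_iso x = cmap x"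
    using pb_tuple[OF cyl_pr_pb[OF x], of "prj X" "cyl X" "cmap x"]
    unfolding cyl_iso_def by (auto simp: hom_def)
qed

text \<open>Evaluation of paths on the plain cylinder over the path object. With it a homotopy over
  \<open>B\<close> becomes an ordinary map out of a cylinder.\<close>

definition pev :: "'a \<Rightarrow> 'a" where
  "pev y = path_eval C I y \<cdot> cyl_iso (path_obj C I y)"

context
  fixes y Y B assumes y: "y \<in> hom C Y B"
begin

private abbreviation "pth \<equiv> path_obj C I y"
private abbreviation "\<epsilon> \<equiv> path_eval C I y"
private abbreviation "p1 \<equiv> cyl_pr1 C I pth"
private abbreviation "p2 \<equiv> cyl_pr2 C I pth"

lemma path_typing [simp]:
  "pth \<in> Arr C" "Cod C pth = B" "\<epsilon> \<in> Arr C" "Dom C \<epsilon> = Dom C p1" "Cod C \<epsilon> = Y"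
  "p1 \<in> Arr C" "Cod C p1 = Dom C pth" "p2 \<in> Arr C" "Dom C p2 = Dom C p1" "Cod C p2 = cyl B"
  "cyl_iso pth \<in> Arr C" "Dom C (cyl_iso pth) = cyl (Dom C pth)" "Cod C (cyl_iso pth) = Dom C p1"
  "y \<in> Arr C" "Dom C y = Y" "Cod C y = B" "B \<in> Obj C" "Y \<in> Obj C"
proof -
  note [simp] = homD[OF y]
  note E = path_exp[OF y] and D = slice_expD[OF path_exp(1)[OF y]]
  show "pth \<in> Arr C" "Cod C pth = B" "\<epsilon> \<in> Arr C" "Dom C \<epsilon> = Dom C p1" "Cod C \<epsilon> = Y"
    using E D homD[OF D(4)] by auto
  then have pth: "pth \<in> hom C (Dom C pth) B" by (simp add: hom_def)
  show "p1 \<in> Arr C" "Cod C p1 = Dom C pth" "p2 \<in> Arr C" "Dom C p2 = Dom C p1" "Cod C p2 = cyl B"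
    using pbD[OF D(1)] by auto
  show "cyl_iso pth \<in> Arr C" "Dom C (cyl_iso pth) = cyl (Dom C pth)" "Cod C (cyl_iso pth) = Dom C p1"
    using homD[OF cyl_iso_spec(1)[OF pth]] by auto
qed (use homD[OF y] in simp_all)

lemma path_hom: "pth \<in> hom C (Dom C pth) B"
  by (simp add: hom_def)

lemma pev_typing [simp]: "pev y \<in> Arr C" "Dom C (pev y) = cyl (Dom C pth)" "Cod C (pev y) = Y"
  by (auto simp: pev_def)

lemma pev_over: "y \<cdot> pev y = pth \<cdot> prj (Dom C pth)"
proof -
  have "y \<cdot> pev y = pth \<cdot> (p1 \<cdot> cyl_iso pth)"
    using reassoc2[OF slice_expD(5)[OF path_exp(1)[OF y]], of "Dom C p1" Y B "Dom C pth" "cyl_iso pth"]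
    by (simp add: pev_def hom_def)
  then show ?thesis using cyl_iso_spec(2)[OF path_hom] by simp
qed

lemma tuple_pev:
  assumes x: "x \<in> hom C X B" and h: "h \<in> hom C X (Dom C pth)" "pth \<cdot> h = x"
  shows "tuple C p1 p2 (h \<cdot> prj X) (cmap x) = cyl_iso pth \<cdot> cmap h"
proof -
  note [simp] = homD[OF x] homD[OF h(1)]
  show ?thesis
  proof (rule pb_tuple_eq[OF cyl_pr_pb[OF path_hom], of _ "cyl X"])
    show "p1 \<cdot> (cyl_iso pth \<cdot> cmap h) = h \<cdot> prj X"
      using reassoc[OF cyl_iso_spec(2)[OF path_hom], of "cyl (Dom C pth)" "Dom C p1" "Dom C pth" "cmap h"]
      by (simp add: hom_def)
    have "p2 \<cdot> (cyl_iso pth \<cdot> cmap h) = cmap pth \<cdot> cmap h"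
      using reassoc[OF cyl_iso_spec(3)[OF path_hom], of "cyl (Dom C pth)" "Dom C p1" "cyl B" "cmap h"]
      by (simp add: hom_def)
    also have "\<dots> = cmap x" using cmap_comp[of h pth] h by simp
    finally show "p2 \<cdot> (cyl_iso pth \<cdot> cmap h) = cmap x" .
  qed (simp add: hom_def)
qed

lemma path_map_ex:
  assumes x: "x \<in> hom C X B" and g: "g \<in> hom C (cyl X) Y" "y \<cdot> g = x \<cdot> prj X"
  shows "\<exists>h. h \<in> hom C X (Dom C pth) \<and> pth \<cdot> h = x \<and> pev y \<cdot> cmap h = g"
proof -
  note [simp] = homD[OF x]
  obtain h where h: "h \<in> hom C X (Dom C pth)" "pth \<cdot> h = x" "\<epsilon> \<cdot> tuple C p1 p2 (h \<cdot> prj X) (cmap x) = g"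
    using slice_exp_map[OF path_exp(1)[OF y] cyl_pb[OF x], of g] g by auto
  note [simp] = homD[OF h(1)]
  have "pev y \<cdot> cmap h = g" using h(3) tuple_pev[OF x h(1,2)] by (simp add: pev_def)
  then show ?thesis using h by blast
qed

lemma path_map_uniq:
  assumes x: "x \<in> hom C X B" and h: "h \<in> hom C X (Dom C pth)" "pth \<cdot> h = x" and k: "k \<in> hom C X (Dom C pth)" "pth \<cdot> k = x"
    and eq: "pev y \<cdot> cmap h = pev y \<cdot> cmap k"
  shows "h = k"
proof (rule slice_exp_uniq[OF path_exp(1)[OF y] cyl_pb[OF x]])
  note [simp] = homD[OF x] homD[OF h(1)] homD[OF k(1)]
  show "\<epsilon> \<cdot> tuple C p1 p2 (h \<cdot> prj X) (cmap x) = \<epsilon> \<cdot> tuple C p1 p2 (k \<cdot> prj X) (cmap x)"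
    using eq tuple_pev[OF x h] tuple_pev[OF x k] by (simp add: pev_def)
qed (use h k homD[OF x] in auto)

lemma path_ev_pev:
  assumes d: "d \<in> hom C T I"
  shows "path_ev C I d y = pev y \<cdot> ins d (Dom C pth)"
proof -
  note [simp] = homD[OF d]
  have "tuple C p1 p2 (Id C (Dom C pth)) (ins d B \<cdot> pth) = cyl_iso pth \<cdot> ins d (Dom C pth)"
  proof (rule pb_tuple_eq[OF cyl_pr_pb[OF path_hom], of _ "Dom C pth"])
    show "p1 \<cdot> (cyl_iso pth \<cdot> ins d (Dom C pth)) = Id C (Dom C pth)"
      using reassoc[OF cyl_iso_spec(2)[OF path_hom], of "cyl (Dom C pth)" "Dom C p1" "Dom C pth" "ins d (Dom C pth)"] d
      by (simp add: hom_def)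
    show "p2 \<cdot> (cyl_iso pth \<cdot> ins d (Dom C pth)) = ins d B \<cdot> pth"
      using reassoc[OF cyl_iso_spec(3)[OF path_hom], of "cyl (Dom C pth)" "Dom C p1" "cyl B" "ins d (Dom C pth)"] d
        ins_nat[OF d, of pth B]
      by (simp add: hom_def)
  qed (use d in \<open>simp add: hom_def\<close>)
  then show ?thesis using d by (simp add: path_ev_def Let_def ins_def[symmetric] pev_def)
qed

text \<open>\<open>path_transpose\<close> is a description inside the slice, on chosen products. It
  is translated here once into an equation on plain cylinders, from which \<open>path_map\<close>
  and \<open>path_base_change\<close> are computed.\<close>

lemma path_transpose_spec:
  assumes x: "x \<in> hom C X B" and g: "g \<in> hom C (Dom C (cyl_pr1 C I x)) Y" "y \<cdot> g = x \<cdot> cyl_pr1 C I x"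
  shows "path_transpose C I y x g \<in> hom C X (Dom C pth)" "pth \<cdot> path_transpose C I y x g = x"
    "pev y \<cdot> cmap (path_transpose C I y x g) = g \<cdot> cyl_iso x"
proof -
  note [simp] = homD[OF x] homD[OF g(1)]
  let ?S = "slice C B"
  note cx = cyl_pr_pb[OF x]
  note [simp] = pbD(4-8)[OF cx]
  have E: "is_exponential ?S (prj B) y pth (exp_ev ?S (prj B) y)"
    using slice_exp_data[of "prj B" y B] by (simp add: path_obj_def cylinder_over_def)
  note Sp = slice_product[OF slice_prod[of x "prj B" B], simplified]
  have po: "prod_obj ?S x (prj B) = x \<cdot> cyl_pr1 C I x"
    unfolding prod_obj_def by (subst Sp(1)) (simp add: cyl_pr1_def cylinder_over_def)
  have "(x \<cdot> cyl_pr1 C I x, g, y) \<in> hom ?S (prod_obj ?S x (prj B)) y"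
    unfolding slice_hom po using g by (auto simp: hom_over_def)
  then have ex1: "\<exists>!h. h \<in> hom ?S x pth \<and> Comp ?S (exp_ev ?S (prj B) y) (prod_map ?S h (Id ?S (prj B))) = (x \<cdot> cyl_pr1 C I x, g, y)"
    using E unfolding is_exponential_def by auto
  define H where "H = exp_transpose ?S (prj B) y x (x \<cdot> cyl_pr1 C I x, g, y)"
  have H: "H \<in> hom ?S x pth" "Comp ?S (exp_ev ?S (prj B) y) (prod_map ?S H (Id ?S (prj B))) = (x \<cdot> cyl_pr1 C I x, g, y)"
    using theI'[OF ex1] unfolding H_def exp_transpose_def by (auto simp: path_obj_def cylinder_over_def)
  have tr: "path_transpose C I y x g = underlying H"
    unfolding path_transpose_def Let_def H_def by (simp add: cylinder_over_def po)
  obtain h where h: "H = (x, h, pth)" "h \<in> hom_over C x pth" using H(1) unfolding slice_hom by blast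
  then have th: "path_transpose C I y x g = h" using tr by simp
  have hh: "h \<in> hom C X (Dom C pth)" "pth \<cdot> h = x" using hom_overD[OF h(2)] by auto
  note [simp] = homD[OF hh(1)]
  have "exp_ev ?S (prj B) y = (pth \<cdot> underlying (pr1 ?S pth (prj B)), underlying (exp_ev ?S (prj B) y), y)"
    using slice_exponential(2)[OF _ _ _ _ E] by simp
  then have ev: "exp_ev ?S (prj B) y = (pth \<cdot> p1, \<epsilon>, y)"
    by (simp add: cyl_pr1_def path_eval_def cylinder_over_def)
  have 1: "\<epsilon> \<cdot> tuple C p1 p2 (h \<cdot> cyl_pr1 C I x) (cyl_pr2 C I x) = g"
    using H(2) unfolding h(1) ev using slice_prod_map[of "prj B" B x pth h] h(2)
    by (simp add: cyl_pr1_def cyl_pr2_def cylinder_over_def)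
  have e: "pth \<cdot> (h \<cdot> cyl_pr1 C I x) = prj B \<cdot> cyl_pr2 C I x"
    using reassoc[OF hh(2,1), of B "cyl_pr1 C I x"] pbD(9)[OF cx] by (simp add: hom_def)
  have hs: "h \<cdot> cyl_pr1 C I x \<in> hom C (Dom C (cyl_pr1 C I x)) (Dom C pth)"
    "cyl_pr2 C I x \<in> hom C (Dom C (cyl_pr1 C I x)) (Dom C (prj B))" by (simp_all add: hom_def)
  note t = pb_tuple[OF cyl_pr_pb[OF path_hom] hs e]
  note ci = cyl_iso_spec[OF x]
  note [simp] = homD(1-3)[OF t(1)] homD(1-3)[OF ci(1)]
  have "g \<cdot> cyl_iso x = \<epsilon> \<cdot> (tuple C p1 p2 (h \<cdot> cyl_pr1 C I x) (cyl_pr2 C I x) \<cdot> cyl_iso x)"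
    using 1[symmetric] by simp
  also have "\<dots> = \<epsilon> \<cdot> tuple C p1 p2 (h \<cdot> prj X) (cmap x)"
    using tuple_comp[OF cyl_pr_pb[OF path_hom] hs e ci(1)] ci(2,3) by simp
  also have "\<dots> = pev y \<cdot> cmap h" using tuple_pev[OF x hh] by (simp add: pev_def)
  finally show "pev y \<cdot> cmap (path_transpose C I y x g) = g \<cdot> cyl_iso x" using th by simp
  show "path_transpose C I y x g \<in> hom C X (Dom C pth)" "pth \<cdot> path_transpose C I y x g = x" using hh th by auto
qed

declare path_typing [simp del] pev_typing [simp del]

end

lemma path_map_spec:
  assumes y: "y \<in> hom C Y B" and z: "z \<in> hom C Z B" and f: "f \<in> hom C Y Z" "z \<cdot> f = y"
  shows "path_map C I y z f \<in> hom C (Dom C (path_obj C I y)) (Dom C (path_obj C I z))"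
    "path_obj C I z \<cdot> path_map C I y z f = path_obj C I y"
    "pev z \<cdot> cmap (path_map C I y z f) = f \<cdot> pev y"
proof -
  note [simp] = path_typing[OF y] path_typing[OF z] homD[OF f(1)]
  let ?\<epsilon> = "path_eval C I y" and ?p = "path_obj C I y"
  have g: "f \<cdot> ?\<epsilon> \<in> hom C (Dom C (cyl_pr1 C I ?p)) Z" by (simp add: hom_def)
  have e: "z \<cdot> (f \<cdot> ?\<epsilon>) = ?p \<cdot> cyl_pr1 C I ?p"
    using reassoc[OF f(2,1), of B ?\<epsilon>] slice_expD(5)[OF path_exp(1)[OF y]] by (simp add: hom_def)
  note T = path_transpose_spec[OF z path_hom[OF y] g e, folded path_map_def]
  show "path_map C I y z f \<in> hom C (Dom C (path_obj C I y)) (Dom C (path_obj C I z))"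
    "path_obj C I z \<cdot> path_map C I y z f = path_obj C I y"
    by (fact T)+
  show "pev z \<cdot> cmap (path_map C I y z f) = f \<cdot> pev y" unfolding T(3) pev_def[of y] by simp
qed

text \<open>The comparison is the transpose of a tuple whose first component is evaluation.
  Projecting to this component gives the third equation: evaluating a restricted path, seen in
  \<open>Y\<close>, is evaluating the original path.\<close>

lemma path_base_change_spec:
  assumes i: "i \<in> hom C D B" and y: "y \<in> hom C Y B"
  defines "p \<equiv> path_obj C I y" and "y' \<equiv> base_change C i y"
  defines "q \<equiv> path_obj C I y'"
  shows "path_base_change C I i y \<in> hom C (Dom C (base_change C i p)) (Dom C q)"
    "q \<cdot> path_base_change C I i y = base_change C i p"
    "base_change_top C i y \<cdot> (pev y' \<cdot> cmap (path_base_change C I i y)) = pev y \<cdot> cmap (base_change_top C i p)"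
    "y' \<in> hom C (Dom C y') D"
proof -
  note [simp] = path_typing[OF y, folded p_def] homD[OF i]
  have bp: "is_pullback C (base_change_top C i p) (base_change C i p) p i" by (rule base_change_pb) auto
  have yb: "is_pullback C (base_change_top C i y) y' y i" unfolding y'_def by (rule base_change_pb) auto
  note [simp] = pbD(4-8)[OF bp] pbD(4-8)[OF yb]
  let ?t = "base_change_top C i p" and ?p' = "base_change C i p"
  have p': "?p' \<in> hom C (Dom C ?t) D" by (simp add: hom_def)
  show y': "y' \<in> hom C (Dom C y') D" by (simp add: hom_def)
  note cp' = cyl_pr_pb[OF p']
  note [simp] = pbD(4-8)[OF cp']
  let ?m = "tuple C (cyl_pr1 C I p) (cyl_pr2 C I p) (?t \<cdot> cyl_pr1 C I ?p') (cmap i \<cdot> cyl_pr2 C I ?p')"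
  have me: "p \<cdot> (?t \<cdot> cyl_pr1 C I ?p') = prj B \<cdot> (cmap i \<cdot> cyl_pr2 C I ?p')"
  proof -
    have "p \<cdot> (?t \<cdot> cyl_pr1 C I ?p') = i \<cdot> (?p' \<cdot> cyl_pr1 C I ?p')"
      using reassoc2[OF pbD(9)[OF bp], of "Dom C ?t" "Dom C p" B D "cyl_pr1 C I ?p'"] by (simp add: hom_def)
    also have "\<dots> = i \<cdot> (prj D \<cdot> cyl_pr2 C I ?p')" using pbD(9)[OF cp'] by simp
    finally show ?thesis by simp
  qed
  have mh: "?t \<cdot> cyl_pr1 C I ?p' \<in> hom C (Dom C (cyl_pr1 C I ?p')) (Dom C p)"
    "cmap i \<cdot> cyl_pr2 C I ?p' \<in> hom C (Dom C (cyl_pr1 C I ?p')) (Dom C (prj B))" by (simp_all add: hom_def)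
  note cp = cyl_pr_pb[OF path_hom[OF y], folded p_def]
  note m = pb_tuple[OF cp mh me]
  note [simp] = homD(1-3)[OF m(1)]
  let ?\<epsilon> = "path_eval C I y"
  have ge: "y \<cdot> (?\<epsilon> \<cdot> ?m) = i \<cdot> (?p' \<cdot> cyl_pr1 C I ?p')"
  proof -
    have "y \<cdot> (?\<epsilon> \<cdot> ?m) = p \<cdot> (cyl_pr1 C I p \<cdot> ?m)"
      using reassoc2[OF slice_expD(5)[OF path_exp(1)[OF y]], folded p_def, of "Dom C (cyl_pr1 C I p)" Y B "Dom C p" ?m]
      by (simp add: hom_def)
    also have "\<dots> = i \<cdot> (?p' \<cdot> cyl_pr1 C I ?p')"
      using m(2) reassoc2[OF pbD(9)[OF bp], of "Dom C ?t" "Dom C p" B D "cyl_pr1 C I ?p'"] by (simp add: hom_def)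
    finally show ?thesis .
  qed
  let ?g = "tuple C (base_change_top C i y) y' (?\<epsilon> \<cdot> ?m) (?p' \<cdot> cyl_pr1 C I ?p')"
  have g: "?g \<in> hom C (Dom C (cyl_pr1 C I ?p')) (Dom C y')" "base_change_top C i y \<cdot> ?g = ?\<epsilon> \<cdot> ?m" "y' \<cdot> ?g = ?p' \<cdot> cyl_pr1 C I ?p'"
    using pb_tuple[OF yb, of "?\<epsilon> \<cdot> ?m" "Dom C (cyl_pr1 C I ?p')" "?p' \<cdot> cyl_pr1 C I ?p'"] ge by (simp_all add: hom_def)
  note T = path_transpose_spec[OF y' p' g(1,3)]
  have eq: "path_base_change C I i y = path_transpose C I y' ?p' ?g"
    by (simp add: path_base_change_def Let_def p_def y'_def)
  show "path_base_change C I i y \<in> hom C (Dom C (base_change C i p)) (Dom C q)"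
    "q \<cdot> path_base_change C I i y = base_change C i p"
    unfolding eq q_def using T(1,2) by simp_all
  note ci = cyl_iso_spec[OF p']
  note [simp] = homD(1-3)[OF ci(1)] homD(1-3)[OF g(1)]
  have "base_change_top C i y \<cdot> (pev y' \<cdot> cmap (path_base_change C I i y)) = base_change_top C i y \<cdot> (?g \<cdot> cyl_iso ?p')"
    unfolding eq T(3) ..
  also have "\<dots> = ?\<epsilon> \<cdot> (?m \<cdot> cyl_iso ?p')"
    using reassoc[OF g(2,1), of Y "cyl_iso ?p'"] by (simp add: hom_def)
  also have "?m \<cdot> cyl_iso ?p' = tuple C (cyl_pr1 C I p) (cyl_pr2 C I p) (?t \<cdot> prj (Dom C ?t)) (cmap i \<cdot> cmap ?p')"
    using tuple_comp[OF cp mh me ci(1)] ci(2,3) by simp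
  also have "cmap i \<cdot> cmap ?p' = cmap (p \<cdot> ?t)" using cmap_comp[of ?p' i] pbD(9)[OF bp] by simp
  also have "tuple C (cyl_pr1 C I p) (cyl_pr2 C I p) (?t \<cdot> prj (Dom C ?t)) (cmap (p \<cdot> ?t)) = cyl_iso p \<cdot> cmap ?t"
    using tuple_pev[OF y, folded p_def, of "p \<cdot> ?t" "Dom C ?t" ?t] by (simp add: hom_def)
  finally show "base_change_top C i y \<cdot> (pev y' \<cdot> cmap (path_base_change C I i y)) = pev y \<cdot> cmap ?t"
    unfolding pev_def[of y, folded p_def] by simp
qed

end

locale model_interval = lcc_interval C T I for C :: "('o, 'a) cat" (structure) and T I +
  fixes W Cof Fib :: "'a set" and d0 d1 :: 'a
  assumes model: "model_structure C W Cof Fib"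
    and cof_mono: "Cof = {f. is_mono C f}"
    and pushout_product: "\<And>f g h. f \<in> Cof \<Longrightarrow> g \<in> Cof \<inter> W \<Longrightarrow> is_pushout_product C f g h \<Longrightarrow> h \<in> Cof \<inter> W"
    and cylinder: "good_cylinder_of_terminal C W Cof T I d0 d1"
    and disjoint: "disjoint_points C d0 d1"
begin

subsection \<open>Model structure\<close>

lemma Fib_arr: "f \<in> Fib \<Longrightarrow> f \<in> Arr C" and Cof_arr: "f \<in> Cof \<Longrightarrow> f \<in> Arr C"
  using model by (auto simp: model_structure_def)

lemma two_of_three:
  assumes "f \<in> hom C X Y" "g \<in> hom C Y Z"
  shows "f \<in> W \<Longrightarrow> g \<in> W \<Longrightarrow> g \<cdot> f \<in> W" "f \<in> W \<Longrightarrow> g \<cdot> f \<in> W \<Longrightarrow> g \<in> W" "g \<in> W \<Longrightarrow> g \<cdot> f \<in> W \<Longrightarrow> f \<in> W"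
proof -
  have "\<forall>f \<in> Arr C. \<forall>g \<in> Arr C. Cod C f = Dom C g \<longrightarrow>
      (f \<in> W \<and> g \<in> W \<longrightarrow> g \<cdot> f \<in> W) \<and> (f \<in> W \<and> g \<cdot> f \<in> W \<longrightarrow> g \<in> W) \<and> (g \<in> W \<and> g \<cdot> f \<in> W \<longrightarrow> f \<in> W)"
    using model unfolding model_structure_def by (elim conjE) assumption
  moreover have "f \<in> Arr C" "g \<in> Arr C" "Cod C f = Dom C g" using homD[OF assms(1)] homD[OF assms(2)] by auto
  ultimately have "(f \<in> W \<and> g \<in> W \<longrightarrow> g \<cdot> f \<in> W) \<and> (f \<in> W \<and> g \<cdot> f \<in> W \<longrightarrow> g \<in> W) \<and> (g \<in> W \<and> g \<cdot> f \<in> W \<longrightarrow> f \<in> W)"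
    by blast
  then show "f \<in> W \<Longrightarrow> g \<in> W \<Longrightarrow> g \<cdot> f \<in> W" "f \<in> W \<Longrightarrow> g \<cdot> f \<in> W \<Longrightarrow> g \<in> W" "g \<in> W \<Longrightarrow> g \<cdot> f \<in> W \<Longrightarrow> f \<in> W"
    by blast+
qed

lemma retract_W:
  assumes f: "f \<in> hom C X Y" and g: "g \<in> hom C X' Y'" "g \<in> W"
    and s: "s \<in> hom C X X'" "r \<in> hom C X' X" "r \<cdot> s = Id C X"
    and s': "s' \<in> hom C Y Y'" "r' \<in> hom C Y' Y" "r' \<cdot> s' = Id C Y"
    and e: "g \<cdot> s = s' \<cdot> f" "f \<cdot> r = r' \<cdot> g"
  shows "f \<in> W"
proof -
  have "\<forall>f g. is_retract C f g \<longrightarrow>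
      (g \<in> W \<longrightarrow> f \<in> W) \<and> (g \<in> Cof \<longrightarrow> f \<in> Cof) \<and> (g \<in> Fib \<longrightarrow> f \<in> Fib)"
    using model unfolding model_structure_def by (elim conjE) assumption
  moreover have "is_retract C f g" unfolding is_retract_def
    using s s' e homD[OF f] homD[OF g(1)] by auto
  ultimately show ?thesis using g(2) by blast
qed

lemma factor_acyclic_cof_fib:
  assumes "f \<in> hom C X Y"
  obtains l r M where "l \<in> hom C X M" "r \<in> hom C M Y" "r \<cdot> l = f" "l \<in> Cof" "l \<in> W" "r \<in> Fib"
proof -
  have "\<forall>f \<in> Arr C.
      (\<exists>l \<in> Cof \<inter> W. \<exists>r \<in> Fib. Cod C l = Dom C r \<and> r \<cdot> l = f) \<and>
      (\<exists>l \<in> Cof. \<exists>r \<in> Fib \<inter> W. Cod C l = Dom C r \<and> r \<cdot> l = f)"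
    using model unfolding model_structure_def by (elim conjE) assumption
  then obtain l r where lr: "l \<in> Cof" "l \<in> W" "r \<in> Fib" "Cod C l = Dom C r" "r \<cdot> l = f" using homD[OF assms] by blast
  note [simp] = Cof_arr[OF lr(1)] Fib_arr[OF lr(3)]
  show thesis using that[of l "Dom C r" r] lr homD[OF assms] by (auto simp: hom_def)
qed

lemma factor_cof_acyclic_fib:
  assumes "f \<in> hom C X Y"
  obtains l r M where "l \<in> hom C X M" "r \<in> hom C M Y" "r \<cdot> l = f" "l \<in> Cof" "r \<in> W" "r \<in> Fib"
proof -
  have "\<forall>f \<in> Arr C.
      (\<exists>l \<in> Cof \<inter> W. \<exists>r \<in> Fib. Cod C l = Dom C r \<and> r \<cdot> l = f) \<and>
      (\<exists>l \<in> Cof. \<exists>r \<in> Fib \<inter> W. Cod C l = Dom C r \<and> r \<cdot> l = f)"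
    using model unfolding model_structure_def by (elim conjE) assumption
  then obtain l r where lr: "l \<in> Cof" "r \<in> W" "r \<in> Fib" "Cod C l = Dom C r" "r \<cdot> l = f" using homD[OF assms] by blast
  note [simp] = Cof_arr[OF lr(1)] Fib_arr[OF lr(3)]
  show thesis using that[of l "Dom C r" r] lr homD[OF assms] by (auto simp: hom_def)
qed

lemma lifting:
  assumes "l \<in> hom C A B" "r \<in> hom C X Y" "l \<in> Cof" "r \<in> Fib" "l \<in> W \<or> r \<in> W"
    and "u \<in> hom C A X" "v \<in> hom C B Y" "r \<cdot> u = v \<cdot> l"
  obtains d where "d \<in> hom C B X" "d \<cdot> l = u" "r \<cdot> d = v"
proof -
  have "\<forall>l \<in> Cof \<inter> W. \<forall>r \<in> Fib. has_lifting C l r"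
    using model unfolding model_structure_def by (elim conjE) assumption
  moreover have "\<forall>l \<in> Cof. \<forall>r \<in> Fib \<inter> W. has_lifting C l r"
    using model unfolding model_structure_def by (elim conjE) assumption
  ultimately have "has_lifting C l r" using assms(3-5) by blast
  then have "\<exists>d \<in> hom C B X. d \<cdot> l = u \<and> r \<cdot> d = v"
    using assms(6-8) homD(2,3)[OF assms(1)] homD(2,3)[OF assms(2)] unfolding has_lifting_def by auto
  then show thesis using that by blast
qed

text \<open>The retract argument: a lift of \<open>l\<close> against the fibration of its
  factorization presents \<open>l\<close> as a retract of the acyclic cofibration
  \<open>k\<close>.\<close>

lemma W_if_llp:
  assumes l: "l \<in> hom C A B"
    and lift: "\<And>r X Y u v. r \<in> Fib \<Longrightarrow> r \<in> hom C X Y \<Longrightarrow> u \<in> hom C A X \<Longrightarrow> v \<in> hom C B Y \<Longrightarrow> r \<cdot> u = v \<cdot> l \<Longrightarrow>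
      \<exists>d. d \<in> hom C B X \<and> d \<cdot> l = u \<and> r \<cdot> d = v"
  shows "l \<in> W"
proof -
  obtain k r M where k: "k \<in> hom C A M" "r \<in> hom C M B" "r \<cdot> k = l" "k \<in> Cof" "k \<in> W" "r \<in> Fib"
    using factor_acyclic_cof_fib[OF l] by blast
  note [simp] = homD[OF l] homD[OF k(1)] homD[OF k(2)]
  obtain d where d: "d \<in> hom C B M" "d \<cdot> l = k" "r \<cdot> d = Id C B"
    using lift[OF k(6,2,1), of "Id C B"] k(3) by (auto simp: hom_def)
  show ?thesis
    by (rule retract_W[OF l k(1,5), of "Id C A" "Id C A" d r]) (use d k in \<open>auto simp: hom_def\<close>)
qed

lemma W_if_rlp:
  assumes r: "r \<in> hom C X Y"
    and lift: "\<And>l A B u v. l \<in> Cof \<Longrightarrow> l \<in> hom C A B \<Longrightarrow> u \<in> hom C A X \<Longrightarrow> v \<in> hom C B Y \<Longrightarrow> r \<cdot> u = v \<cdot> l \<Longrightarrow>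
      \<exists>d. d \<in> hom C B X \<and> d \<cdot> l = u \<and> r \<cdot> d = v"
  shows "r \<in> W"
proof -
  obtain k q M where k: "k \<in> hom C X M" "q \<in> hom C M Y" "q \<cdot> k = r" "k \<in> Cof" "q \<in> W" "q \<in> Fib"
    using factor_cof_acyclic_fib[OF r] by blast
  note [simp] = homD[OF r] homD[OF k(1)] homD[OF k(2)]
  obtain d where d: "d \<in> hom C M X" "d \<cdot> k = Id C X" "r \<cdot> d = q"
    using lift[OF k(4,1) _ k(2), of "Id C X"] k(3) by (auto simp: hom_def)
  show ?thesis
    by (rule retract_W[OF r k(2,5), of k d "Id C Y" "Id C Y"]) (use d k in \<open>auto simp: hom_def\<close>)
qed

text \<open>The axioms do not list identities among the weak equivalences; an identity lifts against
  every map, so the retract argument applies.\<close>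

lemma W_id:
  assumes "X \<in> Obj C" shows "Id C X \<in> W"
proof (rule W_if_llp[of _ X X])
  fix r Z Y u v assume "r \<in> hom C Z Y" "u \<in> hom C X Z" "v \<in> hom C X Y" "r \<cdot> u = v \<cdot> Id C X"
  then show "\<exists>d. d \<in> hom C X Z \<and> d \<cdot> Id C X = u \<and> r \<cdot> d = v"
    by (intro exI[of _ u]) (auto simp: hom_def)
qed (use assms in \<open>simp add: hom_def\<close>)

text \<open>Lifting against all fibrations passes from \<open>f\<close> to its pushout, since a lift
  for \<open>f\<close> and the given map \<open>h\<close> glue.\<close>

lemma W_pushout:
  assumes po: "is_pushout C u v f g" and f: "f \<in> Cof" "f \<in> W"
  shows "v \<in> W"
proof (rule W_if_llp[of _ "Cod C g" "Cod C u"])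
  note [simp] = poD(1-8)[OF po]
  show "v \<in> hom C (Cod C g) (Cod C u)" by (simp add: hom_def)
  fix r X Y h k assume r: "r \<in> Fib" "r \<in> hom C X Y" and h: "h \<in> hom C (Cod C g) X" and k: "k \<in> hom C (Cod C u) Y"
    and e: "r \<cdot> h = k \<cdot> v"
  note [simp] = homD[OF r(2)] homD[OF h] homD[OF k]
  have f': "f \<in> hom C (Dom C f) (Cod C f)" by (simp add: hom_def)
  have "r \<cdot> (h \<cdot> g) = (k \<cdot> u) \<cdot> f"
    using reassoc[OF e h r(2), of g] poD(9)[OF po] by simp
  then obtain d where d: "d \<in> hom C (Cod C f) X" "d \<cdot> f = h \<cdot> g" "r \<cdot> d = k \<cdot> u"
    using lifting[OF f' r(2) f(1) r(1), of "h \<cdot> g" "k \<cdot> u"] f by (auto simp: hom_def)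
  note [simp] = homD[OF d(1)]
  obtain m where m: "m \<in> hom C (Cod C u) X" "m \<cdot> u = d" "m \<cdot> v = h"
    using po_map[OF po d(1) h d(2)] by blast
  note [simp] = homD[OF m(1)]
  have "r \<cdot> m = k" by (rule po_uniq[OF po, of _ Y]) (use m d e in \<open>auto simp: hom_def\<close>)
  then show "\<exists>d. d \<in> hom C (Cod C u) X \<and> d \<cdot> v = h \<and> r \<cdot> d = k" using m by blast
qed

lemma W_pullback:
  assumes pb: "is_pullback C p q f g" and f: "f \<in> Fib" "f \<in> W"
  shows "q \<in> W"
proof (rule W_if_rlp[of _ "Dom C p" "Dom C g"])
  note [simp] = pbD(1-8)[OF pb]
  show "q \<in> hom C (Dom C p) (Dom C g)" by (simp add: hom_def)
  fix l A B h k assume l: "l \<in> Cof" "l \<in> hom C A B" and h: "h \<in> hom C A (Dom C p)" and k: "k \<in> hom C B (Dom C g)"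
    and e: "q \<cdot> h = k \<cdot> l"
  note [simp] = homD[OF l(2)] homD[OF h] homD[OF k]
  have f': "f \<in> hom C (Dom C f) (Cod C f)" by (simp add: hom_def)
  have "f \<cdot> (p \<cdot> h) = (g \<cdot> k) \<cdot> l"
    using reassoc2[OF pbD(9)[OF pb], of "Dom C p" "Dom C f" "Cod C f" "Dom C g" h] e by (simp add: hom_def)
  then obtain d where d: "d \<in> hom C B (Dom C f)" "d \<cdot> l = p \<cdot> h" "f \<cdot> d = g \<cdot> k"
    using lifting[OF l(2) f' l(1) f(1), of "p \<cdot> h" "g \<cdot> k"] f by (auto simp: hom_def)
  note [simp] = homD[OF d(1)]
  obtain m where m: "m \<in> hom C B (Dom C p)" "p \<cdot> m = d" "q \<cdot> m = k"
    using pb_map[OF pb d(1) k d(3)] by blast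
  note [simp] = homD[OF m(1)]
  have "m \<cdot> l = h"
    by (rule pb_uniq[OF pb, of _ A])
      (use m(1) h d(2) e reassoc[OF m(2,1), of "Dom C f" l] reassoc[OF m(3,1), of "Dom C g" l] in \<open>auto simp: hom_def\<close>)
  then show "\<exists>d. d \<in> hom C B (Dom C p) \<and> d \<cdot> l = h \<and> q \<cdot> d = k" using m by blast
qed

text \<open>A map with a section \<open>s\<close> is a retract of the endomorphism
  \<open>s \<cdot> p\<close>.\<close>

lemma W_split:
  assumes p: "p \<in> hom C X Y" and s: "s \<in> hom C Y X" and ps: "p \<cdot> s = Id C Y" and sp: "s \<cdot> p \<in> W"
  shows "p \<in> W"
proof -
  note [simp] = homD[OF p] homD[OF s]
  have 1: "s \<cdot> p \<in> hom C X X" by (simp add: hom_def)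
  show ?thesis
    by (rule retract_W[OF p 1 sp, of "Id C X" "Id C X" s p])
      (use p s ps reassoc[OF ps s p, of p] in \<open>auto simp: hom_def\<close>)
qed

lemma po_ex:
  assumes "f \<in> hom C X Y" "g \<in> hom C X Z"
  shows "\<exists>u v. is_pushout C u v f g"
  using model homD[OF assms(1)] homD[OF assms(2)] unfolding model_structure_def finitely_cocomplete_def by auto

subsection \<open>Lifting against pushout products\<close>

lemma d_hom: "d0 \<in> hom C T I" "d1 \<in> hom C T I"
  using cylinder by (auto simp: good_cylinder_of_terminal_def)

text \<open>A point is a section of the weak equivalence from \<open>I\<close> to the terminal
  object; this makes it both a split mono and, by two out of three, a weak equivalence.\<close>

lemma d_mono_W:
  assumes d: "d \<in> hom C T I" shows "d \<in> Cof" "d \<in> W"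
proof -
  note [simp] = homD[OF d]
  have e: "bang C T I \<cdot> d = Id C T" by (rule to_T_uniq[of _ T]) (simp_all add: hom_def)
  show "d \<in> Cof" using split_mono[OF d bang_hom e] cof_mono by simp
  show "d \<in> W"
    by (rule two_of_three(3)[OF d bang_hom])
      (use e W_id[OF T_obj] cylinder in \<open>auto simp: good_cylinder_of_terminal_def\<close>)
qed

text \<open>The pushout product with a point carries a factor \<open>T\<close>; this passes from it
  to the inclusion \<open>ins d X\<close> of one end of the cylinder.\<close>

lemma point_prod:
  assumes d: "d \<in> hom C T I" and X: "X \<in> Obj C"
  shows "prod_map C (Id C X) d = ins d X \<cdot> pr1 C X T"
proof (rule prod_ext[of X I _ "prod_obj C X T"])
  note [simp] = homD[OF d] X
  have "pr2 C X I \<cdot> (ins d X \<cdot> pr1 C X T) = (d \<cdot> bang C T X) \<cdot> pr1 C X T"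
    using reassoc[OF ins_typing(5)[OF d X] ins_hom[OF d X], of I "pr1 C X T"] by (simp add: hom_def)
  moreover have "pr2 C X T = bang C T (prod_obj C X T)" by (rule to_T_uniq[of _ "prod_obj C X T"]) (simp_all add: hom_def)
  ultimately show "pr2 C X I \<cdot> prod_map C (Id C X) d = pr2 C X I \<cdot> (ins d X \<cdot> pr1 C X T)" by simp
qed (use homD[OF d] X d in \<open>simp_all add: hom_def\<close>)

text \<open>The pushout product of the mono \<open>f\<close> with the acyclic cofibration
  \<open>d\<close> is an acyclic cofibration. Lifting it against \<open>q\<close> extends a homotopy
  given on \<open>X\<close>, with its end at \<open>d\<close> already known on
  \<open>Y\<close>.\<close>

lemma endpoint_lift:
  assumes d: "d \<in> hom C T I" and f: "f \<in> hom C X Y" "is_mono C f" and q: "q \<in> hom C U V" "q \<in> Fib"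
    and g1: "g1 \<in> hom C Y U" and g2: "g2 \<in> hom C (cyl X) U" and b: "b \<in> hom C (cyl Y) V"
    and e: "g2 \<cdot> ins d X = g1 \<cdot> f" "q \<cdot> g1 = b \<cdot> ins d Y" "q \<cdot> g2 = b \<cdot> cmap f"
  obtains G where "G \<in> hom C (cyl Y) U" "G \<cdot> cmap f = g2" "G \<cdot> ins d Y = g1" "q \<cdot> G = b"
proof -
  note [simp] = homD[OF d] homD[OF f(1)] homD[OF q(1)] homD[OF g1] homD[OF g2] homD[OF b]
  note [simp] = ins_typing[OF d]
  let ?a = "prod_map C (Id C X) d" and ?b = "prod_map C f (Id C T)"
  obtain u v where po: "is_pushout C u v ?a ?b" using po_ex[of ?a "prod_obj C X T" "cyl X" ?b] by (auto simp: hom_def)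
  note [simp] = poD(4-8)[OF po]
  let ?c = "prod_map C (Id C Y) d"
  have ce: "cmap f \<cdot> ?a = ?c \<cdot> ?b"
    using prod_map_comp[of "Id C X" f d "Id C I"] prod_map_comp[of f "Id C Y" "Id C T" d] by simp
  define h where "h = cotuple C u v (cmap f) ?c"
  have h: "h \<in> hom C (Cod C u) (cyl Y)" "h \<cdot> u = cmap f" "h \<cdot> v = ?c"
    using po_cotuple[OF po, of "cmap f" "cyl Y" ?c] ce unfolding h_def by (auto simp: hom_def)
  note [simp] = homD[OF h(1)]
  have "is_pushout_product C f d h" unfolding is_pushout_product_def h_def using po by auto
  then have hW: "h \<in> Cof" "h \<in> W" using pushout_product[of f d h] d_mono_W[OF d] f cof_mono by auto
  have "g2 \<cdot> ?a = (g1 \<cdot> pr1 C Y T) \<cdot> ?b"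
    using reassoc2[OF e(1), of X "cyl X" U Y "pr1 C X T"] point_prod[OF d, of X] by (simp add: hom_def)
  then obtain t where t: "t \<in> hom C (Cod C u) U" "t \<cdot> u = g2" "t \<cdot> v = g1 \<cdot> pr1 C Y T"
    using po_map[OF po, of g2 U "g1 \<cdot> pr1 C Y T"] by (auto simp: hom_def)
  note [simp] = homD[OF t(1)]
  have "q \<cdot> t = b \<cdot> h"
  proof (rule po_uniq[OF po, of _ V])
    show "(q \<cdot> t) \<cdot> u = (b \<cdot> h) \<cdot> u" using t h e by simp
    show "(q \<cdot> t) \<cdot> v = (b \<cdot> h) \<cdot> v"
      using t h reassoc2[OF e(2), of Y U V "cyl Y" "pr1 C Y T"] point_prod[OF d, of Y] by (simp add: hom_def)
  qed (simp_all add: hom_def)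
  then obtain G where G: "G \<in> hom C (cyl Y) U" "G \<cdot> h = t" "q \<cdot> G = b"
    using lifting[OF h(1) q(1) hW(1) q(2) disjI1[OF hW(2)] t(1) b] by blast
  note [simp] = homD[OF G(1)]
  have G1: "G \<cdot> cmap f = g2" using reassoc[OF G(2) h(1) G(1), of u] h t by simp
  \<comment> \<open>\<open>?j\<close> inverts the projection from \<open>prod_obj C Y T\<close> to
    \<open>Y\<close> and thus removes the factor \<open>T\<close>.\<close>
  let ?j = "tuple C (pr1 C Y T) (pr2 C Y T) (Id C Y) (bang C T Y)"
  have "ins d Y = ?c \<cdot> ?j" using point_prod[OF d, of Y] by simp
  then have "G \<cdot> ins d Y = G \<cdot> (h \<cdot> (v \<cdot> ?j))" using reassoc[OF h(3) _ h(1), of "prod_obj C Y T" ?j] by (simp add: hom_def)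
  also have "\<dots> = t \<cdot> (v \<cdot> ?j)" using reassoc[OF G(2) h(1) G(1), of "v \<cdot> ?j"] by simp
  also have "\<dots> = g1" using reassoc[OF t(3) _ t(1), of "prod_obj C Y T" ?j] by (simp add: hom_def)
  finally show thesis using that[OF G(1) G1 _ G(3)] by blast
qed

lemma initial_ex: "\<exists>Z. is_initial C Z"
  using model by (simp add: model_structure_def finitely_cocomplete_def)

text \<open>The case of \<open>endpoint_lift\<close> with an initial subobject: all conditions on
  the cylinder over it hold by strictness, so \<open>ins d Y\<close> lifts against every
  fibration.\<close>

lemma ins_W:
  assumes d: "d \<in> hom C T I" and Y: "Y \<in> Obj C" shows "ins d Y \<in> W"
proof (rule W_if_llp[OF ins_hom[OF d Y]])
  fix q U V g b assume q: "q \<in> Fib" "q \<in> hom C U V" and g: "g \<in> hom C Y U" and b: "b \<in> hom C (cyl Y) V"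
    and e: "q \<cdot> g = b \<cdot> ins d Y"
  obtain Z where Z: "is_initial C Z" using initial_ex by blast
  obtain f where f: "f \<in> hom C Z Y" using Z Y unfolding is_initial_def by blast
  obtain k where k: "k \<in> hom C Z U" using Z homD(5)[OF g] unfolding is_initial_def by blast
  note [simp] = homD[OF f] homD[OF k] homD[OF q(2)] homD[OF g] homD[OF b] ins_typing[OF d]
  have z: "Id C Z \<in> hom C Z Z" "prj Z \<in> hom C (cyl Z) Z" by (simp_all add: hom_def)
  have "(k \<cdot> prj Z) \<cdot> ins d Z = g \<cdot> f" by (rule initial_strict[OF Z z(1), of _ U]) (simp_all add: hom_def)
  moreover have "q \<cdot> (k \<cdot> prj Z) = b \<cdot> cmap f" by (rule initial_strict[OF Z z(2), of _ V]) (simp_all add: hom_def)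
  moreover have "k \<cdot> prj Z \<in> hom C (cyl Z) U" by (simp add: hom_def)
  ultimately show "\<exists>G. G \<in> hom C (cyl Y) U \<and> G \<cdot> ins d Y = g \<and> q \<cdot> G = b"
    using endpoint_lift[OF d f initial_mono[OF Z f] q(2,1) g _ b, of "k \<cdot> prj Z"] e by blast
qed

text \<open>Both ends include into the cylinder by weak equivalences, so two out of three passes
  from one end to \<open>H\<close> and on to the other end.\<close>

lemma homotopic_W:
  assumes d: "d \<in> hom C T I" "d' \<in> hom C T I" and H: "H \<in> hom C (cyl X) Y" and X: "X \<in> Obj C" and W: "H \<cdot> ins d X \<in> W"
  shows "H \<cdot> ins d' X \<in> W"
proof -
  have "H \<in> W" by (rule two_of_three(2)[OF ins_hom[OF d(1) X] H ins_W[OF d(1) X] W])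
  then show ?thesis by (rule two_of_three(1)[OF ins_hom[OF d(2) X] H ins_W[OF d(2) X]])
qed

section \<open>Homotopies with both ends prescribed\<close>

abbreviation "point_incl D l A \<equiv> tuple C (pr1 C D A) (pr2 C D A) (l \<cdot> bang C T A) (Id C A)"

text \<open>The functor \<open>- \<times> A\<close> preserves the coproduct \<open>D = 1 + 1\<close> with injections \<open>j\<close> and \<open>k\<close>.\<close>

definition endpoint_cover :: "'o \<Rightarrow> 'a \<Rightarrow> 'a \<Rightarrow> bool" where
  "endpoint_cover D j k \<longleftrightarrow>
    (\<forall>A V. \<forall>g0 \<in> hom C A V. \<forall>g1 \<in> hom C A V.
      \<exists>!\<gamma>. \<gamma> \<in> hom C (prod_obj C D A) V \<and> \<gamma> \<cdot> point_incl D j A = g0 \<and> \<gamma> \<cdot> point_incl D k A = g1)"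

text \<open>\<open>D\<close> is the coproduct of two copies of the terminal object and
  \<open>m\<close> its inclusion into \<open>I\<close>, a mono because the cylinder is good. The
  cover property comes from stability of pushouts, applied to the projection from the product of
  \<open>D\<close> and \<open>A\<close>.\<close>

lemma endpoints:
  obtains D j k m where "j \<in> hom C T D" "k \<in> hom C T D" "m \<in> hom C D I" "is_mono C m" "m \<cdot> j = d0" "m \<cdot> k = d1"
    "endpoint_cover D j k"
proof -
  obtain j k where jk: "is_coproduct C T T j k" and mC: "cotuple C j k d0 d1 \<in> Cof"
    using cylinder by (auto simp: good_cylinder_of_terminal_def)
  define D where "D = Cod C j"
  define m where "m = cotuple C j k d0 d1"
  have j: "j \<in> hom C T D" and k: "k \<in> hom C T D" and
    up: "\<And>V u v. u \<in> hom C T V \<Longrightarrow> v \<in> hom C T V \<Longrightarrow> \<exists>!m. m \<in> hom C D V \<and> m \<cdot> j = u \<and> m \<cdot> k = v"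
    using jk unfolding is_coproduct_def D_def[symmetric] by blast+
  note [simp] = homD[OF j] homD[OF k] homD[OF d_hom(1)]
  have m: "m \<in> hom C D I" "m \<cdot> j = d0" "m \<cdot> k = d1"
    using theI'[OF up[OF d_hom]] unfolding m_def cotuple_def homD(3)[OF j] homD(3)[OF d_hom(1)] by blast+
  obtain Z where Z: "is_initial C Z" using initial_ex by blast
  then obtain z where z: "z \<in> hom C Z T" unfolding is_initial_def using T_obj by blast
  note [simp] = homD[OF z]
  have zz: "Id C Z \<in> hom C Z Z" by (simp add: hom_def)
  \<comment> \<open>The coproduct is rewritten as a pushout over an initial object, so that the
    stability lemma applies.\<close>
  have po: "is_pushout C j k z z"
  proof (rule poI[OF z z j k])
    show "j \<cdot> z = k \<cdot> z" by (rule initial_strict[OF Z zz, of _ D]) (simp_all add: hom_def)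
    fix V h l assume "h \<in> hom C T V" "l \<in> hom C T V"
    then show "\<exists>m. m \<in> hom C D V \<and> m \<cdot> j = h \<and> m \<cdot> k = l" using up by blast
  next
    fix V h l assume h: "h \<in> hom C D V" and l: "l \<in> hom C D V" and e: "h \<cdot> j = l \<cdot> j" "h \<cdot> k = l \<cdot> k"
    show "h = l" using up[of "l \<cdot> j" V "l \<cdot> k"] h l e comp_hom[OF j l] comp_hom[OF k l] by blast
  qed
  let ?in = "\<lambda>l A. tuple C (pr1 C D A) (pr2 C D A) (l \<cdot> bang C T A) (Id C A)"
  \<comment> \<open>\<open>A\<close> is the fibre of \<open>prod_obj C D A\<close> over the point
    \<open>l\<close>.\<close>
  have pb: "is_pullback C (bang C T A) (?in l A) l (pr1 C D A)" if A: "A \<in> Obj C" and l: "l \<in> hom C T D" for l A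
  proof (rule pbI[of _ T D _ "prod_obj C D A" _ A])
    note [simp] = A homD[OF l]
    fix V u v assume u: "u \<in> hom C V T" and v: "v \<in> hom C V (prod_obj C D A)" and uv: "l \<cdot> u = pr1 C D A \<cdot> v"
    note [simp] = homD[OF u] homD[OF v]
    have u': "u = bang C T V" by (rule to_T_uniq[of _ V]) (simp_all add: hom_def)
    have "?in l A \<cdot> (pr2 C D A \<cdot> v) = v"
      by (rule prod_ext[of D A _ V]) (use uv u' in \<open>simp_all add: hom_def\<close>)
    then show "\<exists>m. m \<in> hom C V A \<and> bang C T A \<cdot> m = u \<and> ?in l A \<cdot> m = v"
      using u' by (intro exI[of _ "pr2 C D A \<cdot> v"]) (simp add: hom_def)
  next
    note [simp] = A homD[OF l]
    fix V x y assume x: "x \<in> hom C V A" and y: "y \<in> hom C V A" and e: "?in l A \<cdot> x = ?in l A \<cdot> y"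
    note [simp] = homD[OF x] homD[OF y]
    have "pr2 C D A \<cdot> (?in l A \<cdot> x) = pr2 C D A \<cdot> (?in l A \<cdot> y)" using e by simp
    then show "x = y" by simp
  qed (use A homD[OF l] in \<open>simp_all add: hom_def\<close>)
  have st: "\<exists>f' g' c. is_pushout C (?in j A) (?in k A) f' g' \<and> c \<in> hom C (Dom C f') Z" if A: "A \<in> Obj C" for A
  proof -
    have "pr1 C D A \<in> hom C (prod_obj C D A) (Cod C j)" using A by (simp add: hom_def)
    from pushout_stable_ex[OF po this pb[OF A j] pb[OF A k]] show ?thesis using homD[OF z] by auto
  qed
  show thesis
  proof (rule that[OF j k m(1) _ m(2,3)])
    show "is_mono C m" using mC cof_mono by (simp add: m_def)
    show "endpoint_cover D j k" unfolding endpoint_cover_def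
    proof (intro allI ballI)
      fix A V g0 g1 assume g: "g0 \<in> hom C A V" "g1 \<in> hom C A V"
      note [simp] = homD[OF g(1)] homD[OF g(2)]
      obtain f' g' c where po': "is_pushout C (?in j A) (?in k A) f' g'" and c: "c \<in> hom C (Dom C f') Z" using st[of A] by auto
      have [simp]: "f' \<in> Arr C" "g' \<in> Arr C" "Dom C g' = Dom C f'" "Cod C f' = A" "Cod C g' = A" using poD[OF po'] by auto
      \<comment> \<open>The apex of the pulled back pushout maps to an initial object, so any two
        maps out of it agree.\<close>
      have "g0 \<cdot> f' = g1 \<cdot> g'" by (rule initial_strict[OF Z c, of _ V]) (simp_all add: hom_def)
      then obtain \<gamma> where \<gamma>: "\<gamma> \<in> hom C (prod_obj C D A) V" "\<gamma> \<cdot> ?in j A = g0" "\<gamma> \<cdot> ?in k A = g1"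
        using po_map[OF po', of g0 V g1] g by auto
      show "\<exists>!\<gamma>. \<gamma> \<in> hom C (prod_obj C D A) V \<and> \<gamma> \<cdot> ?in j A = g0 \<and> \<gamma> \<cdot> ?in k A = g1"
      proof (rule ex1I[of _ \<gamma>])
        fix \<gamma>' assume "\<gamma>' \<in> hom C (prod_obj C D A) V \<and> \<gamma>' \<cdot> ?in j A = g0 \<and> \<gamma>' \<cdot> ?in k A = g1"
        then show "\<gamma>' = \<gamma>" using po_uniq[OF po', of \<gamma>' V \<gamma>] \<gamma> by simp
      qed (use \<gamma> in blast)
    qed
  qed
qed

lemma endpoint_cover_uniq:
  assumes E: "endpoint_cover D j k" and D: "j \<in> hom C T D" "k \<in> hom C T D" and A: "A \<in> Obj C"
    and h: "h \<in> hom C (prod_obj C D A) V" "h' \<in> hom C (prod_obj C D A) V"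
    and e: "h \<cdot> point_incl D j A = h' \<cdot> point_incl D j A" "h \<cdot> point_incl D k A = h' \<cdot> point_incl D k A"
  shows "h = h'"
proof -
  note [simp] = homD[OF D(1)] homD[OF D(2)] homD[OF h(1)] homD[OF h(2)] A
  have "h \<cdot> point_incl D j A \<in> hom C A V" "h \<cdot> point_incl D k A \<in> hom C A V" by (simp_all add: hom_def)
  then have "\<exists>!\<gamma>. \<gamma> \<in> hom C (prod_obj C D A) V \<and> \<gamma> \<cdot> point_incl D j A = h \<cdot> point_incl D j A \<and>
      \<gamma> \<cdot> point_incl D k A = h \<cdot> point_incl D k A"
    using E unfolding endpoint_cover_def by blast
  then show ?thesis using h e by metis
qed

text \<open>\<open>pushout_product\<close> wants the acyclic factor second. When the merely
  cofibrant inclusion of both ends is paired with an acyclic \<open>c\<close>, the interval must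
  therefore come first, whereas cylinders carry it second.\<close>

definition swap :: "'o \<Rightarrow> 'o \<Rightarrow> 'a" where
  "swap X Y = tuple C (pr1 C Y X) (pr2 C Y X) (pr2 C X Y) (pr1 C X Y)"

lemma swap_typing [simp]:
  assumes "X \<in> Obj C" "Y \<in> Obj C"
  shows "swap X Y \<in> Arr C" "Dom C (swap X Y) = prod_obj C X Y" "Cod C (swap X Y) = prod_obj C Y X"
    "pr1 C Y X \<cdot> swap X Y = pr2 C X Y" "pr2 C Y X \<cdot> swap X Y = pr1 C X Y"
  using assms unfolding swap_def by auto

lemma swap_re [simp]:
  assumes "X \<in> Obj C" "Y \<in> Obj C" "x \<in> Arr C" "Cod C x = prod_obj C X Y"
  shows "pr1 C Y X \<cdot> (swap X Y \<cdot> x) = pr2 C X Y \<cdot> x" "pr2 C Y X \<cdot> (swap X Y \<cdot> x) = pr1 C X Y \<cdot> x"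
  using assms unfolding swap_def by auto

lemma swap_swap:
  assumes "X \<in> Obj C" "Y \<in> Obj C" shows "swap Y X \<cdot> swap X Y = Id C (prod_obj C X Y)"
  by (rule prod_ext[of X Y _ "prod_obj C X Y"]) (use assms in \<open>simp_all add: hom_def\<close>)

lemma swap_nat:
  assumes "f \<in> Arr C" "g \<in> Arr C"
  shows "swap (Cod C f) (Cod C g) \<cdot> prod_map C f g = prod_map C g f \<cdot> swap (Dom C f) (Dom C g)"
  by (rule prod_ext[of "Cod C g" "Cod C f" _ "prod_obj C (Dom C f) (Dom C g)"])
    (use assms in \<open>simp_all add: hom_def\<close>)

lemma swap_endpoint:
  assumes m: "m \<in> hom C D I" and j: "j \<in> hom C T D" and A: "A \<in> Obj C"
  shows "swap I A \<cdot> (prod_map C m (Id C A) \<cdot> tuple C (pr1 C D A) (pr2 C D A) (j \<cdot> bang C T A) (Id C A)) = ins (m \<cdot> j) A"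
    "swap A I \<cdot> ins (m \<cdot> j) A = prod_map C m (Id C A) \<cdot> tuple C (pr1 C D A) (pr2 C D A) (j \<cdot> bang C T A) (Id C A)"
proof -
  note [simp] = homD[OF m] homD[OF j] A
  have mj: "m \<cdot> j \<in> hom C T I" by (simp add: hom_def)
  note [simp] = ins_typing[OF mj]
  show "swap I A \<cdot> (prod_map C m (Id C A) \<cdot> tuple C (pr1 C D A) (pr2 C D A) (j \<cdot> bang C T A) (Id C A)) = ins (m \<cdot> j) A"
    by (rule prod_ext[of A I _ A]) (simp_all add: hom_def)
  show "swap A I \<cdot> ins (m \<cdot> j) A = prod_map C m (Id C A) \<cdot> tuple C (pr1 C D A) (pr2 C D A) (j \<cdot> bang C T A) (Id C A)"
    by (rule prod_ext[of I A _ A]) (simp_all add: hom_def)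
qed

lemma prod_map_mono:
  assumes m: "m \<in> hom C X Y" "is_mono C m" and A: "A \<in> Obj C"
  shows "is_mono C (prod_map C m (Id C A))"
  using pb_mono[OF prod_map_pullback[OF m(1) A] m(2)] .

text \<open>The inclusion of both ends is only a cofibration, so acyclicity has to be demanded of
  \<open>q\<close>; in return both ends of the lift may be prescribed.\<close>

lemma homotopy_lift_acyclic:
  assumes q: "q \<in> hom C U V" "q \<in> Fib" "q \<in> W"
    and g0: "g0 \<in> hom C A U" and g1: "g1 \<in> hom C A U" and b: "b \<in> hom C (cyl A) V"
    and e: "q \<cdot> g0 = b \<cdot> ins d0 A" "q \<cdot> g1 = b \<cdot> ins d1 A"
  obtains G where "G \<in> hom C (cyl A) U" "G \<cdot> ins d0 A = g0" "G \<cdot> ins d1 A = g1" "q \<cdot> G = b"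
proof -
  obtain D j k m where j: "j \<in> hom C T D" and k: "k \<in> hom C T D" and m: "m \<in> hom C D I" "is_mono C m" "m \<cdot> j = d0" "m \<cdot> k = d1"
    and E: "endpoint_cover D j k"
    by (rule endpoints)
  note un = endpoint_cover_uniq[OF E j k]
  note [simp] = homD[OF j] homD[OF k] homD[OF m(1)] homD[OF q(1)] homD[OF g0] homD[OF g1] homD[OF b]
  note [simp] = ins_typing[OF d_hom(1)] ins_typing[OF d_hom(2)]
  let ?in = "\<lambda>l. tuple C (pr1 C D A) (pr2 C D A) (l \<cdot> bang C T A) (Id C A)"
  let ?M = "prod_map C m (Id C A)"
  obtain \<gamma> where g: "\<gamma> \<in> hom C (prod_obj C D A) U" "\<gamma> \<cdot> ?in j = g0" "\<gamma> \<cdot> ?in k = g1" using E g0 g1 unfolding endpoint_cover_def by blast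
  note [simp] = homD[OF g(1)]
  have M: "?M \<in> hom C (prod_obj C D A) (prod_obj C I A)" by (simp add: hom_def)
  have s: "swap I A \<cdot> (?M \<cdot> ?in j) = ins d0 A" "swap I A \<cdot> (?M \<cdot> ?in k) = ins d1 A"
    "swap A I \<cdot> ins d0 A = ?M \<cdot> ?in j" "swap A I \<cdot> ins d1 A = ?M \<cdot> ?in k"
    using swap_endpoint[OF m(1) j, of A] swap_endpoint[OF m(1) k, of A] m by simp_all
  have sq: "q \<cdot> \<gamma> = (b \<cdot> swap I A) \<cdot> ?M"
    by (rule un[of A _ V]) (use g e s in \<open>simp_all add: hom_def\<close>)
  have bs: "b \<cdot> swap I A \<in> hom C (prod_obj C I A) V" by (simp add: hom_def)
  have "?M \<in> Cof" using prod_map_mono[OF m(1,2)] cof_mono by simp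
  from lifting[OF M q(1) this q(2) disjI2[OF q(3)] g(1) bs sq]
  obtain G where G: "G \<in> hom C (prod_obj C I A) U" "G \<cdot> ?M = \<gamma>" "q \<cdot> G = b \<cdot> swap I A" by blast
  note [simp] = homD[OF G(1)]
  have 0: "G \<cdot> (swap A I \<cdot> ins d0 A) = g0" unfolding s using reassoc[OF G(2) M G(1), of "?in j"] g by simp
  have 1: "G \<cdot> (swap A I \<cdot> ins d1 A) = g1" unfolding s using reassoc[OF G(2) M G(1), of "?in k"] g by simp
  have 2: "q \<cdot> (G \<cdot> swap A I) = b"
    using reassoc[OF G(3) G(1) q(1), of "swap A I"] swap_swap[of A I] by simp
  show thesis by (rule that[of "G \<cdot> swap A I"]) (use 0 1 2 in \<open>simp_all add: hom_def\<close>)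
qed

text \<open>The pushout product of the inclusion of both ends with the acyclic cofibration
  \<open>c\<close> is again acyclic. So both ends and the homotopy on \<open>A\<close> may be
  prescribed at once, and \<open>q\<close> need only be a fibration.\<close>

lemma homotopy_extension:
  assumes c: "c \<in> hom C A A'" "c \<in> Cof" "c \<in> W" and q: "q \<in> hom C U V" "q \<in> Fib"
    and g0: "g0 \<in> hom C A' U" and g1: "g1 \<in> hom C A' U" and g2: "g2 \<in> hom C (cyl A) U" and b: "b \<in> hom C (cyl A') V"
    and e: "g2 \<cdot> ins d0 A = g0 \<cdot> c" "g2 \<cdot> ins d1 A = g1 \<cdot> c"
      "q \<cdot> g0 = b \<cdot> ins d0 A'" "q \<cdot> g1 = b \<cdot> ins d1 A'" "q \<cdot> g2 = b \<cdot> cmap c"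
  obtains G where "G \<in> hom C (cyl A') U" "G \<cdot> ins d0 A' = g0" "G \<cdot> ins d1 A' = g1" "G \<cdot> cmap c = g2" "q \<cdot> G = b"
proof -
  obtain D j k m where j: "j \<in> hom C T D" and k: "k \<in> hom C T D" and m: "m \<in> hom C D I" "is_mono C m" "m \<cdot> j = d0" "m \<cdot> k = d1"
    and E: "endpoint_cover D j k"
    by (rule endpoints)
  note un = endpoint_cover_uniq[OF E j k]
  note [simp] = homD[OF j] homD[OF k] homD[OF m(1)] homD[OF q(1)] homD[OF g0] homD[OF g1] homD[OF g2] homD[OF b] homD[OF c(1)]
  note [simp] = ins_typing[OF d_hom(1)] ins_typing[OF d_hom(2)]
  let ?in = "\<lambda>A l. tuple C (pr1 C D A) (pr2 C D A) (l \<cdot> bang C T A) (Id C A)"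
  have s: "swap I A \<cdot> (prod_map C m (Id C A) \<cdot> ?in A j) = ins d0 A" "swap I A \<cdot> (prod_map C m (Id C A) \<cdot> ?in A k) = ins d1 A"
    "swap A I \<cdot> ins d0 A = prod_map C m (Id C A) \<cdot> ?in A j" "swap A I \<cdot> ins d1 A = prod_map C m (Id C A) \<cdot> ?in A k"
    if "A \<in> Obj C" for A
    using swap_endpoint[OF m(1) j that] swap_endpoint[OF m(1) k that] m by simp_all
  have inc: "prod_map C (Id C D) c \<cdot> ?in A l = ?in A' l \<cdot> c" if "l \<in> hom C T D" for l
    by (rule prod_ext[of D A' _ A]) (use homD[OF that] in \<open>simp_all add: hom_def\<close>)
  let ?a = "prod_map C (Id C D) c" and ?b = "prod_map C m (Id C A)" and ?a' = "prod_map C m (Id C A')" and ?b' = "prod_map C (Id C I) c"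
  obtain u v where po: "is_pushout C u v ?a ?b" using po_ex[of ?a "prod_obj C D A" "prod_obj C D A'" ?b] by (auto simp: hom_def)
  note [simp] = poD(4-8)[OF po]
  have ce: "?a' \<cdot> ?a = ?b' \<cdot> ?b"
    using prod_map_comp[of "Id C D" m c "Id C A'"] prod_map_comp[of m "Id C I" "Id C A" c] by simp
  define h where "h = cotuple C u v ?a' ?b'"
  have h: "h \<in> hom C (Cod C u) (prod_obj C I A')" "h \<cdot> u = ?a'" "h \<cdot> v = ?b'"
    using po_cotuple[OF po, of ?a' "prod_obj C I A'" ?b'] ce unfolding h_def by (auto simp: hom_def)
  note [simp] = homD[OF h(1)]
  have "is_pushout_product C m c h" unfolding is_pushout_product_def h_def using po by auto
  then have hW: "h \<in> Cof" "h \<in> W" using pushout_product[of m c h] c m cof_mono by auto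
  obtain \<gamma> where g: "\<gamma> \<in> hom C (prod_obj C D A') U" "\<gamma> \<cdot> ?in A' j = g0" "\<gamma> \<cdot> ?in A' k = g1" using E g0 g1 unfolding endpoint_cover_def by blast
  note [simp] = homD[OF g(1)]
  have inh: "?in A' l \<in> hom C A' (prod_obj C D A')" if "l \<in> hom C T D" for l using homD[OF that] by (simp add: hom_def)
  have "\<gamma> \<cdot> ?a = (g2 \<cdot> swap I A) \<cdot> ?b"
  proof (rule un[of A _ U])
    show "(\<gamma> \<cdot> ?a) \<cdot> ?in A j = ((g2 \<cdot> swap I A) \<cdot> ?b) \<cdot> ?in A j"
      using inc[OF j] s(1)[of A] e(1) reassoc[OF g(2) inh[OF j] g(1), of c] by simp
    show "(\<gamma> \<cdot> ?a) \<cdot> ?in A k = ((g2 \<cdot> swap I A) \<cdot> ?b) \<cdot> ?in A k"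
      using inc[OF k] s(2)[of A] e(2) reassoc[OF g(3) inh[OF k] g(1), of c] by simp
  qed (simp_all add: hom_def)
  then obtain t where t: "t \<in> hom C (Cod C u) U" "t \<cdot> u = \<gamma>" "t \<cdot> v = g2 \<cdot> swap I A"
    using po_map[OF po, of \<gamma> U "g2 \<cdot> swap I A"] by (auto simp: hom_def)
  note [simp] = homD[OF t(1)]
  have "q \<cdot> t = (b \<cdot> swap I A') \<cdot> h"
  proof (rule po_uniq[OF po, of _ V])
    have "q \<cdot> \<gamma> = (b \<cdot> swap I A') \<cdot> ?a'"
      by (rule un[of A' _ V]) (use g e s[of A'] in \<open>simp_all add: hom_def\<close>)
    then show "(q \<cdot> t) \<cdot> u = ((b \<cdot> swap I A') \<cdot> h) \<cdot> u" using t h by simp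
    have "swap I A' \<cdot> ?b' = cmap c \<cdot> swap I A" using swap_nat[of "Id C I" c] by simp
    then show "(q \<cdot> t) \<cdot> v = ((b \<cdot> swap I A') \<cdot> h) \<cdot> v"
      using t h reassoc2[OF e(5) g2 q(1) _ b, of "swap I A"] by (simp add: hom_def)
  qed (simp_all add: hom_def)
  moreover have "b \<cdot> swap I A' \<in> hom C (prod_obj C I A') V" by (simp add: hom_def)
  ultimately obtain G where G: "G \<in> hom C (prod_obj C I A') U" "G \<cdot> h = t" "q \<cdot> G = b \<cdot> swap I A'"
    using lifting[OF h(1) q(1) hW(1) q(2) disjI1[OF hW(2)] t(1)] by blast
  note [simp] = homD[OF G(1)]
  have Gu: "G \<cdot> ?a' = \<gamma>" using reassoc[OF G(2) h(1) G(1), of u] h t by simp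
  have Gv: "G \<cdot> ?b' = g2 \<cdot> swap I A" using reassoc[OF G(2) h(1) G(1), of v] h t by simp
  have M: "?a' \<in> hom C (prod_obj C D A') (prod_obj C I A')" "?b' \<in> hom C (prod_obj C I A) (prod_obj C I A')" by (simp_all add: hom_def)
  have 0: "G \<cdot> (swap A' I \<cdot> ins d0 A') = g0" using s(3)[of A'] reassoc[OF Gu M(1) G(1), of "?in A' j"] g by simp
  have 1: "G \<cdot> (swap A' I \<cdot> ins d1 A') = g1" using s(4)[of A'] reassoc[OF Gu M(1) G(1), of "?in A' k"] g by simp
  have 2: "q \<cdot> (G \<cdot> swap A' I) = b"
    using reassoc[OF G(3) G(1) q(1), of "swap A' I"] swap_swap[of A' I] by simp
  have "G \<cdot> (swap A' I \<cdot> cmap c) = G \<cdot> (?b' \<cdot> swap A I)" using swap_nat[of c "Id C I"] by simp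
  also have "\<dots> = g2" using reassoc[OF Gv M(2) G(1), of "swap A I"] swap_swap[of A I] by simp
  finally have 3: "G \<cdot> (swap A' I \<cdot> cmap c) = g2" .
  show thesis by (rule that[of "G \<cdot> swap A' I"]) (use 0 1 2 3 in \<open>simp_all add: hom_def\<close>)
qed

end

context category
begin

lemma mono_cancel:
  assumes f: "f \<in> hom C X Y" and g: "g \<in> hom C Y Z" and m: "is_mono C (g \<cdot> f)"
  shows "is_mono C f"
proof (rule monoI[OF f])
  note [simp] = homD[OF f] homD[OF g]
  fix V u v assume u: "u \<in> hom C V X" and v: "v \<in> hom C V X" and e: "f \<cdot> u = f \<cdot> v"
  show "u = v"
    by (rule monoD[OF m, of X Z _ V]) (use u v e homD[OF u] homD[OF v] in \<open>simp_all add: hom_def\<close>)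
qed

end

section \<open>Cylinders on pushouts and the free end of a mapping cylinder\<close>

context model_interval
begin

text \<open>The cylinder on \<open>u\<close> is the pullback of \<open>u\<close> along the
  projection of a cylinder, so this is an instance of stability.\<close>

lemma cyl_pushout:
  assumes po: "is_pushout C u v f g"
  shows "is_pushout C (cmap u) (cmap v) (cmap f) (cmap g)"
proof -
  note [simp] = poD(1-8)[OF po]
  have h: "u \<in> hom C (Cod C f) (Cod C u)" "v \<in> hom C (Cod C g) (Cod C u)" "u \<cdot> f \<in> hom C (Dom C f) (Cod C u)"
    by (simp_all add: hom_def)
  show ?thesis
  proof (rule pushout_stable[OF po _ pb_sym[OF cmap_pb[OF h(1)]] pb_sym[OF cmap_pb[OF h(2)]] pb_sym[OF cmap_pb[OF h(3)]]])
    show "cmap u \<cdot> cmap f = cmap (u \<cdot> f)" using cmap_comp[of f u] by simp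
    show "cmap v \<cdot> cmap g = cmap (u \<cdot> f)" using cmap_comp[of g v] poD(9)[OF po] by simp
  qed (simp_all add: hom_def)
qed

lemma ins_mono: "d \<in> hom C T I \<Longrightarrow> X \<in> Obj C \<Longrightarrow> ins d X \<in> Cof"
  using split_mono[OF ins_hom, of d X "prj X"] cof_mono by (simp add: hom_def)

text \<open>This is where disjointness of the endpoints enters.\<close>

lemma mapping_cylinder_mono:
  assumes po: "is_pushout C inl inr (ins d0 X) w" and w: "w \<in> hom C X Y"
  shows "is_mono C (inl \<cdot> ins d1 X)"
proof -
  note [simp] = homD[OF w] ins_typing[OF d_hom(1)] ins_typing[OF d_hom(2)] homD[OF d_hom(1)] homD[OF d_hom(2)]
  define M where "M = Cod C inl"
  have [simp]: "Cod C inl = M" by (simp add: M_def)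
  have [simp]: "inl \<in> Arr C" "inr \<in> Arr C" "Dom C inl = cyl X" "Dom C inr = Y" "Cod C inr = M"
    using poD[OF po] by simp_all
  have inl: "inl \<in> hom C (cyl X) M" and inr: "inr \<in> hom C Y M" by (simp_all add: hom_def)
  \<comment> \<open>A height function on the mapping cylinder: the interval coordinate on the
    cylinder, and \<open>0\<close> on the glued copy of \<open>Y\<close>.\<close>
  obtain \<theta> where th: "\<theta> \<in> hom C M I" "\<theta> \<cdot> inl = pr2 C X I" "\<theta> \<cdot> inr = d0 \<cdot> bang C T Y"
    using po_map[OF po, of "pr2 C X I" I "d0 \<cdot> bang C T Y"] by (auto simp: hom_def)
  note [simp] = homD[OF th(1)]
  show ?thesis
  proof (rule monoI[of _ X M])
    fix V g h assume g: "g \<in> hom C V X" and h: "h \<in> hom C V X" and e: "(inl \<cdot> ins d1 X) \<cdot> g = (inl \<cdot> ins d1 X) \<cdot> h"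
    note [simp] = homD[OF g] homD[OF h]
    define t where "t = inl \<cdot> (ins d1 X \<cdot> g)"
    have t: "t \<in> hom C V M" "t = inl \<cdot> (ins d1 X \<cdot> h)" using e by (simp_all add: t_def hom_def)
    note [simp] = homD[OF t(1)]
    have tM: "t \<in> hom C V (Cod C inl)" using t by simp
    obtain a1 a2 where pa: "is_pullback C a1 a2 inl t" using pb_ex[of inl t] by auto
    obtain b1 b2 where pb: "is_pullback C b1 b2 inr t" using pb_ex[of inr t] by auto
    have [simp]: "a1 \<in> Arr C" "a2 \<in> Arr C" "Dom C a2 = Dom C a1" "Cod C a1 = cyl X" "Cod C a2 = V" using pbD[OF pa] by simp_all
    have [simp]: "b1 \<in> Arr C" "b2 \<in> Arr C" "Dom C b2 = Dom C b1" "Cod C b1 = Y" "Cod C b2 = V" using pbD[OF pb] by simp_all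
    obtain f' g' where po': "is_pushout C a2 b2 f' g'" using pushout_stable_ex[OF po tM pa pb] by blast
    have [simp]: "f' \<in> Arr C" "g' \<in> Arr C" "Dom C g' = Dom C f'" "Cod C f' = Dom C a1" "Cod C g' = Dom C b1" using poD[OF po'] by simp_all
    \<comment> \<open>The part of \<open>V\<close> that \<open>t\<close> sends into \<open>Y\<close>
      has height \<open>0\<close> by its position and height \<open>1\<close> by the choice of
      \<open>t\<close>; disjointness then puts it over an initial object.\<close>
    have "d0 \<cdot> bang C T (Dom C b1) = d1 \<cdot> bang C T (Dom C b1)"
    proof -
      have "d0 \<cdot> bang C T (Dom C b1) = \<theta> \<cdot> (inr \<cdot> b1)" using reassoc[OF th(3) inr th(1), of b1] by simp
      also have "\<dots> = \<theta> \<cdot> (t \<cdot> b2)" using pbD(9)[OF pb] by simp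
      also have "\<dots> = pr2 C X I \<cdot> (ins d1 X \<cdot> (g \<cdot> b2))" using reassoc[OF th(2) inl th(1), of "ins d1 X \<cdot> (g \<cdot> b2)"] by (simp add: t_def)
      also have "\<dots> = d1 \<cdot> bang C T (Dom C b1)"
        using reassoc[OF ins_typing(5)[OF d_hom(2)] ins_hom[OF d_hom(2)], of X I "g \<cdot> b2"] by (simp add: hom_def)
      finally show ?thesis .
    qed
    moreover obtain p q where pq: "is_pullback C p q d0 d1" "is_initial C (Dom C p)" using disjoint unfolding disjoint_points_def by blast
    ultimately obtain \<zeta> where \<zeta>: "\<zeta> \<in> hom C (Dom C b1) (Dom C p)"
      using pb_map[OF pq(1), of "bang C T (Dom C b1)" "Dom C b1" "bang C T (Dom C b1)"] by (auto simp: hom_def)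
    note [simp] = homD[OF \<zeta>]
    have "Dom C a1 \<in> Obj C" by simp
    then obtain \<beta> where \<beta>: "\<beta> \<in> hom C (Dom C p) (Dom C a1)" using pq(2) unfolding is_initial_def by blast
    note [simp] = homD[OF \<beta>]
    \<comment> \<open>That part being empty, the part over the cylinder covers \<open>V\<close> by
      itself: the identity on the latter, extended by an arbitrary map on the former, gives a
      retraction \<open>m\<close> of \<open>a2\<close>.\<close>
    have "Id C (Dom C a1) \<cdot> f' = (\<beta> \<cdot> \<zeta>) \<cdot> g'"
      by (rule initial_strict[OF pq(2), of "\<zeta> \<cdot> g'" "Dom C f'" _ "Dom C a1"]) (simp_all add: hom_def)
    then obtain m where m: "m \<in> hom C V (Dom C a1)" "m \<cdot> a2 = Id C (Dom C a1)"
      using po_map[OF po', of "Id C (Dom C a1)" "Dom C a1" "\<beta> \<cdot> \<zeta>"] by (auto simp: hom_def)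
    \<comment> \<open>A lift of \<open>t\<close> to the cylinder is a section of \<open>a2\<close>,
      and the retraction forces every such section to be \<open>m\<close>. Hence \<open>g\<close>
      and \<open>h\<close> yield the same lift.\<close>
    have sec: "ins d1 X \<cdot> s = a1 \<cdot> m" if s: "s \<in> hom C V X" "t = inl \<cdot> (ins d1 X \<cdot> s)" for s
    proof -
      note [simp] = homD[OF s(1)]
      have e': "inl \<cdot> (ins d1 X \<cdot> s) = t \<cdot> Id C V" using s(2)[symmetric] by simp
      obtain \<sigma> where \<sigma>: "\<sigma> \<in> hom C V (Dom C a1)" "a1 \<cdot> \<sigma> = ins d1 X \<cdot> s" "a2 \<cdot> \<sigma> = Id C V"
        using pb_map[OF pa _ _ e', of V] by (auto simp: hom_def)
      note [simp] = homD[OF \<sigma>(1)] homD[OF m(1)]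
      have "\<sigma> = m \<cdot> (a2 \<cdot> \<sigma>)" using reassoc[OF m(2) _ m(1), of "Dom C a1" \<sigma>] by (simp add: hom_def)
      then have "\<sigma> = m" using \<sigma>(3) by simp
      then show ?thesis using \<sigma>(2) by simp
    qed
    have "prj X \<cdot> (ins d1 X \<cdot> g) = prj X \<cdot> (ins d1 X \<cdot> h)" using sec[OF g t_def] sec[OF h t(2)] by simp
    then show "g = h" using d_hom by simp
  qed (simp add: hom_def)
qed

end

text \<open>\<open>glue_data\<close> abstracts the glue construction to its universal property: \<open>X\<close> and \<open>A\<close> are the total
  spaces of \<open>E\<close> and \<open>a\<close>, and the pullback of \<open>e\<close> along \<open>i\<close> is given by \<open>te\<close> and \<open>be\<close>.\<close>

locale glue_data = model_interval C T I W Cof Fib d0 d1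
  for C :: "('o, 'a) cat" (structure) and T I W Cof Fib d0 d1 +
  fixes i e a te be w c dw :: 'a and D B Y A Y' X :: 'o
  assumes i: "i \<in> hom C D B" "is_mono C i"
    and e: "e \<in> hom C Y B" "e \<in> Fib" and a: "a \<in> hom C A D" "a \<in> Fib"
    and te: "te \<in> hom C Y' Y" and be: "be \<in> hom C Y' D" and pbe: "is_pullback C te be e i"
    and w: "w \<in> hom C X Y" and c: "c \<in> hom C A X" and pbE: "is_pullback C c a (e \<cdot> w) i"
    and dw: "dw \<in> hom C A Y'" "be \<cdot> dw = a" and wc: "w \<cdot> c = te \<cdot> dw"
    and glue_ex: "\<And>s t x u v. is_pullback C s t x i \<Longrightarrow> u \<in> hom C (Dom C x) Y \<Longrightarrow> e \<cdot> u = x \<Longrightarrow>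
      v \<in> hom C (Dom C s) A \<Longrightarrow> a \<cdot> v = t \<Longrightarrow> te \<cdot> (dw \<cdot> v) = u \<cdot> s \<Longrightarrow>
      \<exists>m. m \<in> hom C (Dom C x) X \<and> w \<cdot> m = u \<and> m \<cdot> s = c \<cdot> v"
    and glue_uniq: "\<And>s t x m n. is_pullback C s t x i \<Longrightarrow> m \<in> hom C (Dom C x) X \<Longrightarrow> (e \<cdot> w) \<cdot> m = x \<Longrightarrow>
      n \<in> hom C (Dom C x) X \<Longrightarrow> w \<cdot> m = w \<cdot> n \<Longrightarrow> m \<cdot> s = n \<cdot> s \<Longrightarrow> m = n"
begin

section \<open>Extension of the homotopy data over abstract glue data\<close>

lemmas typing [simp] = homD[OF i(1)] homD[OF e(1)] homD[OF a(1)] homD[OF te] homD[OF be] homD[OF w] homD[OF c]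
  homD[OF dw(1)] ins_typing[OF d_hom(1)] ins_typing[OF d_hom(2)] ins_prj_re[OF d_hom(1)] ins_prj_re[OF d_hom(2)]

lemma e_te: "e \<cdot> te = i \<cdot> be" "Cod C x = Y' \<Longrightarrow> x \<in> Arr C \<Longrightarrow> e \<cdot> (te \<cdot> x) = i \<cdot> (be \<cdot> x)"
  using pbD(9)[OF pbe] reassoc2[OF pbD(9)[OF pbe] te e(1) be i(1)] by auto

lemma wc_re: "Cod C x = A \<Longrightarrow> x \<in> Arr C \<Longrightarrow> w \<cdot> (c \<cdot> x) = te \<cdot> (dw \<cdot> x)"
  using reassoc2[OF wc c w dw(1) te] .

lemma dw_re: "Cod C x = A \<Longrightarrow> x \<in> Arr C \<Longrightarrow> be \<cdot> (dw \<cdot> x) = a \<cdot> x"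
  using reassoc[OF dw(2,1) be] .

lemma te_mono: "is_mono C te" and c_mono: "is_mono C c"
  using pb_mono[OF pbe i(2)] pb_mono[OF pbE i(2)] by auto

lemma cmap_ins: "d \<in> hom C T I \<Longrightarrow> f \<in> Arr C \<Longrightarrow> cmap f \<cdot> ins d (Dom C f) = ins d (Cod C f) \<cdot> f"
  using ins_nat by simp

text \<open>The end at \<open>0\<close> of the extended homotopy restricts over \<open>D\<close> to
  \<open>dw \<cdot> ds\<close>; its lift \<open>ds\<close> through \<open>dw\<close> is exactly the
  datum that a map into the glue object asks for.\<close>

lemma section_extension:
  assumes ds: "ds \<in> hom C Y' A" "a \<cdot> ds = be" and K: "K \<in> hom C (cyl Y') Y'" "be \<cdot> K = be \<cdot> prj Y'"
    "K \<cdot> ins d0 Y' = dw \<cdot> ds" "K \<cdot> ins d1 Y' = Id C Y'"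
  obtains s H where "s \<in> hom C Y X" "H \<in> hom C (cyl Y) Y" "e \<cdot> H = e \<cdot> prj Y" "H \<cdot> ins d0 Y = w \<cdot> s" "H \<cdot> ins d1 Y = Id C Y"
    "s \<cdot> te = c \<cdot> ds" "H \<cdot> cmap te = te \<cdot> K"
proof -
  note [simp] = homD[OF ds(1)] homD[OF K(1)]
  obtain H where H: "H \<in> hom C (cyl Y) Y" "H \<cdot> cmap te = te \<cdot> K" "H \<cdot> ins d1 Y = Id C Y" "e \<cdot> H = e \<cdot> prj Y"
  proof (rule endpoint_lift[OF d_hom(2) te te_mono e, of "Id C Y" "te \<cdot> K" "e \<cdot> prj Y"])
    show "e \<cdot> (te \<cdot> K) = (e \<cdot> prj Y) \<cdot> cmap te" using e_te(2)[of K] e_te(2)[of "prj Y'"] K by simp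
  qed (use K in \<open>simp_all add: hom_def\<close>)
  note [simp] = homD[OF H(1)]
  have 1: "te \<cdot> (dw \<cdot> ds) = (H \<cdot> ins d0 Y) \<cdot> te"
    using reassoc[OF H(2) _ H(1), of "cyl Y'" "ins d0 Y'"] K(3) cmap_ins[OF d_hom(1), of te] by (simp add: hom_def)
  have 2: "e \<cdot> (H \<cdot> ins d0 Y) = e" using reassoc2[OF H(4,1) e(1) _ e(1), of "ins d0 Y"] by (simp add: hom_def)
  obtain s where "s \<in> hom C Y X" "w \<cdot> s = H \<cdot> ins d0 Y" "s \<cdot> te = c \<cdot> ds"
    using glue_ex[OF pbe _ 2, of ds] ds 1 by (auto simp: hom_def)
  then show thesis using that H by metis
qed

lemma boundary_W:
  assumes dr: "dr \<in> hom C Y' A" and H: "H \<in> hom C (cyl A) A" "H \<cdot> ins d0 A = dr \<cdot> dw" "H \<cdot> ins d1 A = Id C A"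
    and ds: "ds \<in> hom C Y' A" and K: "K \<in> hom C (cyl Y') Y'" "K \<cdot> ins d0 Y' = dw \<cdot> ds" "K \<cdot> ins d1 Y' = Id C Y'"
  shows "dw \<in> W"
proof -
  note [simp] = homD[OF ds(1)] homD[OF K(1)] homD[OF dr(1)] homD[OF H(1)]
  have rw: "dr \<cdot> dw \<in> W"
    using homotopic_W[OF d_hom(2,1) H(1)] H(2,3) W_id[of A] by simp
  obtain j p A' where j: "j \<in> hom C A A'" "p \<in> hom C A' Y'" "p \<cdot> j = dw" "j \<in> Cof" "j \<in> W" "p \<in> Fib"
    using factor_acyclic_cof_fib[OF dw(1)] by blast
  note [simp] = homD[OF j(1)] homD[OF j(2)]
  have e0: "p \<cdot> (j \<cdot> ds) = K \<cdot> ins d0 Y'" using reassoc[OF j(3,1,2), of ds] K by simp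
  have Y': "Y' \<in> Obj C" by simp
  \<comment> \<open>Lift \<open>K\<close> through \<open>p\<close> starting from
    \<open>j \<cdot> ds\<close>; since \<open>K\<close> ends at the identity, the lift ends at a
    strict section of \<open>p\<close>.\<close>
  obtain L where L: "L \<in> hom C (cyl Y') A'" "L \<cdot> ins d0 Y' = j \<cdot> ds" "p \<cdot> L = K"
    using lifting[OF ins_hom[OF d_hom(1) Y'] j(2) ins_mono[OF d_hom(1) Y'] j(6) disjI1[OF ins_W[OF d_hom(1) Y']] _ K(1) e0]
    by (auto simp: hom_def)
  note [simp] = homD[OF L(1)]
  define \<sigma> where "\<sigma> = L \<cdot> ins d1 Y'"
  have \<sigma>: "\<sigma> \<in> hom C Y' A'" "p \<cdot> \<sigma> = Id C Y'" using K(3) reassoc[OF L(3,1) j(2), of "ins d1 Y'"] by (simp_all add: \<sigma>_def hom_def)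
  note [simp] = homD[OF \<sigma>(1)]
  have 1: "(j \<cdot> (dr \<cdot> p)) \<cdot> j = j \<cdot> (dr \<cdot> dw)" using j(3) by simp
  have 2: "j \<cdot> (dr \<cdot> dw) \<in> W" by (rule two_of_three(1)[OF _ j(1) rw j(5), of A]) (simp add: hom_def)
  have rp: "j \<cdot> (dr \<cdot> p) \<in> W"
    using two_of_three(2)[OF j(1) _ j(5), of "j \<cdot> (dr \<cdot> p)" A'] 2 unfolding 1 by (simp add: hom_def)
  \<comment> \<open>The weak equivalence \<open>j \<cdot> (dr \<cdot> p)\<close> absorbs
    \<open>\<sigma> \<cdot> p\<close> on its right because \<open>p \<cdot> \<sigma>\<close> is an
    identity.\<close>
  have "\<sigma> \<cdot> p \<in> W"
    by (rule two_of_three(3)[OF _ _ rp, of _ A' A' A'])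
      (use rp reassoc[OF \<sigma>(2,1) j(2), of p] in \<open>simp_all add: hom_def\<close>)
  then have "p \<in> W" by (rule W_split[OF j(2) \<sigma>])
  then show ?thesis using two_of_three(1)[OF j(1,2,5)] j(3) by simp
qed

lemma unglue_W:
  assumes dwW: "dw \<in> W" shows "w \<in> W"
proof -
  obtain k q F where k: "k \<in> hom C X F" "q \<in> hom C F Y" "q \<cdot> k = w" "k \<in> Cof" "q \<in> W" "q \<in> Fib"
    using factor_cof_acyclic_fib[OF w] by blast
  note [simp] = homD[OF k(1)] homD[OF k(2)]
  have kmono: "is_mono C k" using k cof_mono by simp
  note qk = reassoc[OF k(3,1,2)]
  \<comment> \<open>The restriction of \<open>F\<close> along \<open>i\<close> is formed as a
    pullback of \<open>q\<close> along \<open>te\<close>, so that \<open>p\<close> is visibly a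
    pullback of an acyclic fibration; pasting gives the square over \<open>i\<close>.\<close>
  obtain f' p where pq: "is_pullback C f' p q te" using pb_ex[of q te] by auto
  define A' where "A' = Dom C f'"
  have f': "f' \<in> hom C A' F" and p: "p \<in> hom C A' Y'" using pbD[OF pq] by (simp_all add: hom_def A'_def)
  note [simp] = homD[OF f'] homD[OF p]
  have qf: "q \<cdot> f' = te \<cdot> p" using pbD(9)[OF pq] .
  note qf' = reassoc2[OF qf f' k(2) p te]
  have pbF: "is_pullback C (be \<cdot> p) f' i (e \<cdot> q)" by (rule pb_paste[OF pb_sym[OF pbe] pb_sym[OF pq]])
  have pW: "p \<in> W" by (rule W_pullback[OF pq k(6,5)])
  have "q \<cdot> (k \<cdot> c) = te \<cdot> dw" using qk[of c] wc by simp
  then obtain j where j: "j \<in> hom C A A'" "f' \<cdot> j = k \<cdot> c" "p \<cdot> j = dw"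
    using pb_map[OF pq, of "k \<cdot> c" A dw] by (auto simp: hom_def)
  note [simp] = homD[OF j(1)]
  note fj = reassoc2[OF j(2,1) f' c k(1)] and pj = reassoc[OF j(3,1) p]
  have jW: "j \<in> W" using two_of_three(3)[OF j(1) p pW] j(3) dwW by simp
  have "is_mono C (f' \<cdot> j)" unfolding j(2) by (rule mono_comp[OF c_mono kmono c k(1)])
  then have jC: "j \<in> Cof" using mono_cancel[OF j(1) f'] cof_mono by simp
  \<comment> \<open>\<open>A\<close> is the intersection of \<open>A'\<close> and \<open>X\<close>
    inside \<open>F\<close>, so the pushout \<open>P\<close> below is their union.\<close>
  have pbj: "is_pullback C j c f' k"
  proof (rule pb_cancel[OF pbF])
    show "is_pullback C a c i ((e \<cdot> q) \<cdot> k)" using pb_sym[OF pbE] k(3) by simp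
    show "(be \<cdot> p) \<cdot> j = a" using j(3) dw(2) by simp
  qed (use j in \<open>simp_all add: hom_def\<close>)
  obtain u v where po: "is_pushout C u v j c" using po_ex[OF j(1) c] by blast
  define P where "P = Cod C u"
  have u: "u \<in> hom C A' P" and v: "v \<in> hom C X P" using poD[OF po] by (simp_all add: hom_def P_def)
  note [simp] = homD[OF u] homD[OF v]
  obtain n where n: "n \<in> hom C P F" "n \<cdot> u = f'" "n \<cdot> v = k"
    using po_map[OF po, of f' F k] j(2) by (auto simp: hom_def)
  note [simp] = homD[OF n(1)]
  have nmono: "is_mono C n"
    using union_mono[OF po, of n F] pbj n kmono pb_mono[OF pq te_mono] by simp
  have ap: "a \<cdot> Id C A = (be \<cdot> p) \<cdot> j" using j(3) dw(2) by simp
  have IdA: "Id C A \<in> hom C A A" and bp: "be \<cdot> p \<in> hom C A' D" by (simp_all add: hom_def)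
  obtain \<rho> where \<rho>: "\<rho> \<in> hom C A' A" "\<rho> \<cdot> j = Id C A" "a \<cdot> \<rho> = be \<cdot> p"
    by (rule lifting[OF j(1) a(1) jC a(2) disjI1[OF jW] IdA bp ap])
  note [simp] = homD[OF \<rho>(1)]
  \<comment> \<open>The deformation of \<open>A'\<close> is built only after projecting to
    \<open>Y\<close>, where \<open>e\<close> provides lifting. It runs from
    \<open>dw \<cdot> \<rho>\<close> to \<open>p\<close>, both seen in \<open>Y\<close>, and is
    stationary on \<open>A\<close>.\<close>
  obtain g where g: "g \<in> hom C (cyl A') Y" "g \<cdot> ins d0 A' = te \<cdot> (dw \<cdot> \<rho>)" "g \<cdot> ins d1 A' = te \<cdot> p"
    "g \<cdot> cmap j = te \<cdot> (dw \<cdot> prj A)" "e \<cdot> g = (e \<cdot> (te \<cdot> p)) \<cdot> prj A'"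
  proof (rule homotopy_extension[OF j(1) jC jW e, of "te \<cdot> (dw \<cdot> \<rho>)" "te \<cdot> p" "te \<cdot> (dw \<cdot> prj A)" "(e \<cdot> (te \<cdot> p)) \<cdot> prj A'"])
    show "(te \<cdot> (dw \<cdot> prj A)) \<cdot> ins d0 A = (te \<cdot> (dw \<cdot> \<rho>)) \<cdot> j" using \<rho>(2) by simp
    show "(te \<cdot> (dw \<cdot> prj A)) \<cdot> ins d1 A = (te \<cdot> p) \<cdot> j" using j(3) by simp
    show "e \<cdot> (te \<cdot> (dw \<cdot> \<rho>)) = ((e \<cdot> (te \<cdot> p)) \<cdot> prj A') \<cdot> ins d0 A'"
      using \<rho>(3) by (simp add: e_te dw_re)
    show "e \<cdot> (te \<cdot> (dw \<cdot> prj A)) = ((e \<cdot> (te \<cdot> p)) \<cdot> prj A') \<cdot> cmap j"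
      using pj[of "prj A"] by simp
  qed (simp_all add: hom_def)
  note [simp] = homD[OF g(1)]
  note cpo = cyl_pushout[OF po]
  \<comment> \<open>On the union take \<open>g\<close> over \<open>D\<close> and the stationary
    homotopy of \<open>w\<close> on \<open>X\<close>; they agree on the cylinder over
    \<open>A\<close>.\<close>
  have "g \<cdot> cmap j = (w \<cdot> prj X) \<cdot> cmap c" using g(4) wc_re[of "prj A"] by simp
  then obtain \<gamma> where \<gamma>: "\<gamma> \<in> hom C (cyl P) Y" "\<gamma> \<cdot> cmap u = g" "\<gamma> \<cdot> cmap v = w \<cdot> prj X"
    using po_map[OF cpo, of g Y "w \<cdot> prj X"] by (auto simp: hom_def)
  note [simp] = homD[OF \<gamma>(1)]
  have cu: "cmap u \<in> hom C (cyl A') (cyl P)" and cv: "cmap v \<in> hom C (cyl X) (cyl P)" by (simp_all add: hom_def)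
  note \<gamma>u = reassoc[OF \<gamma>(2) cu \<gamma>(1)] and \<gamma>v = reassoc2[OF \<gamma>(3) cv \<gamma>(1) _ w]
  \<comment> \<open>Extension from the union to all of \<open>F\<close>, starting at the end
    \<open>1\<close>, where the value is required to be \<open>q\<close>.\<close>
  obtain G where G: "G \<in> hom C (cyl F) Y" "G \<cdot> cmap n = \<gamma>" "G \<cdot> ins d1 F = q" "e \<cdot> G = (e \<cdot> q) \<cdot> prj F"
  proof (rule endpoint_lift[OF d_hom(2) n(1) nmono e k(2) \<gamma>(1), of "(e \<cdot> q) \<cdot> prj F"])
    show "\<gamma> \<cdot> ins d1 P = q \<cdot> n"
    proof (rule po_uniq[OF po, of _ Y])
      have "(\<gamma> \<cdot> ins d1 P) \<cdot> u = g \<cdot> ins d1 A'" using \<gamma>u[of "ins d1 A'"] cmap_ins[OF d_hom(2), of u] by simp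
      then show "(\<gamma> \<cdot> ins d1 P) \<cdot> u = (q \<cdot> n) \<cdot> u" using n qf g by simp
      have "(\<gamma> \<cdot> ins d1 P) \<cdot> v = w" using \<gamma>v[of "ins d1 X"] cmap_ins[OF d_hom(2), of v] by (simp add: hom_def)
      then show "(\<gamma> \<cdot> ins d1 P) \<cdot> v = (q \<cdot> n) \<cdot> v" using n k by simp
    qed (simp_all add: hom_def)
    show "e \<cdot> \<gamma> = ((e \<cdot> q) \<cdot> prj F) \<cdot> cmap n"
    proof (rule po_uniq[OF cpo, of _ B])
      have nu: "n \<cdot> (u \<cdot> prj A') = f' \<cdot> prj A'" "n \<cdot> (v \<cdot> prj X) = k \<cdot> prj X"
        using reassoc[OF n(2) u n(1), of "prj A'"] reassoc[OF n(3) v n(1), of "prj X"] by simp_all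
      show "(e \<cdot> \<gamma>) \<cdot> cmap u = (((e \<cdot> q) \<cdot> prj F) \<cdot> cmap n) \<cdot> cmap u"
        using \<gamma>(2) g(5) nu qf'[of "prj A'"] by simp
      show "(e \<cdot> \<gamma>) \<cdot> cmap v = (((e \<cdot> q) \<cdot> prj F) \<cdot> cmap n) \<cdot> cmap v"
        using \<gamma>(3) nu qk[of "prj X"] by simp
    qed (simp_all add: hom_def)
  qed (simp_all add: hom_def)
  note [simp] = homD[OF G(1)]
  have cn: "cmap n \<in> hom C (cyl P) (cyl F)" by (simp add: hom_def)
  have Gf: "G \<cdot> cmap f' = g" using reassoc[OF G(2) cn G(1), of "cmap u"] \<gamma>(2) cmap_comp[of u n] n(2) by simp
  have Gk: "G \<cdot> cmap k = w \<cdot> prj X" using reassoc[OF G(2) cn G(1), of "cmap v"] \<gamma>(3) cmap_comp[of v n] n(3) by simp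
  have cf: "cmap f' \<in> hom C (cyl A') (cyl F)" and ck: "cmap k \<in> hom C (cyl X) (cyl F)" by (simp_all add: hom_def)
  have G0f: "G \<cdot> (ins d0 F \<cdot> f') = te \<cdot> (dw \<cdot> \<rho>)"
    using reassoc[OF Gf cf G(1), of "ins d0 A'"] g(2) cmap_ins[OF d_hom(1), of f'] by simp
  have G0k: "G \<cdot> (ins d0 F \<cdot> k) = w"
    using reassoc2[OF Gk ck G(1) _ w, of "ins d0 X"] cmap_ins[OF d_hom(1), of k] by (simp add: hom_def)
  have prjF: "prj F \<in> hom C (cyl F) F" "e \<cdot> q \<in> hom C F B" by (simp_all add: hom_def)
  have eG: "e \<cdot> (G \<cdot> ins d0 F) = e \<cdot> q"
    using reassoc2[OF G(4,1) e(1) prjF, of "ins d0 F"] by simp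
  \<comment> \<open>The end of \<open>G\<close> at \<open>0\<close> restricts over \<open>D\<close>
    to \<open>dw \<cdot> \<rho>\<close>; with \<open>\<rho>\<close> as lift it becomes a map into
    the glue object.\<close>
  obtain \<rho>' where \<rho>': "\<rho>' \<in> hom C F X" "w \<cdot> \<rho>' = G \<cdot> ins d0 F" "\<rho>' \<cdot> f' = c \<cdot> \<rho>"
    using glue_ex[OF pb_sym[OF pbF] _ eG, of \<rho>] \<rho> G0f by (auto simp: hom_def)
  note [simp] = homD[OF \<rho>'(1)]
  note w\<rho> = reassoc2[OF \<rho>'(2,1) w _ G(1)]
  have \<rho>k: "\<rho>' \<cdot> k = Id C X"
  proof (rule glue_uniq[OF pbE])
    have 1: "w \<cdot> (\<rho>' \<cdot> k) = w" using w\<rho>[of k] G0k by (simp add: hom_def)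
    then show "w \<cdot> (\<rho>' \<cdot> k) = w \<cdot> Id C X" by simp
    show "(e \<cdot> w) \<cdot> (\<rho>' \<cdot> k) = e \<cdot> w" using 1 by simp
    have "\<rho>' \<cdot> (f' \<cdot> j) = c \<cdot> (\<rho> \<cdot> j)" using reassoc2[OF \<rho>'(3) f' \<rho>'(1) \<rho>(1) c, of j] by simp
    then show "(\<rho>' \<cdot> k) \<cdot> c = Id C X \<cdot> c" using j(2) \<rho>(2) by simp
  qed (simp_all add: hom_def)
  have IdF: "Id C F \<in> hom C F F" and kr: "k \<cdot> \<rho>' \<in> hom C F F" by (simp_all add: hom_def)
  have qkr: "q \<cdot> (k \<cdot> \<rho>') = G \<cdot> ins d0 F" using qk[of \<rho>'] \<rho>'(2) by simp
  have qI: "q \<cdot> Id C F = G \<cdot> ins d1 F" using G(3) by simp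
  \<comment> \<open>\<open>G\<close> only connects \<open>q \<cdot> (k \<cdot> \<rho>')\<close> with
    \<open>q\<close>. Lifting it along the acyclic fibration \<open>q\<close>, with both ends fixed,
    connects \<open>k \<cdot> \<rho>'\<close> with the identity.\<close>
  obtain L where L: "L \<in> hom C (cyl F) F" "L \<cdot> ins d0 F = k \<cdot> \<rho>'" "L \<cdot> ins d1 F = Id C F"
    by (rule homotopy_lift_acyclic[OF k(2,6,5) kr IdF G(1) qkr qI])
  have "k \<cdot> \<rho>' \<in> W" using homotopic_W[OF d_hom(2,1) L(1)] L(2,3) W_id[of F] by simp
  then have "\<rho>' \<in> W" by (rule W_split[OF \<rho>'(1) k(1) \<rho>k])
  then have "k \<in> W" using two_of_three(3)[OF k(1) \<rho>'(1)] \<rho>k W_id[of X] by simp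
  then show ?thesis using two_of_three(1)[OF k(1,2)] k(3,5) by simp
qed

lemma retraction_extension:
  assumes wW: "w \<in> W" and dwW: "dw \<in> W"
    and dr: "dr \<in> hom C Y' A" "a \<cdot> dr = be" and H: "H \<in> hom C (cyl A) A" "a \<cdot> H = a \<cdot> prj A"
    "H \<cdot> ins d0 A = dr \<cdot> dw" "H \<cdot> ins d1 A = Id C A"
  obtains r K where "r \<in> hom C Y X" "K \<in> hom C (cyl X) X" "e \<cdot> (w \<cdot> r) = e"
    "e \<cdot> (w \<cdot> K) = e \<cdot> (w \<cdot> prj X)" "K \<cdot> ins d0 X = r \<cdot> w" "K \<cdot> ins d1 X = Id C X"
    "r \<cdot> te = c \<cdot> dr" "K \<cdot> cmap c = c \<cdot> H"
proof -
  note [simp] = homD[OF dr(1)] homD[OF H(1)]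
  have XO: "X \<in> Obj C" and AO: "A \<in> Obj C" by simp_all
  \<comment> \<open>The mapping cylinder of \<open>w\<close>: the end \<open>0\<close> is attached
    to \<open>Y\<close> and the end \<open>1\<close> stays free. One map out of it encodes the
    retraction and its homotopy together.\<close>
  obtain inl inr where po: "is_pushout C inl inr (ins d0 X) w" using po_ex[OF ins_hom[OF d_hom(1) XO] w] by blast
  define M where "M = Cod C inl"
  have inl: "inl \<in> hom C (cyl X) M" and inr: "inr \<in> hom C Y M" using poD[OF po] by (simp_all add: hom_def M_def)
  note [simp] = homD[OF inl] homD[OF inr]
  have ii: "inl \<cdot> ins d0 X = inr \<cdot> w" using poD(9)[OF po] .
  note ii' = reassoc2[OF ii ins_hom[OF d_hom(1) XO] inl w inr]
  obtain \<pi> where \<pi>: "\<pi> \<in> hom C M B" "\<pi> \<cdot> inl = (e \<cdot> w) \<cdot> prj X" "\<pi> \<cdot> inr = e"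
    using po_map[OF po, of "(e \<cdot> w) \<cdot> prj X" B e] by (auto simp: hom_def)
  note [simp] = homD[OF \<pi>(1)]
  have prjX: "prj X \<in> hom C (cyl X) X" "e \<cdot> w \<in> hom C X B" by (simp_all add: hom_def)
  note \<pi>l = reassoc2[OF \<pi>(2) inl \<pi>(1) prjX]
  obtain \<mu> \<mu>' where pbM: "is_pullback C \<mu> \<mu>' \<pi> i" using pb_ex[of \<pi> i] by auto
  define M' where "M' = Dom C \<mu>"
  have \<mu>: "\<mu> \<in> hom C M' M" and \<mu>': "\<mu>' \<in> hom C M' D" using pbD[OF pbM] by (simp_all add: hom_def M'_def)
  note [simp] = homD[OF \<mu>] homD[OF \<mu>']
  have pbc: "is_pullback C (a \<cdot> prj A) (cmap c) i ((e \<cdot> w) \<cdot> prj X)"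
    by (rule pb_paste[OF pb_sym[OF pbE] pb_sym[OF cmap_pb[OF c]]])
  have "\<pi> \<cdot> (inl \<cdot> cmap c) = i \<cdot> (a \<cdot> prj A)" using \<pi>l[of "cmap c"] pbD(9)[OF pbc] by simp
  then obtain inl' where inl': "inl' \<in> hom C (cyl A) M'" "\<mu> \<cdot> inl' = inl \<cdot> cmap c" "\<mu>' \<cdot> inl' = a \<cdot> prj A"
    using pb_map[OF pbM, of "inl \<cdot> cmap c" "cyl A" "a \<cdot> prj A"] by (auto simp: hom_def)
  note [simp] = homD[OF inl'(1)]
  have "\<pi> \<cdot> (inr \<cdot> te) = i \<cdot> be" using reassoc[OF \<pi>(3) inr \<pi>(1), of te] e_te(1) by simp
  then obtain inr' where inr': "inr' \<in> hom C Y' M'" "\<mu> \<cdot> inr' = inr \<cdot> te" "\<mu>' \<cdot> inr' = be"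
    using pb_map[OF pbM, of "inr \<cdot> te" Y' be] by (auto simp: hom_def)
  note [simp] = homD[OF inr'(1)]
  have cc: "cmap c \<in> hom C (cyl A) (cyl X)" and pA: "prj A \<in> hom C (cyl A) A" by (simp_all add: hom_def)
  note \<mu>l = reassoc2[OF inl'(2,1) \<mu> cc inl] and \<mu>r = reassoc2[OF inr'(2,1) \<mu> te inr]
    and \<mu>l' = reassoc2[OF inl'(3,1) \<mu>' pA a(1)] and \<mu>r' = reassoc[OF inr'(3,1) \<mu>']
  have pl: "is_pullback C (cmap c) inl' inl \<mu>"
    by (rule pb_sym[OF pb_cancel[OF pb_sym[OF pbM]]]) (use pbc \<pi>(2) inl inl' in \<open>simp_all\<close>)
  have pr: "is_pullback C te inr' inr \<mu>"
    by (rule pb_sym[OF pb_cancel[OF pb_sym[OF pbM]]]) (use pb_sym[OF pbe] \<pi>(3) inr inr' in \<open>simp_all\<close>)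
  have pin: "is_pullback C c (inl' \<cdot> ins d A) (inl \<cdot> ins d X) \<mu>" if d: "d \<in> hom C T I" for d
  proof (rule pb_sym[OF pb_cancel[OF pb_sym[OF pbM]]])
    note [simp] = ins_typing[OF d] ins_prj_re[OF d]
    show "is_pullback C a c i (\<pi> \<cdot> (inl \<cdot> ins d X))" using pb_sym[OF pbE] \<pi>l[of "ins d X"] by simp
    show "inl \<cdot> ins d X \<in> hom C X (Dom C \<pi>)" by (simp add: hom_def)
    show "inl' \<cdot> ins d A \<in> hom C (Dom C a) (Dom C \<mu>')" by (simp add: hom_def)
    show "\<mu>' \<cdot> (inl' \<cdot> ins d A) = a" using \<mu>l'[of "ins d A"] by simp
    show "\<mu> \<cdot> (inl' \<cdot> ins d A) = (inl \<cdot> ins d X) \<cdot> c" using \<mu>l[of "ins d A"] cmap_ins[OF d, of c] by simp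
  qed
  \<comment> \<open>By stability of pushouts, the restriction of the mapping cylinder of
    \<open>w\<close> is the mapping cylinder of \<open>dw\<close>.\<close>
  have po': "is_pushout C inl' inr' (ins d0 A) dw"
  proof (rule pushout_stable[OF po _ pl pr pin[OF d_hom(1)]])
    show "inr' \<cdot> dw = inl' \<cdot> ins d0 A"
    proof (rule pb_uniq[OF pbM, of _ A])
      show "\<mu> \<cdot> (inr' \<cdot> dw) = \<mu> \<cdot> (inl' \<cdot> ins d0 A)"
        using \<mu>r[of dw] \<mu>l[of "ins d0 A"] cmap_ins[OF d_hom(1), of c] ii'[of c] wc by simp
      show "\<mu>' \<cdot> (inr' \<cdot> dw) = \<mu>' \<cdot> (inl' \<cdot> ins d0 A)"
        using \<mu>r'[of dw] \<mu>l'[of "ins d0 A"] dw by simp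
    qed (simp_all add: hom_def)
    show "cmap c \<cdot> ins d0 A = ins d0 X \<cdot> c" using cmap_ins[OF d_hom(1), of c] by simp
  qed (use wc in \<open>simp_all add: hom_def\<close>)
  \<comment> \<open>The attached copy of the target includes by a pushout of the acyclic cofibration
    \<open>ins d0 Z\<close>, so the end \<open>0\<close> is a weak equivalence if \<open>f\<close>
    is; the cylinder passes this on to the free end.\<close>
  have cylW: "il \<cdot> ins d1 Z \<in> W" if P: "is_pushout C il ir (ins d0 Z) f" and f: "f \<in> hom C Z Z'" "f \<in> W" for il ir f Z Z'
  proof -
    have Z: "Z \<in> Obj C" using homD[OF f(1)] by simp
    have il: "il \<in> hom C (cyl Z) (Cod C il)" and ir: "ir \<in> hom C Z' (Cod C il)"
      using poD[OF P] homD[OF f(1)] by (simp_all add: hom_def)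
    have "ir \<in> W" by (rule W_pushout[OF P ins_mono[OF d_hom(1) Z] ins_W[OF d_hom(1) Z]])
    then have "il \<cdot> ins d0 Z \<in> W" using two_of_three(1)[OF f(1) ir f(2)] poD(9)[OF P] by simp
    then show ?thesis by (rule homotopic_W[OF d_hom(1,2) il Z])
  qed
  define \<iota> where "\<iota> = inl \<cdot> ins d1 X"
  define \<iota>' where "\<iota>' = inl' \<cdot> ins d1 A"
  have \<iota>: "\<iota> \<in> hom C X M" and \<iota>': "\<iota>' \<in> hom C A M'" by (simp_all add: \<iota>_def \<iota>'_def hom_def)
  have \<iota>W: "\<iota> \<in> W" and \<iota>'W: "\<iota>' \<in> W" unfolding \<iota>_def \<iota>'_def by (rule cylW[OF po w wW], rule cylW[OF po' dw(1) dwW])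
  have \<iota>m: "is_mono C \<iota>" unfolding \<iota>_def by (rule mapping_cylinder_mono[OF po w])
  have p\<iota>: "is_pullback C c \<iota>' \<iota> \<mu>" unfolding \<iota>_def \<iota>'_def by (rule pin[OF d_hom(2)])
  have \<iota>'m: "\<iota>' \<in> Cof" using pb_mono[OF pb_sym[OF p\<iota>] \<iota>m] cof_mono by simp
  note [simp] = homD[OF \<iota>] homD[OF \<iota>']
  have \<mu>\<iota>: "\<mu> \<cdot> \<iota>' = \<iota> \<cdot> c" using pbD(9)[OF p\<iota>] by simp
  obtain n1 n2 where pn: "is_pushout C n1 n2 \<iota>' c" using po_ex[OF \<iota>' c] by blast
  define N where "N = Cod C n1"
  have n1: "n1 \<in> hom C M' N" and n2: "n2 \<in> hom C X N" using poD[OF pn] by (simp_all add: hom_def N_def)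
  note [simp] = homD[OF n1] homD[OF n2]
  obtain n where n: "n \<in> hom C N M" "n \<cdot> n1 = \<mu>" "n \<cdot> n2 = \<iota>"
    using po_map[OF pn, of \<mu> M \<iota>] \<mu>\<iota> by (auto simp: hom_def)
  note [simp] = homD[OF n(1)]
  \<comment> \<open>\<open>N\<close> is the union inside \<open>M\<close> of the restriction
    \<open>M'\<close> and the free end \<open>X\<close>, glued along their intersection
    \<open>A\<close>.\<close>
  have nC: "n \<in> Cof"
    using union_mono[OF pn, of n M] pb_sym[OF p\<iota>] n pb_mono[OF pbM i(2)] \<iota>m cof_mono by simp
  \<comment> \<open>\<open>n2\<close> is a pushout of the acyclic cofibration
    \<open>\<iota>'\<close>, and \<open>n \<cdot> n2\<close> is the weak equivalence
    \<open>\<iota>\<close>.\<close>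
  have nW: "n \<in> W" using two_of_three(2)[OF n2 n(1) W_pushout[OF pn \<iota>'m \<iota>'W]] n(3) \<iota>W by simp
  \<comment> \<open>Over \<open>D\<close> the map is dictated by the given \<open>H\<close> and
    \<open>dr\<close>, pushed into \<open>Y\<close> by \<open>dw\<close>.\<close>
  have "(te \<cdot> (dw \<cdot> H)) \<cdot> ins d0 A = (te \<cdot> (dw \<cdot> dr)) \<cdot> dw" using H(3) by simp
  then obtain \<phi> where \<phi>: "\<phi> \<in> hom C M' Y" "\<phi> \<cdot> inl' = te \<cdot> (dw \<cdot> H)" "\<phi> \<cdot> inr' = te \<cdot> (dw \<cdot> dr)"
    using po_map[OF po', of "te \<cdot> (dw \<cdot> H)" Y "te \<cdot> (dw \<cdot> dr)"] by (auto simp: hom_def)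
  note [simp] = homD[OF \<phi>(1)]
  \<comment> \<open>On the free end the value must be \<open>w\<close>; since \<open>H\<close> ends
    at the identity, this agrees with \<open>\<phi>\<close> on \<open>A\<close>.\<close>
  have "\<phi> \<cdot> \<iota>' = w \<cdot> c"
    unfolding \<iota>'_def wc using reassoc[OF \<phi>(2) inl'(1) \<phi>(1), of "ins d1 A"] H(4) by simp
  then obtain \<psi> where \<psi>: "\<psi> \<in> hom C N Y" "\<psi> \<cdot> n1 = \<phi>" "\<psi> \<cdot> n2 = w"
    using po_map[OF pn, of \<phi> Y w] by (auto simp: hom_def)
  note [simp] = homD[OF \<psi>(1)]
  have e\<phi>: "e \<cdot> \<phi> = \<pi> \<cdot> \<mu>"
  proof (rule po_uniq[OF po', of _ B])
    have "\<pi> \<cdot> \<mu> = i \<cdot> \<mu>'" using pbD(9)[OF pbM] .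
    note \<pi>\<mu> = reassoc2[OF this \<mu> \<pi>(1) \<mu>' i(1)]
    show "(e \<cdot> \<phi>) \<cdot> inl' = (\<pi> \<cdot> \<mu>) \<cdot> inl'" using \<phi>(2) \<pi>\<mu>[of inl'] inl'(3) H(2) by (simp add: e_te dw_re)
    show "(e \<cdot> \<phi>) \<cdot> inr' = (\<pi> \<cdot> \<mu>) \<cdot> inr'" using \<phi>(3) \<pi>\<mu>[of inr'] inr'(3) dr(2) by (simp add: e_te dw_re)
  qed (simp_all add: hom_def)
  have e\<psi>: "e \<cdot> \<psi> = \<pi> \<cdot> n"
  proof (rule po_uniq[OF pn, of _ B])
    show "(e \<cdot> \<psi>) \<cdot> n1 = (\<pi> \<cdot> n) \<cdot> n1" using \<psi>(2) n(2) e\<phi> by simp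
    show "(e \<cdot> \<psi>) \<cdot> n2 = (\<pi> \<cdot> n) \<cdot> n2" using \<psi>(3) n(3) \<pi>l[of "ins d1 X"] by (simp add: \<iota>_def)
  qed (simp_all add: hom_def)
  obtain \<chi> where \<chi>: "\<chi> \<in> hom C M Y" "\<chi> \<cdot> n = \<psi>" "e \<cdot> \<chi> = \<pi>"
    by (rule lifting[OF n(1) e(1) nC e(2) disjI1[OF nW] \<psi>(1) \<pi>(1) e\<psi>])
  note [simp] = homD[OF \<chi>(1)]
  have \<chi>\<mu>: "\<chi> \<cdot> \<mu> = \<phi>" using reassoc[OF \<chi>(2) n(1) \<chi>(1), of n1] \<psi>(2) n(2) by simp
  have \<chi>\<iota>: "\<chi> \<cdot> \<iota> = w" using reassoc[OF \<chi>(2) n(1) \<chi>(1), of n2] \<psi>(3) n(3) by simp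
  note \<chi>\<mu>' = reassoc[OF \<chi>\<mu> \<mu> \<chi>(1)]
  have r1: "e \<cdot> (\<chi> \<cdot> inr) = e" using reassoc[OF \<chi>(3,1) e(1), of inr] \<pi>(3) by simp
  have r2: "te \<cdot> (dw \<cdot> dr) = (\<chi> \<cdot> inr) \<cdot> te" using \<chi>\<mu>'[of inr'] \<phi>(3) inr'(2) by simp
  \<comment> \<open>The restriction of \<open>\<chi>\<close> to \<open>Y\<close> is lifted to the
    glue object with boundary datum \<open>dr\<close>; below, its restriction to the cylinder is
    lifted with \<open>H\<close>.\<close>
  obtain r where r: "r \<in> hom C Y X" "w \<cdot> r = \<chi> \<cdot> inr" "r \<cdot> te = c \<cdot> dr"
    using glue_ex[OF pbe _ r1, of dr] dr r2 by (auto simp: hom_def)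
  note [simp] = homD[OF r(1)]
  have K1: "e \<cdot> (\<chi> \<cdot> inl) = (e \<cdot> w) \<cdot> prj X" using reassoc[OF \<chi>(3,1) e(1), of inl] \<pi>(2) by simp
  have K2: "te \<cdot> (dw \<cdot> H) = (\<chi> \<cdot> inl) \<cdot> cmap c" using \<chi>\<mu>'[of inl'] \<phi>(2) inl'(2) by simp
  obtain K where K: "K \<in> hom C (cyl X) X" "w \<cdot> K = \<chi> \<cdot> inl" "K \<cdot> cmap c = c \<cdot> H"
    using glue_ex[OF pb_sym[OF pbc] _ K1, of H] H K2 by (auto simp: hom_def)
  note [simp] = homD[OF K(1)]
  note wK = reassoc2[OF K(2,1) w inl \<chi>(1)]
  note Kc = reassoc2[OF K(3) cc K(1) H(1) c]
  have w0: "w \<cdot> (K \<cdot> ins d0 X) = w \<cdot> (r \<cdot> w)" using wK[of "ins d0 X"] ii reassoc2[OF r(2,1) w inr \<chi>(1), of w] by simp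
  have w1: "w \<cdot> (K \<cdot> ins d1 X) = w" using wK[of "ins d1 X"] \<chi>\<iota> by (simp add: \<iota>_def)
  \<comment> \<open>\<open>r\<close> and \<open>K\<close> were lifted separately, so their
    compatibility is verified by uniqueness: once after \<open>w\<close>, and once after restricting
    along \<open>c\<close>.\<close>
  have K0: "K \<cdot> ins d0 X = r \<cdot> w"
  proof (rule glue_uniq[OF pbE _ _ _ w0])
    show "(e \<cdot> w) \<cdot> (K \<cdot> ins d0 X) = e \<cdot> w" using w0 r(2) reassoc[OF r1 _ e(1), of Y w] reassoc2[OF r(2,1) w inr \<chi>(1), of w] by (simp add: hom_def)
    show "(K \<cdot> ins d0 X) \<cdot> c = (r \<cdot> w) \<cdot> c"
      using Kc[of "ins d0 A"] cmap_ins[OF d_hom(1), of c] H(3) reassoc2[OF r(3) te r(1) dr(1) c, of dw] wc by simp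
  qed (simp_all add: hom_def)
  have K1': "K \<cdot> ins d1 X = Id C X"
  proof (rule glue_uniq[OF pbE])
    show "w \<cdot> (K \<cdot> ins d1 X) = w \<cdot> Id C X" using w1 by simp
    show "(e \<cdot> w) \<cdot> (K \<cdot> ins d1 X) = e \<cdot> w" using w1 by simp
    show "(K \<cdot> ins d1 X) \<cdot> c = Id C X \<cdot> c"
      using Kc[of "ins d1 A"] cmap_ins[OF d_hom(2), of c] H(4) by simp
  qed (simp_all add: hom_def)
  show thesis
    by (rule that[OF r(1) K(1) _ _ K0 K1' r(3) K(3)]) (use r(2) r1 K(2) K1 in simp_all)
qed

end

section \<open>Passage between the chosen constructions and abstract glue data\<close>

context model_interval
begin

text \<open>The equation for \<open>c\<close> and \<open>glue_restrict\<close> accompanies the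
  interpretation because it translates results about the abstract restriction \<open>c\<close> back
  to the chosen base change of the glue object.\<close>

lemma glue_data_glue:
  assumes i: "is_mono C i" "i \<in> hom C D B" and e: "e \<in> hom C Y B" "e \<in> Fib" and a: "a \<in> hom C A D" "a \<in> Fib"
    and dw: "dw \<in> hom_over C a (base_change C i e)"
  shows "\<exists>c. glue_data C T I W Cof Fib d0 d1 i e a (base_change_top C i e) (base_change C i e) (unglue C i e a dw) c dw
      D B Y A (Dom C (base_change_top C i e)) (Dom C (glue C i e a dw)) \<and>
    c \<cdot> glue_restrict C i e a dw = base_change_top C i (glue C i e a dw)"
proof (rule glue_spec[OF i e(1) a(1) dw])
  note pb = glue_base[OF i e(1) a(1) dw]
  note [simp] = homD[OF i(2)] homD[OF e(1)] homD[OF a(1)]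
  fix c assume c: "is_pullback C c a (glue C i e a dw) i" "c \<in> hom C A (Dom C (glue C i e a dw))"
      "unglue C i e a dw \<cdot> c = base_change_top C i e \<cdot> dw"
    and ck: "c \<cdot> glue_restrict C i e a dw = base_change_top C i (glue C i e a dw)"
    and ex: "\<And>s t x u v. is_pullback C s t x i \<Longrightarrow> u \<in> hom C (Dom C x) Y \<Longrightarrow> e \<cdot> u = x \<Longrightarrow>
      v \<in> hom C (Dom C s) A \<Longrightarrow> a \<cdot> v = t \<Longrightarrow> base_change_top C i e \<cdot> (dw \<cdot> v) = u \<cdot> s \<Longrightarrow>
      \<exists>m. m \<in> hom C (Dom C x) (Dom C (glue C i e a dw)) \<and> unglue C i e a dw \<cdot> m = u \<and> m \<cdot> s = c \<cdot> v"
    and un: "\<And>s t x m n. is_pullback C s t x i \<Longrightarrow> m \<in> hom C (Dom C x) (Dom C (glue C i e a dw)) \<Longrightarrow>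
      glue C i e a dw \<cdot> m = x \<Longrightarrow> n \<in> hom C (Dom C x) (Dom C (glue C i e a dw)) \<Longrightarrow>
      unglue C i e a dw \<cdot> m = unglue C i e a dw \<cdot> n \<Longrightarrow> m \<cdot> s = n \<cdot> s \<Longrightarrow> m = n"
  have ax: "glue_data_axioms C Fib i e a (base_change_top C i e) (base_change C i e) (unglue C i e a dw) c dw
      D B Y A (Dom C (base_change_top C i e)) (Dom C (glue C i e a dw))"
  proof (rule glue_data_axioms.intro)
    show "base_change_top C i e \<in> hom C (Dom C (base_change_top C i e)) Y" "base_change C i e \<in> hom C (Dom C (base_change_top C i e)) D"
      using pbD(4-8)[OF pb] by (simp_all add: hom_def)
    show "is_pullback C c a (e \<cdot> unglue C i e a dw) i" using c(1) unfolding glue_def .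
    show "dw \<in> hom C A (Dom C (base_change_top C i e))" "base_change C i e \<cdot> dw = a"
      using hom_overD[OF dw] pbD(6)[OF pb] by simp_all
    fix s t x m n assume "is_pullback C s t x i" "m \<in> hom C (Dom C x) (Dom C (glue C i e a dw))"
      and "(e \<cdot> unglue C i e a dw) \<cdot> m = x"
      and "n \<in> hom C (Dom C x) (Dom C (glue C i e a dw))" "unglue C i e a dw \<cdot> m = unglue C i e a dw \<cdot> n" "m \<cdot> s = n \<cdot> s"
    then show "m = n" using un[of s t x m n] unfolding glue_def[symmetric] by blast
  qed (fact i e a pb unglue_hom[OF i e(1) a(1) dw] c ex)+
  show ?thesis using glue_data.intro[OF model_interval_axioms ax] ck by (intro exI conjI)
qed

text \<open>Turns a homotopy valued in a path object into a map out of the cylinder on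
  \<open>X\<close>; evaluation at \<open>d\<close> becomes restriction to that end.\<close>

lemma homotopy_uncurry:
  assumes x: "x \<in> hom C X B" and y: "y \<in> hom C Y B" and h: "h \<in> hom_over C x (path_obj C I y)"
  shows "h \<in> hom C X (Dom C (path_obj C I y))" "path_obj C I y \<cdot> h = x"
    "pev y \<cdot> cmap h \<in> hom C (cyl X) Y" "y \<cdot> (pev y \<cdot> cmap h) = x \<cdot> prj X"
    "d \<in> hom C T I \<Longrightarrow> path_ev C I d y \<cdot> h = (pev y \<cdot> cmap h) \<cdot> ins d X"
proof -
  note [simp] = homD[OF x] homD[OF y] path_typing[OF y] pev_typing[OF y]
  show h': "h \<in> hom C X (Dom C (path_obj C I y))" "path_obj C I y \<cdot> h = x" using hom_overD[OF h] by auto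
  note [simp] = homD[OF h'(1)]
  show "pev y \<cdot> cmap h \<in> hom C (cyl X) Y" by (simp add: hom_def)
  have "y \<cdot> (pev y \<cdot> cmap h) = path_obj C I y \<cdot> (h \<cdot> prj X)"
    using reassoc2[OF pev_over[OF y], of "cyl (Dom C (path_obj C I y))" Y B "Dom C (path_obj C I y)" "cmap h"] by (simp add: hom_def)
  then show "y \<cdot> (pev y \<cdot> cmap h) = x \<cdot> prj X" using reassoc[OF h'(2,1), of B "prj X"] by (simp add: hom_def)
  assume d: "d \<in> hom C T I"
  show "path_ev C I d y \<cdot> h = (pev y \<cdot> cmap h) \<cdot> ins d X"
    using path_ev_pev[OF y d] ins_nat[OF d, of h] d by (simp add: ins_typing[OF d])
qed

text \<open>Two comparison maps enter the restriction of a homotopy. Both disappear once the result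
  is uncurried and included into \<open>Y\<close>: what remains is precomposition with the cylinder
  on the base change projection.\<close>

lemma homotopy_restrict:
  assumes i: "i \<in> hom C D B" and x: "x \<in> hom C X B" and y: "y \<in> hom C Y B" and h: "h \<in> hom_over C x (path_obj C I y)"
  defines "k \<equiv> path_base_change C I i y \<cdot> base_change_map C i x (path_obj C I y) h"
  shows "k \<in> hom_over C (base_change C i x) (path_obj C I (base_change C i y))"
    "base_change_top C i y \<cdot> (pev (base_change C i y) \<cdot> cmap k) = (pev y \<cdot> cmap h) \<cdot> cmap (base_change_top C i x)"
proof -
  note u = homotopy_uncurry[OF x y h] and P = path_base_change_spec[OF i y]
  let ?p = "path_obj C I y" and ?y' = "base_change C i y"
  note [simp] = homD[OF i] homD[OF x] homD[OF y] path_typing[OF y] pev_typing[OF y] homD[OF u(1)]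
  have bx: "is_pullback C (base_change_top C i x) (base_change C i x) x i" by (rule base_change_pb) auto
  have bp: "is_pullback C (base_change_top C i ?p) (base_change C i ?p) ?p i" by (rule base_change_pb) auto
  have by': "is_pullback C (base_change_top C i y) ?y' y i" by (rule base_change_pb) auto
  note [simp] = pbD(4-8)[OF bx] pbD(4-8)[OF bp] pbD(4-8)[OF by'] path_typing[OF P(4)] pev_typing[OF P(4)] homD(1-3)[OF P(1)]
  have e: "?p \<cdot> (h \<cdot> base_change_top C i x) = i \<cdot> base_change C i x"
    using reassoc[OF u(2,1), of B "base_change_top C i x"] pbD(9)[OF bx] by (simp add: hom_def)
  have hx: "h \<cdot> base_change_top C i x \<in> hom C (Dom C (base_change_top C i x)) (Dom C ?p)"
    "base_change C i x \<in> hom C (Dom C (base_change_top C i x)) D" by (simp_all add: hom_def)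
  note b = bct_spec[OF i path_hom[OF y] hx e, folded base_change_map_def]
  note [simp] = homD(1-3)[OF b(1)]
  let ?b = "base_change_map C i x ?p h" and ?c = "path_base_change C I i y"
  have "path_obj C I ?y' \<cdot> k = base_change C i x"
    unfolding k_def using reassoc[OF P(2,1), of D ?b] b(3) by (simp add: hom_def)
  then show "k \<in> hom_over C (base_change C i x) (path_obj C I ?y')"
    by (simp add: hom_over_def hom_def k_def)
  have "base_change_top C i y \<cdot> (pev ?y' \<cdot> cmap k) = (base_change_top C i y \<cdot> (pev ?y' \<cdot> cmap ?c)) \<cdot> cmap ?b"
    unfolding k_def by (simp add: cmap_comp)
  also have "\<dots> = pev y \<cdot> cmap (base_change_top C i ?p \<cdot> ?b)" unfolding P(3) by (simp add: cmap_comp)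
  also have "\<dots> = (pev y \<cdot> cmap h) \<cdot> cmap (base_change_top C i x)" unfolding b(2) by (simp add: cmap_comp)
  finally show "base_change_top C i y \<cdot> (pev ?y' \<cdot> cmap k) = (pev y \<cdot> cmap h) \<cdot> cmap (base_change_top C i x)" .
qed

end

text \<open>The restrictions of the extended data agree with the given ones only up to canonical
  identifications, which are therefore explicit: \<open>\<kappa>\<close> for the glue object and
  \<open>path_base_change\<close> for path objects. The first conjunct certifies that
  \<open>\<kappa>\<close> is an isomorphism carrying \<open>dw\<close> to the restriction of
  \<open>w\<close>.\<close>

theorem theorem6p14:
  fixes C :: "('o, 'a) cat"
    and W Cof Fib :: "'a set"
    and T I :: 'o
    and d0 d1 i e a dw dr dHr ds dHs E w \<kappa> :: 'a
  assumes lccc: "locally_cartesian_closed C"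
    and model: "model_structure C W Cof Fib"
    and cof_mono: "Cof = {f. is_mono C f}"
    and pushout_product: "\<And>f g h. f \<in> Cof \<Longrightarrow> g \<in> Cof \<inter> W \<Longrightarrow>
      is_pushout_product C f g h \<Longrightarrow> h \<in> Cof \<inter> W"
    and cylinder: "good_cylinder_of_terminal C W Cof T I d0 d1"
    and disjoint: "disjoint_points C d0 d1"
    and proper: "right_proper C W Fib"
    and i: "i \<in> Cof"
    and e: "e \<in> Fib" "Cod C e = Cod C i"
    and a: "a \<in> Fib" "Cod C a = Dom C i"
    and dw: "dw \<in> hom_over C a (base_change C i e)"
    and dr: "dr \<in> hom_over C (base_change C i e) a"
    and dHr: "dHr \<in> hom_over C a (path_obj C I a)"
    and dHr0: "path_ev C I d0 a \<cdot>\<^bsub>C\<^esub> dHr = dr \<cdot>\<^bsub>C\<^esub> dw"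
    and dHr1: "path_ev C I d1 a \<cdot>\<^bsub>C\<^esub> dHr = Id C (Dom C a)"
    and ds: "ds \<in> hom_over C (base_change C i e) a"
    and dHs: "dHs \<in> hom_over C (base_change C i e) (path_obj C I (base_change C i e))"
    and dHs0: "path_ev C I d0 (base_change C i e) \<cdot>\<^bsub>C\<^esub> dHs = dw \<cdot>\<^bsub>C\<^esub> ds"
    and dHs1: "path_ev C I d1 (base_change C i e) \<cdot>\<^bsub>C\<^esub> dHs = Id C (Dom C (base_change C i e))"
    and E: "E = glue C i e a dw"
    and w: "w = unglue C i e a dw"
    and \<kappa>: "\<kappa> = glue_restrict C i e a dw"
  shows "(\<kappa> \<in> hom_over C (base_change C i E) a \<and> is_iso C \<kappa> \<and>
      base_change_map C i E e w = dw \<cdot>\<^bsub>C\<^esub> \<kappa>) \<and>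
    (\<exists>r \<in> hom_over C e E. \<exists>Hr \<in> hom_over C E (path_obj C I E).
      path_ev C I d0 E \<cdot>\<^bsub>C\<^esub> Hr = r \<cdot>\<^bsub>C\<^esub> w \<and>
      path_ev C I d1 E \<cdot>\<^bsub>C\<^esub> Hr = Id C (Dom C E) \<and>
      \<kappa> \<cdot>\<^bsub>C\<^esub> base_change_map C i e E r = dr \<and>
      path_map C I (base_change C i E) a \<kappa> \<cdot>\<^bsub>C\<^esub> path_base_change C I i E \<cdot>\<^bsub>C\<^esub>
        base_change_map C i E (path_obj C I E) Hr = dHr \<cdot>\<^bsub>C\<^esub> \<kappa>) \<and>
    (\<exists>s \<in> hom_over C e E. \<exists>Hs \<in> hom_over C e (path_obj C I e).
      path_ev C I d0 e \<cdot>\<^bsub>C\<^esub> Hs = w \<cdot>\<^bsub>C\<^esub> s \<and>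
      path_ev C I d1 e \<cdot>\<^bsub>C\<^esub> Hs = Id C (Dom C e) \<and>
      \<kappa> \<cdot>\<^bsub>C\<^esub> base_change_map C i e E s = ds \<and>
      path_base_change C I i e \<cdot>\<^bsub>C\<^esub> base_change_map C i e (path_obj C I e) Hs = dHs)"
proof -
  interpret category C using lccc by (simp add: locally_cartesian_closed_def)
  have fc: "finitely_complete C" using model unfolding model_structure_def by (elim conjE) assumption
  have trm: "is_terminal C T" and d0: "d0 \<in> hom C T I" and d1: "d1 \<in> hom C T I"
    using cylinder by (auto simp: good_cylinder_of_terminal_def)
  interpret model_interval C T I W Cof Fib d0 d1
    by unfold_locales (fact lccc fc trm homD(5)[OF d0] model cof_mono pushout_product cylinder disjoint)+
  define D where "D = Dom C i" define B where "B = Cod C i"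
  define Y where "Y = Dom C e" define A where "A = Dom C a"
  let ?te = "base_change_top C i e" and ?be = "base_change C i e"
  have im: "is_mono C i" and ih: "i \<in> hom C D B" using i cof_mono Cof_arr[OF i] by (auto simp: hom_def D_def B_def)
  have eh: "e \<in> hom C Y B" and ah: "a \<in> hom C A D"
    using Fib_arr[OF e(1)] Fib_arr[OF a(1)] e a by (auto simp: hom_def D_def B_def Y_def A_def)
  note glue_facts = im ih eh ah dw
  obtain c where GD: "glue_data C T I W Cof Fib d0 d1 i e a ?te ?be w c dw D B Y A (Dom C ?te) (Dom C E)"
    and ck: "c \<cdot>\<^bsub>C\<^esub> \<kappa> = base_change_top C i E"
    using glue_data_glue[OF im ih eh e(1) ah a(1) dw, folded E w \<kappa>] by blast
  define Y' where "Y' = Dom C ?te"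
  define X where "X = Dom C E"
  interpret G: glue_data C T I W Cof Fib d0 d1 i e a ?te ?be w c dw D B Y A Y' X
    using GD unfolding Y'_def X_def .
  have Ew: "E = e \<cdot>\<^bsub>C\<^esub> w" by (simp add: E w glue_def)
  have Eh: "E \<in> hom C X B" unfolding Ew by (simp add: hom_def)
  note \<kappa>h = hom_overD[OF glue_kappa[OF glue_facts, folded E \<kappa>]]
  have pbE: "is_pullback C (base_change_top C i E) (base_change C i E) E i"
    by (rule base_change_pb) (use homD[OF Eh] in simp_all)
  define X' where "X' = Dom C (base_change_top C i E)"
  have tE: "base_change_top C i E \<in> hom C X' X" and bE: "base_change C i E \<in> hom C X' D"
    using pbD[OF pbE] homD[OF Eh] by (simp_all add: hom_def X'_def)
  have \<kappa>h: "\<kappa> \<in> hom C X' A" "a \<cdot>\<^bsub>C\<^esub> \<kappa> = base_change C i E" using \<kappa>h homD[OF bE] by simp_all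
  note [simp] = homD[OF Eh] homD[OF tE] homD[OF bE] homD[OF \<kappa>h(1)]
  have drh: "dr \<in> hom C Y' A" "a \<cdot>\<^bsub>C\<^esub> dr = ?be" using hom_overD[OF dr] by simp_all
  have dsh: "ds \<in> hom C Y' A" "a \<cdot>\<^bsub>C\<^esub> ds = ?be" using hom_overD[OF ds] by simp_all
  note [simp] = homD[OF drh(1)] homD[OF dsh(1)]
  \<comment> \<open>The given homotopies, uncurried to maps on cylinders.\<close>
  define H where "H = pev a \<cdot>\<^bsub>C\<^esub> cmap dHr"
  define K where "K = pev ?be \<cdot>\<^bsub>C\<^esub> cmap dHs"
  note uH = homotopy_uncurry[OF ah ah dHr, folded H_def] and uK = homotopy_uncurry[OF G.be G.be dHs, folded K_def]
  have H: "H \<cdot>\<^bsub>C\<^esub> ins d0 A = dr \<cdot>\<^bsub>C\<^esub> dw" "H \<cdot>\<^bsub>C\<^esub> ins d1 A = Id C A" using uH(5) d0 d1 dHr0 dHr1 by simp_all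
  have K: "K \<cdot>\<^bsub>C\<^esub> ins d0 Y' = dw \<cdot>\<^bsub>C\<^esub> ds" "K \<cdot>\<^bsub>C\<^esub> ins d1 Y' = Id C Y'" using uK(5) d0 d1 dHs0 dHs1 by simp_all
  have dwW: "dw \<in> W" by (rule G.boundary_W[OF drh(1) uH(3) H dsh(1) uK(3) K])
  \<comment> \<open>Restriction over the chosen base change is compared with restriction along
    \<open>c\<close> and \<open>te\<close>: \<open>c\<close> is mono, and \<open>c\<close> after
    \<open>\<kappa>\<close> is the base change projection of \<open>E\<close>.\<close>
  have restrict: "\<kappa> \<cdot>\<^bsub>C\<^esub> base_change_map C i e E f = f'"
    if f: "f \<in> hom C Y X" "E \<cdot>\<^bsub>C\<^esub> f = e" and f': "f' \<in> hom C Y' A" "f \<cdot>\<^bsub>C\<^esub> ?te = c \<cdot>\<^bsub>C\<^esub> f'" for f f'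
  proof (rule monoD[OF G.c_mono G.c, of _ Y'])
    note [simp] = homD[OF f(1)] homD[OF f'(1)]
    have "E \<cdot>\<^bsub>C\<^esub> (f \<cdot>\<^bsub>C\<^esub> ?te) = i \<cdot>\<^bsub>C\<^esub> ?be" using reassoc[OF f(2,1) Eh, of ?te] G.e_te(1) by simp
    note b = bct_spec[OF ih Eh _ G.be this, folded base_change_map_def]
    have b1: "base_change_map C i e E f \<in> hom C Y' X'" and b2: "base_change_top C i E \<cdot>\<^bsub>C\<^esub> base_change_map C i e E f = f \<cdot>\<^bsub>C\<^esub> ?te"
      using b(1,2) by (simp_all add: hom_def)
    note [simp] = homD[OF b1]
    show "\<kappa> \<cdot>\<^bsub>C\<^esub> base_change_map C i e E f \<in> hom C Y' A" by (simp add: hom_def)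
    show "c \<cdot>\<^bsub>C\<^esub> \<kappa> \<cdot>\<^bsub>C\<^esub> base_change_map C i e E f = c \<cdot>\<^bsub>C\<^esub> f'"
      using reassoc[OF ck \<kappa>h(1) G.c, of "base_change_map C i e E f"] b2 f'(2) by simp
  qed (rule f')
  have part2: "\<exists>s \<in> hom_over C e E. \<exists>Hs \<in> hom_over C e (path_obj C I e).
      path_ev C I d0 e \<cdot>\<^bsub>C\<^esub> Hs = w \<cdot>\<^bsub>C\<^esub> s \<and>
      path_ev C I d1 e \<cdot>\<^bsub>C\<^esub> Hs = Id C (Dom C e) \<and>
      \<kappa> \<cdot>\<^bsub>C\<^esub> base_change_map C i e E s = ds \<and>
      path_base_change C I i e \<cdot>\<^bsub>C\<^esub> base_change_map C i e (path_obj C I e) Hs = dHs"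
  proof -
    obtain s L where s: "s \<in> hom C Y X" and L: "L \<in> hom C (cyl Y) Y" "e \<cdot>\<^bsub>C\<^esub> L = e \<cdot>\<^bsub>C\<^esub> prj Y"
      "L \<cdot>\<^bsub>C\<^esub> ins d0 Y = w \<cdot>\<^bsub>C\<^esub> s" "L \<cdot>\<^bsub>C\<^esub> ins d1 Y = Id C Y"
      and sL: "s \<cdot>\<^bsub>C\<^esub> ?te = c \<cdot>\<^bsub>C\<^esub> ds" "L \<cdot>\<^bsub>C\<^esub> cmap ?te = ?te \<cdot>\<^bsub>C\<^esub> K"
      by (rule G.section_extension[OF dsh uK(3,4) K])
    note [simp] = homD[OF s] homD[OF L(1)]
    obtain Hs where Hs: "Hs \<in> hom C Y (Dom C (path_obj C I e))" "path_obj C I e \<cdot>\<^bsub>C\<^esub> Hs = e" "pev e \<cdot>\<^bsub>C\<^esub> cmap Hs = L"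
      using path_map_ex[OF eh eh L(1,2)] by blast
    have Hso: "Hs \<in> hom_over C e (path_obj C I e)" using Hs by (simp add: hom_over_def)
    note u = homotopy_uncurry[OF eh eh Hso, unfolded Hs(3)]
    have es: "E \<cdot>\<^bsub>C\<^esub> s = e"
    proof -
      have "E \<cdot>\<^bsub>C\<^esub> s = e \<cdot>\<^bsub>C\<^esub> (L \<cdot>\<^bsub>C\<^esub> ins d0 Y)" unfolding Ew L(3) by simp
      also have "\<dots> = e" using reassoc2[OF L(2,1) eh _ eh, of "ins d0 Y"] by (simp add: hom_def)
      finally show ?thesis .
    qed
    note R = homotopy_restrict[OF ih eh eh Hso, unfolded Hs(3)]
    let ?k = "path_base_change C I i e \<cdot>\<^bsub>C\<^esub> base_change_map C i e (path_obj C I e) Hs"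
    note uk = homotopy_uncurry[OF G.be G.be R(1)]
    \<comment> \<open>The mono \<open>te\<close> reduces the comparison of the restricted homotopies
      to one in \<open>Y\<close>.\<close>
    have "pev ?be \<cdot>\<^bsub>C\<^esub> cmap ?k = K"
      by (rule monoD[OF G.te_mono G.te uk(3) uK(3)]) (use R(2) sL(2) in simp)
    then have "?k = dHs" by (intro path_map_uniq[OF G.be G.be uk(1,2) uK(1,2)]) (simp add: K_def)
    moreover have "s \<in> hom_over C e E" using s es by (simp add: hom_over_def)
    ultimately show ?thesis
      using Hso u(5)[OF d0] u(5)[OF d1] L restrict[OF s es dsh(1) sL(1)] by (intro bexI[of _ s] bexI[of _ Hs]) simp_all
  qed
  have part1: "\<exists>r \<in> hom_over C e E. \<exists>Hr \<in> hom_over C E (path_obj C I E).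
      path_ev C I d0 E \<cdot>\<^bsub>C\<^esub> Hr = r \<cdot>\<^bsub>C\<^esub> w \<and>
      path_ev C I d1 E \<cdot>\<^bsub>C\<^esub> Hr = Id C (Dom C E) \<and>
      \<kappa> \<cdot>\<^bsub>C\<^esub> base_change_map C i e E r = dr \<and>
      path_map C I (base_change C i E) a \<kappa> \<cdot>\<^bsub>C\<^esub> path_base_change C I i E \<cdot>\<^bsub>C\<^esub>
        base_change_map C i E (path_obj C I E) Hr = dHr \<cdot>\<^bsub>C\<^esub> \<kappa>"
  proof -
    obtain r L where r: "r \<in> hom C Y X" and L: "L \<in> hom C (cyl X) X" and er: "e \<cdot>\<^bsub>C\<^esub> (w \<cdot>\<^bsub>C\<^esub> r) = e"
      and eL: "e \<cdot>\<^bsub>C\<^esub> (w \<cdot>\<^bsub>C\<^esub> L) = e \<cdot>\<^bsub>C\<^esub> (w \<cdot>\<^bsub>C\<^esub> prj X)"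
      and L01: "L \<cdot>\<^bsub>C\<^esub> ins d0 X = r \<cdot>\<^bsub>C\<^esub> w" "L \<cdot>\<^bsub>C\<^esub> ins d1 X = Id C X"
      and rL: "r \<cdot>\<^bsub>C\<^esub> ?te = c \<cdot>\<^bsub>C\<^esub> dr" "L \<cdot>\<^bsub>C\<^esub> cmap c = c \<cdot>\<^bsub>C\<^esub> H"
      by (rule G.retraction_extension[OF G.unglue_W[OF dwW] dwW drh uH(3,4) H])
    note [simp] = homD[OF r] homD[OF L]
    have Er: "E \<cdot>\<^bsub>C\<^esub> r = e" and EL: "E \<cdot>\<^bsub>C\<^esub> L = E \<cdot>\<^bsub>C\<^esub> prj X" unfolding Ew using er eL by simp_all
    obtain Hr where Hr: "Hr \<in> hom C X (Dom C (path_obj C I E))" "path_obj C I E \<cdot>\<^bsub>C\<^esub> Hr = E" "pev E \<cdot>\<^bsub>C\<^esub> cmap Hr = L"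
      using path_map_ex[OF Eh Eh L EL] by blast
    have Hro: "Hr \<in> hom_over C E (path_obj C I E)" using Hr by (simp add: hom_over_def)
    note u = homotopy_uncurry[OF Eh Eh Hro, unfolded Hr(3)]
    note R = homotopy_restrict[OF ih Eh Eh Hro, unfolded Hr(3)]
    let ?k = "path_base_change C I i E \<cdot>\<^bsub>C\<^esub> base_change_map C i E (path_obj C I E) Hr"
    note uk = homotopy_uncurry[OF bE bE R(1)]
    note pm = path_map_spec[OF bE ah \<kappa>h]
    let ?m = "path_map C I (base_change C i E) a \<kappa>"
    note [simp] = homD(1-3)[OF uk(1)] homD(1-3)[OF uk(3)] homD(1-3)[OF pm(1)] homD(1-3)[OF uH(1)] homD(1-3)[OF uH(3)]
      path_typing[OF ah] pev_typing[OF ah] path_typing[OF bE] pev_typing[OF bE]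
    have "?m \<cdot>\<^bsub>C\<^esub> ?k = dHr \<cdot>\<^bsub>C\<^esub> \<kappa>"
    proof (rule path_map_uniq[OF ah bE])
      show "?m \<cdot>\<^bsub>C\<^esub> ?k \<in> hom C X' (Dom C (path_obj C I a))" "dHr \<cdot>\<^bsub>C\<^esub> \<kappa> \<in> hom C X' (Dom C (path_obj C I a))"
        using comp_hom[OF uk(1) pm(1)] comp_hom[OF \<kappa>h(1) uH(1)] by simp_all
      show "path_obj C I a \<cdot>\<^bsub>C\<^esub> ?m \<cdot>\<^bsub>C\<^esub> ?k = base_change C i E"
        using reassoc[OF pm(2,1) path_hom[OF ah], of ?k] uk(2) by simp
      show "path_obj C I a \<cdot>\<^bsub>C\<^esub> dHr \<cdot>\<^bsub>C\<^esub> \<kappa> = base_change C i E"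
        using reassoc[OF uH(2,1) path_hom[OF ah], of \<kappa>] \<kappa>h(2) by simp
      have l: "pev a \<cdot>\<^bsub>C\<^esub> cmap (?m \<cdot>\<^bsub>C\<^esub> ?k) = \<kappa> \<cdot>\<^bsub>C\<^esub> (pev (base_change C i E) \<cdot>\<^bsub>C\<^esub> cmap ?k)"
      proof -
        have "pev a \<cdot>\<^bsub>C\<^esub> cmap (?m \<cdot>\<^bsub>C\<^esub> ?k) = (pev a \<cdot>\<^bsub>C\<^esub> cmap ?m) \<cdot>\<^bsub>C\<^esub> cmap ?k" using cmap_comp[of ?k ?m] by simp
        then show ?thesis unfolding pm(3) by simp
      qed
      have q: "pev a \<cdot>\<^bsub>C\<^esub> cmap (dHr \<cdot>\<^bsub>C\<^esub> \<kappa>) = H \<cdot>\<^bsub>C\<^esub> cmap \<kappa>" unfolding H_def by (simp add: cmap_comp)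
      \<comment> \<open>Likewise the mono \<open>c\<close> moves the comparison into the glue
        object, where \<open>L\<close> restricts to \<open>H\<close>.\<close>
      have "\<kappa> \<cdot>\<^bsub>C\<^esub> (pev (base_change C i E) \<cdot>\<^bsub>C\<^esub> cmap ?k) = H \<cdot>\<^bsub>C\<^esub> cmap \<kappa>"
      proof (rule monoD[OF G.c_mono G.c, of _ "cyl X'"])
        show "\<kappa> \<cdot>\<^bsub>C\<^esub> (pev (base_change C i E) \<cdot>\<^bsub>C\<^esub> cmap ?k) \<in> hom C (cyl X') A" using comp_hom[OF uk(3) \<kappa>h(1)] .
        show "H \<cdot>\<^bsub>C\<^esub> cmap \<kappa> \<in> hom C (cyl X') A" by (simp add: hom_def)
        have "c \<cdot>\<^bsub>C\<^esub> (\<kappa> \<cdot>\<^bsub>C\<^esub> (pev (base_change C i E) \<cdot>\<^bsub>C\<^esub> cmap ?k)) = L \<cdot>\<^bsub>C\<^esub> cmap (base_change_top C i E)"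
          using reassoc[OF ck \<kappa>h(1) G.c, of "pev (base_change C i E) \<cdot>\<^bsub>C\<^esub> cmap ?k"] R(2) uk(3) by simp
        also have "\<dots> = L \<cdot>\<^bsub>C\<^esub> (cmap c \<cdot>\<^bsub>C\<^esub> cmap \<kappa>)" using cmap_comp[of \<kappa> c] ck by simp
        also have "\<dots> = c \<cdot>\<^bsub>C\<^esub> (H \<cdot>\<^bsub>C\<^esub> cmap \<kappa>)"
          using reassoc2[OF rL(2) _ L uH(3) G.c, of "cmap \<kappa>"] by (simp add: hom_def)
        finally show "c \<cdot>\<^bsub>C\<^esub> (\<kappa> \<cdot>\<^bsub>C\<^esub> (pev (base_change C i E) \<cdot>\<^bsub>C\<^esub> cmap ?k)) = c \<cdot>\<^bsub>C\<^esub> (H \<cdot>\<^bsub>C\<^esub> cmap \<kappa>)" .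
      qed
      then show "pev a \<cdot>\<^bsub>C\<^esub> cmap (?m \<cdot>\<^bsub>C\<^esub> ?k) = pev a \<cdot>\<^bsub>C\<^esub> cmap (dHr \<cdot>\<^bsub>C\<^esub> \<kappa>)" using l q by simp
    qed
    moreover have "r \<in> hom_over C e E" using r Er by (simp add: hom_over_def)
    ultimately show ?thesis
      using Hro u(5)[OF d0] u(5)[OF d1] L01 restrict[OF r Er drh(1) rL(1)] by (intro bexI[of _ r] bexI[of _ Hr]) simp_all
  qed
  show ?thesis
    using glue_kappa[OF glue_facts] glue_restrict_iso[OF glue_facts] unglue_restrict[OF glue_facts] part1 part2
    unfolding E w \<kappa> by blast
qed

end
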